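(* Let $u$ be the mild solution, for each noise level $\lambda>0$, of the stochastic heat equation on $(0,L)$ with Neumann boundary conditions $$\partial_t u_t(x)=\tfrac12\Delta u_t(x)+\lambda\,\sigma(u_t(x))\,\dot w(t,x),\qquad \partial_xu_t(0)=\partial_xu_t(L)=0,$$ with initial function $u_0$. Set $$\mathcal I_t(\lambda):=\inf_{x\in[0,L]}\mathrm E|u_t(x)|^2,\qquad \mathcal S_t(\lambda):=\sup_{x\in[0,L]}\mathrm E|u_t(x)|^2 .$$ Fix $t>0$. Then $$\liminf_{\lambda\to\infty}\frac{\log\log\mathcal I_t(\lambda)}{\log\lambda}=\limsup_{\lambda\to\infty}\frac{\log\log\mathcal S_t(\lambda)}{\log\lambda}=4 .$$
   Context: Fix $L>0$. $\dot w$ denotes space-time white noise on $(0,\infty)\times(0,L)$ and $\lambda>0$ is the level of the noise. Assumptions on $\sigma$: $\sigma:\mathbf R\to\mathbf R$ is Lipschitz continuous, $\sigma(0)=0$, and with $l_\sigma:=\inf_{x\ne0}|\sigma(x)/x|$ and $L_\sigma:=\sup_{x\neq 0}|\sigma(x)/x|$ one has $0<l_\sigma\le L_\sigma<\infty$. Assumptions on $u_0$: $u_0:[0,L]\to[0,\infty)$ is a nonrandom, bounded, measurable function, compactly supported in $[0,L]$, and not almost everywhere zero (it is not required to be bounded below away from zero). Neither $\sigma$ nor $u_0$ depends on $\lambda$. Mild solution: let $p_N(t,x,y)$ be the Neumann heat kernel on $[0,L]$ (the fundamental solution of $\partial_t=\frac12\Delta$ on $(0,L)$ with zero normal derivative at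 the boundary). The mild solution is the unique predictable random field $u$ (with respect to the filtration of the white noise) with initial function $u_0$ such that $\sup_{x\in[0,L]}\sup_{t\in[0,T]}\mathrm E|u_t(x)|^k<\infty$ for all $T>0$ and $k\in[2,\infty)$ and, almost surely for each $t>0$ and $x\in[0,L]$, $$u_t(x)=\int_0^L u_0(y)p_N(t,x,y)\,dy+\lambda\int_0^L\int_0^t p_N(t-s,x,y)\,\sigma(u_s(y))\,w(ds\,dy),$$ the last integral being a Walsh stochastic integral. Existence and uniqueness of this solution are known. Convention: $\log\log r:=-\infty$ for $r\le1$. *)

theory Defs
  imports "HOL-Probability.Probability"
begin

section \<open>The Neumann heat kernel\<close>

text \<open>
  The kernel is characterised as the fundamental solution of
  \<open>\<partial>\<^sub>t = \<Delta> / 2\<close> on the interval: a classical solution of the equation in \<open>(t, x)\<close> for each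
  \<open>y\<close>, with zero derivative in \<open>x\<close> at both end points, whose initial value is the unit mass
  at the diagonal. Derivatives in \<open>x\<close> are one-sided at \<open>0\<close> and \<open>L\<close>. The predicate determines
  \<open>p\<close> on \<open>(0,\<infinity>) \<times> [0,L] \<times> [0,L]\<close>; other values of \<open>p\<close> are irrelevant.
\<close>

definition neumann_heat_kernel :: "real \<Rightarrow> (real \<Rightarrow> real \<Rightarrow> real \<Rightarrow> real) \<Rightarrow> bool" where
  "neumann_heat_kernel L p \<longleftrightarrow>
     (\<exists>pt px pxx.
        (\<forall>t>0. \<forall>x\<in>{0..L}. \<forall>y\<in>{0..L}.
           ((\<lambda>s. p s x y) has_real_derivative pt t x y) (at t) \<and>
           ((\<lambda>z. p t z y) has_real_derivative px t x y) (at x within {0..L}) \<and>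
           ((\<lambda>z. px t z y) has_real_derivative pxx t x y) (at x within {0..L}) \<and>
           pt t x y = 1/2 * pxx t x y) \<and>
        (\<forall>t>0. \<forall>y\<in>{0..L}. px t 0 y = 0 \<and> px t L y = 0) \<and>
        (\<forall>q\<in>{p, pt, px, pxx}.
           continuous_on ({0<..} \<times> {0..L} \<times> {0..L}) (\<lambda>(t, x, y). q t x y))) \<and>
     (\<forall>f :: real \<Rightarrow> real. continuous_on {0..L} f \<longrightarrow>
        uniform_limit {0..L} (\<lambda>t x. LBINT y:{0..L}. p t x y * f y) f (at_right 0))"


section \<open>Space-time white noise\<close>

definition centered_gaussian :: "'a measure \<Rightarrow> ('a \<Rightarrow> real) \<Rightarrow> bool" where
  "centered_gaussian M X \<longleftrightarrow>
     X \<in> borel_measurable M \<and>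
     ((AE \<omega> in M. X \<omega> = 0) \<or>
      (\<exists>s>0. distributed M lborel X (\<lambda>x. ennreal (normal_density 0 s x))))"

definition noise_sets :: "real \<Rightarrow> (real \<times> real) set set" where
  "noise_sets L =
     {A \<in> sets borel. A \<subseteq> {0<..} \<times> {0<..<L} \<and> emeasure lborel A < \<infinity>}"

text \<open>
  White noise on \<open>(0,\<infinity>) \<times> (0,L)\<close> is a centred Gaussian family (all finite linear
  combinations are Gaussian) indexed by the Borel sets of finite area, with covariance the
  area of the intersection.
\<close>

definition white_noise ::
    "'a measure \<Rightarrow> real \<Rightarrow> ((real \<times> real) set \<Rightarrow> 'a \<Rightarrow> real) \<Rightarrow> bool" where
  "white_noise M L W \<longleftrightarrow>
     (\<forall>\<A> c. finite \<A> \<and> \<A> \<subseteq> noise_sets L \<longrightarrow>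
        centered_gaussian M (\<lambda>\<omega>. \<Sum>A\<in>\<A>. c A * W A \<omega>)) \<and>
     (\<forall>A\<in>noise_sets L. \<forall>B\<in>noise_sets L.
        (\<integral>\<omega>. W A \<omega> * W B \<omega> \<partial>M) = measure lborel (A \<inter> B))"

text \<open>The filtration of the noise, augmented by the null sets of the probability space.\<close>

definition noise_filtration ::
    "'a measure \<Rightarrow> real \<Rightarrow> ((real \<times> real) set \<Rightarrow> 'a \<Rightarrow> real) \<Rightarrow> real \<Rightarrow> 'a measure" where
  "noise_filtration M L W t =
     sigma (space M)
       ({W A -` B \<inter> space M |A B. A \<in> noise_sets L \<and> A \<subseteq> {0<..t} \<times> UNIV \<and> B \<in> sets borel}
        \<union> null_sets M)"


section \<open>Predictable random fields and the Walsh integral\<close>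

definition predictable_algebra ::
    "'a measure \<Rightarrow> real \<Rightarrow> ((real \<times> real) set \<Rightarrow> 'a \<Rightarrow> real) \<Rightarrow> (real \<times> real \<times> 'a) measure" where
  "predictable_algebra M L W =
     sigma ({0<..} \<times> {0..L} \<times> space M)
       {{a<..b} \<times> A \<times> F |a b A F.
          0 \<le> a \<and> a < b \<and> A \<in> sets borel \<and> A \<subseteq> {0..L} \<and> F \<in> sets (noise_filtration M L W a)}"

definition predictable ::
    "'a measure \<Rightarrow> real \<Rightarrow> ((real \<times> real) set \<Rightarrow> 'a \<Rightarrow> real) \<Rightarrow> (real \<Rightarrow> real \<Rightarrow> 'a \<Rightarrow> real) \<Rightarrow> bool" where
  "predictable M L W \<Phi> \<longleftrightarrow>
     (\<lambda>(s, y, \<omega>). \<Phi> s y \<omega>) \<in> borel_measurable (predictable_algebra M L W)"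

text \<open>
  A simple field is a finite sum of elementary fields
  \<open>X(\<omega>) 1\<^bsub>(a,b]\<^esub>(s) 1\<^bsub>A\<^esub>(y)\<close>, coded as the list of the tuples \<open>(X, a, b, A)\<close>.
\<close>

type_synonym 'a simple_field = "(('a \<Rightarrow> real) \<times> real \<times> real \<times> real set) list"

definition is_simple_field ::
    "'a measure \<Rightarrow> real \<Rightarrow> ((real \<times> real) set \<Rightarrow> 'a \<Rightarrow> real) \<Rightarrow> 'a simple_field \<Rightarrow> bool" where
  "is_simple_field M L W h \<longleftrightarrow>
     (\<forall>(X, a, b, A)\<in>set h.
        0 \<le> a \<and> a < b \<and> A \<in> sets borel \<and> A \<subseteq> {0<..<L} \<and>
        X \<in> borel_measurable (noise_filtration M L W a) \<and> bounded (X ` space M))"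

definition simple_field_value :: "'a simple_field \<Rightarrow> real \<Rightarrow> real \<Rightarrow> 'a \<Rightarrow> real" where
  "simple_field_value h s y \<omega> =
     (\<Sum>(X, a, b, A)\<leftarrow>h. X \<omega> * indicator ({a<..b} \<times> A) (s, y))"

definition simple_walsh_integral ::
    "((real \<times> real) set \<Rightarrow> 'a \<Rightarrow> real) \<Rightarrow> 'a simple_field \<Rightarrow> 'a \<Rightarrow> real" where
  "simple_walsh_integral W h \<omega> = (\<Sum>(X, a, b, A)\<leftarrow>h. X \<omega> * W ({a<..b} \<times> A) \<omega>)"

text \<open>
  The Walsh integral over \<open>(0,\<infinity>) \<times> (0,L)\<close> of a predictable field is the isometric extension
  of the integral of simple fields, from \<open>L\<^sup>2(ds dy dP)\<close> to \<open>L\<^sup>2(P)\<close>. It is defined only up to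
  null events, hence the relation instead of a function.
\<close>

definition has_walsh_integral ::
    "'a measure \<Rightarrow> real \<Rightarrow> ((real \<times> real) set \<Rightarrow> 'a \<Rightarrow> real) \<Rightarrow>
     (real \<Rightarrow> real \<Rightarrow> 'a \<Rightarrow> real) \<Rightarrow> ('a \<Rightarrow> real) \<Rightarrow> bool" where
  "has_walsh_integral M L W \<Phi> I \<longleftrightarrow>
     predictable M L W \<Phi> \<and>
     I \<in> borel_measurable M \<and>
     (\<exists>h. (\<forall>n. is_simple_field M L W (h n)) \<and>
        (\<lambda>n. \<integral>\<^sup>+ (s, y, \<omega>).
               ennreal ((\<Phi> s y \<omega> - simple_field_value (h n) s y \<omega>)\<^sup>2)
               * indicator ({0<..} \<times> {0<..<L}) (s, y)
             \<partial>(lborel \<Otimes>\<^sub>M lborel \<Otimes>\<^sub>M M)) \<longlonglongrightarrow> 0 \<and>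
        (\<lambda>n. \<integral>\<^sup>+ \<omega>. ennreal ((I \<omega> - simple_walsh_integral W (h n) \<omega>)\<^sup>2) \<partial>M) \<longlonglongrightarrow> 0)"


section \<open>Mild solutions\<close>

definition mild_solution ::
    "'a measure \<Rightarrow> real \<Rightarrow> ((real \<times> real) set \<Rightarrow> 'a \<Rightarrow> real) \<Rightarrow>
     (real \<Rightarrow> real \<Rightarrow> real \<Rightarrow> real) \<Rightarrow> (real \<Rightarrow> real) \<Rightarrow> (real \<Rightarrow> real) \<Rightarrow> real \<Rightarrow>
     (real \<Rightarrow> real \<Rightarrow> 'a \<Rightarrow> real) \<Rightarrow> bool" where
  "mild_solution M L W p \<sigma> u0 lam u \<longleftrightarrow>
     predictable M L W u \<and>
     (\<forall>x\<in>{0..L}. AE \<omega> in M. u 0 x \<omega> = u0 x) \<and>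
     (\<forall>T>0. \<forall>k\<ge>2.
        (SUP x\<in>{0..L}. SUP t\<in>{0..T}. \<integral>\<^sup>+ \<omega>. ennreal (\<bar>u t x \<omega>\<bar> powr k) \<partial>M) < \<infinity>) \<and>
     (\<forall>t>0. \<forall>x\<in>{0..L}. \<exists>I.
        has_walsh_integral M L W
          (\<lambda>s y \<omega>. if s < t then p (t - s) x y * \<sigma> (u s y \<omega>) else 0) I \<and>
        (AE \<omega> in M. u t x \<omega> = (LBINT y:{0..L}. u0 y * p t x y) + lam * I \<omega>))"


section \<open>Hypotheses on the coefficients, and the moment functionals\<close>

definition lower_slope :: "(real \<Rightarrow> real) \<Rightarrow> ereal" where
  "lower_slope \<sigma> = (INF x\<in>-{0}. ereal \<bar>\<sigma> x / x\<bar>)"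

definition upper_slope :: "(real \<Rightarrow> real) \<Rightarrow> ereal" where
  "upper_slope \<sigma> = (SUP x\<in>-{0}. ereal \<bar>\<sigma> x / x\<bar>)"

definition admissible_sigma :: "(real \<Rightarrow> real) \<Rightarrow> bool" where
  "admissible_sigma \<sigma> \<longleftrightarrow>
     (\<exists>C. C-lipschitz_on UNIV \<sigma>) \<and> \<sigma> 0 = 0 \<and>
     0 < lower_slope \<sigma> \<and> lower_slope \<sigma> \<le> upper_slope \<sigma> \<and> upper_slope \<sigma> < \<infinity>"

definition admissible_initial :: "real \<Rightarrow> (real \<Rightarrow> real) \<Rightarrow> bool" where
  "admissible_initial L u0 \<longleftrightarrow>
     u0 \<in> borel_measurable (restrict_space borel {0..L}) \<and>
     (\<forall>x\<in>{0..L}. 0 \<le> u0 x) \<and>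
     bounded (u0 ` {0..L}) \<and>
     compact (closure {x\<in>{0..L}. u0 x \<noteq> 0}) \<and> closure {x\<in>{0..L}. u0 x \<noteq> 0} \<subseteq> {0..L} \<and>
     \<not> (AE x in lborel. x \<in> {0..L} \<longrightarrow> u0 x = 0)"

definition inf_second_moment ::
    "'a measure \<Rightarrow> real \<Rightarrow> (real \<Rightarrow> real \<Rightarrow> 'a \<Rightarrow> real) \<Rightarrow> real \<Rightarrow> real" where
  "inf_second_moment M L u t = (INF x\<in>{0..L}. \<integral>\<omega>. \<bar>u t x \<omega>\<bar>\<^sup>2 \<partial>M)"

definition sup_second_moment ::
    "'a measure \<Rightarrow> real \<Rightarrow> (real \<Rightarrow> real \<Rightarrow> 'a \<Rightarrow> real) \<Rightarrow> real \<Rightarrow> real" where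
  "sup_second_moment M L u t = (SUP x\<in>{0..L}. \<integral>\<omega>. \<bar>u t x \<omega>\<bar>\<^sup>2 \<partial>M)"

definition loglog :: "real \<Rightarrow> ereal" where
  "loglog r = (if r \<le> 1 then -\<infinity> else ereal (ln (ln r)))"

end

theory Submission
  imports Defs "HOL-Real_Asymp.Real_Asymp"
begin

text \<open>
  By the isometry of the Walsh integral, \<open>F t x = E |u\<^sub>t(x)|\<^sup>2\<close> satisfies, up to the constants that compare
  \<open>\<sigma>(z)\<^sup>2\<close> with \<open>z\<^sup>2\<close>, the renewal equation
  \<open>F t x = (P\<^sub>t u\<^sub>0)(x)\<^sup>2 + \<lambda>\<^sup>2 \<integral>\<integral> p\<^sub>t\<^sub>-\<^sub>s(x, y)\<^sup>2 F s y dy ds\<close>, and \<open>\<integral> p\<^sub>r(x, y)\<^sup>2 dy\<close> is of order \<open>1 / \<surd>r\<close>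
  uniformly in \<open>x\<close>. Upper bound: with \<open>\<beta>\<close> a large multiple of \<open>\<lambda>\<^sup>4\<close>, the supremum \<open>S\<close> of
  \<open>exp (- \<beta> s) F s y\<close> satisfies \<open>S \<le> C + S / 2\<close>. Lower bound: by positivity of the kernel \<open>P\<^sub>s u\<^sub>0\<close> is
  bounded below for \<open>s \<ge> t / 2\<close>, and from then on the infimum of \<open>F\<close> at least doubles in each time step of
  length of order \<open>\<lambda>\<^sup>-\<^sup>4\<close>. Hence both moments are \<open>exp (\<lambda>\<^sup>4)\<close> up to constants in the exponent.

  The kernel estimates come from comparison with Gaussians by means of the maximum principle. The
  isometry needs the independence of the noise after time \<open>a\<close> from the filtration at \<open>a\<close>, which is
  deduced from the vanishing covariance through the uniqueness of characteristic functions.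
\<close>

section \<open>Independence of the increments of white noise\<close>

text \<open>The exponent 4 is a matter of scaling: over a time span \<open>\<delta>\<close> the
  integral of \<open>1 / sqrt r\<close> is of order \<open>sqrt \<delta>\<close>, so
  \<open>lam\<^sup>2 * sqrt \<delta>\<close> is of order one exactly when \<open>\<delta>\<close> is
  of order \<open>1 / lam ^ 4\<close>. The double logarithm of \<open>exp (c * lam ^ 4)\<close> does
  not see \<open>c\<close>, so crude constants are harmless. The obstacle is that the objects are
  given by characterisations. The kernel comes without a formula and without stated positivity or
  size; these are extracted from the differential equation and its boundary condition. The Walsh
  integral is a relation involving some approximating sequence, so the isometry is computed for
  simple fields and carried to the limit. Even additivity of the noise in its set has to be read off
  from the covariance. Two points are delicate. The inequality \<open>S \<le> C + S / 2\<close> says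
  something only for finite \<open>S\<close>, which the moment condition provides. And the initial
  function may vanish on large sets, so a lower bound uniform in \<open>x\<close> exists only after
  some waiting; spending half of the time on it changes constants only.\<close>

lemma (in prob_space) integral_zero_of_fourier_zero:
  fixes Z X :: "'a \<Rightarrow> real"
  assumes Z: "integrable M Z" and X[measurable]: "X \<in> borel_measurable M"
    and zero: "\<And>c. (CLINT \<omega>|M. of_real (Z \<omega>) * iexp (c * X \<omega>)) = 0"
    and B[measurable]: "B \<in> sets borel"
  shows "(\<integral>\<omega>. Z \<omega> * indicator B (X \<omega>) \<partial>M) = 0"
proof -
  have Zm[measurable]: "Z \<in> borel_measurable M" using Z by auto
  \<comment> \<open>\<open>Levy_uniqueness\<close> compares probability distributions, whereas
    \<open>Z\<close> is a signed density. Hence the splitting \<open>Z = P - N\<close>: frequency 0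
    gives both parts the same mass \<open>m\<close>, and after division by \<open>m\<close> their
    images under \<open>X\<close> are distributions with equal characteristic functions.\<close>
  define P where "P = (\<lambda>\<omega>. max (Z \<omega>) 0)"
  define N where "N = (\<lambda>\<omega>. max (- Z \<omega>) 0)"
  have [measurable]: "P \<in> borel_measurable M" "N \<in> borel_measurable M"
    by (auto simp: P_def N_def)
  have iP: "integrable M P" and iN: "integrable M N"
    unfolding P_def N_def using Z by (auto intro!: integrable_max)
  have PN: "Z \<omega> = P \<omega> - N \<omega>" "P \<omega> \<ge> 0" "N \<omega> \<ge> 0" for \<omega>
    by (auto simp: P_def N_def max_def)
  have icP: "integrable M (\<lambda>\<omega>. complex_of_real (P \<omega>) * iexp (c * X \<omega>))" for c
    by (rule Bochner_Integration.integrable_bound[OF iP]) (auto simp: norm_mult PN)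
  have icN: "integrable M (\<lambda>\<omega>. complex_of_real (N \<omega>) * iexp (c * X \<omega>))" for c
    by (rule Bochner_Integration.integrable_bound[OF iN]) (auto simp: norm_mult PN)
  have eqc: "(CLINT \<omega>|M. of_real (P \<omega>) * iexp (c * X \<omega>)) = (CLINT \<omega>|M. of_real (N \<omega>) * iexp (c * X \<omega>))" for c
    using zero[of c] Bochner_Integration.integral_diff[OF icP icN, of c c]
    by (simp add: PN left_diff_distrib)
  have iPB: "integrable M (\<lambda>\<omega>. P \<omega> * indicator B (X \<omega>))"
    by (rule Bochner_Integration.integrable_bound[OF iP]) (auto simp: norm_mult PN indicator_def)
  have iNB: "integrable M (\<lambda>\<omega>. N \<omega> * indicator B (X \<omega>))"
    by (rule Bochner_Integration.integrable_bound[OF iN]) (auto simp: norm_mult PN indicator_def)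
  have m_eq: "(\<integral>\<omega>. P \<omega> \<partial>M) = (\<integral>\<omega>. N \<omega> \<partial>M)"
    using eqc[of 0] by simp
  define m where "m = (\<integral>\<omega>. P \<omega> \<partial>M)"
  have m0: "m \<ge> 0" unfolding m_def by (intro Bochner_Integration.integral_nonneg) (simp add: PN)
  have *: "(\<integral>\<omega>. P \<omega> * indicator B (X \<omega>) \<partial>M) = (\<integral>\<omega>. N \<omega> * indicator B (X \<omega>) \<partial>M)"
  proof (cases "m = 0")
    case True
    have "AE \<omega> in M. P \<omega> = 0" "AE \<omega> in M. N \<omega> = 0"
      using integral_nonneg_eq_0_iff_AE[OF iP] integral_nonneg_eq_0_iff_AE[OF iN] True m_eq
      by (simp_all add: m_def PN)
    then have "AE \<omega> in M. P \<omega> * indicator B (X \<omega>) = N \<omega> * indicator B (X \<omega>)" by eventually_elim simp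
    then show ?thesis by (intro integral_cong_AE) auto
  next
    case False
    then have mpos: "m > 0" using m0 by simp
    have real_dist: "real_distribution (distr (density M (\<lambda>\<omega>. ennreal (Q \<omega> / m))) borel X)"
      and char_eq: "char (distr (density M (\<lambda>\<omega>. ennreal (Q \<omega> / m))) borel X) c
          = (CLINT \<omega>|M. of_real (Q \<omega>) * iexp (c * X \<omega>)) / of_real m"
      and meas_eq: "measure (distr (density M (\<lambda>\<omega>. ennreal (Q \<omega> / m))) borel X) B
          = (\<integral>\<omega>. Q \<omega> * indicator B (X \<omega>) \<partial>M) / m"
      if Q[measurable]: "integrable M Q" "Q \<in> borel_measurable M" and Q0: "\<And>\<omega>. Q \<omega> \<ge> 0" and Qm: "(\<integral>\<omega>. Q \<omega> \<partial>M) = m" for Q c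
    proof -
      have "emeasure (density M (\<lambda>\<omega>. ennreal (Q \<omega> / m))) (space M) = (\<integral>\<^sup>+\<omega>. ennreal (Q \<omega> / m) \<partial>M)"
        by (auto simp: emeasure_density intro!: nn_integral_cong)
      also have "\<dots> = ennreal (\<integral>\<omega>. Q \<omega> / m \<partial>M)"
        using Q Q0 m0 by (intro nn_integral_eq_integral) auto
      also have "\<dots> = 1" using Qm mpos by simp
      finally have ps: "prob_space (density M (\<lambda>\<omega>. ennreal (Q \<omega> / m)))"
        by (intro prob_spaceI) simp
      show "real_distribution (distr (density M (\<lambda>\<omega>. ennreal (Q \<omega> / m))) borel X)"
        unfolding real_distribution_def real_distribution_axioms_def
        using prob_space.prob_space_distr[OF ps, of X borel] by simp
      show "char (distr (density M (\<lambda>\<omega>. ennreal (Q \<omega> / m))) borel X) c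
          = (CLINT \<omega>|M. of_real (Q \<omega>) * iexp (c * X \<omega>)) / of_real m"
        unfolding char_def using Q0 m0
        by (subst integral_distr; simp?) (subst integral_density; simp add: scaleR_conv_of_real)
      have iQB: "integrable M (\<lambda>\<omega>. Q \<omega> * indicator B (X \<omega>))"
        by (rule Bochner_Integration.integrable_bound[OF Q(1)]) (auto simp: indicator_def)
      have "ennreal (measure (distr (density M (\<lambda>\<omega>. ennreal (Q \<omega> / m))) borel X) B)
         = emeasure (density M (\<lambda>\<omega>. ennreal (Q \<omega> / m))) (X -` B \<inter> space M)"
        using prob_space.prob_space_distr[OF ps, of X borel]
        by (simp add: emeasure_distr prob_space_def finite_measure.emeasure_eq_measure[symmetric])
      also have "\<dots> = (\<integral>\<^sup>+\<omega>. ennreal (Q \<omega> * indicator B (X \<omega>) / m) \<partial>M)"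
        by (auto simp: emeasure_density indicator_def intro!: nn_integral_cong)
      also have "\<dots> = ennreal (\<integral>\<omega>. Q \<omega> * indicator B (X \<omega>) / m \<partial>M)"
        using integrable_divide[OF iQB, of m] Q0 m0 by (intro nn_integral_eq_integral) auto
      finally show "measure (distr (density M (\<lambda>\<omega>. ennreal (Q \<omega> / m))) borel X) B
          = (\<integral>\<omega>. Q \<omega> * indicator B (X \<omega>) \<partial>M) / m"
        using Q0 m0 by (subst (asm) ennreal_inj) (auto intro!: Bochner_Integration.integral_nonneg)
    qed
    have Pm: "(\<integral>\<omega>. P \<omega> \<partial>M) = m" and Nm: "(\<integral>\<omega>. N \<omega> \<partial>M) = m"
      using m_eq by (simp_all add: m_def)
    note Pf = iP \<open>P \<in> borel_measurable M\<close> PN(2) Pm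
    note Nf = iN \<open>N \<in> borel_measurable M\<close> PN(3) Nm
    have "distr (density M (\<lambda>\<omega>. ennreal (P \<omega> / m))) borel X = distr (density M (\<lambda>\<omega>. ennreal (N \<omega> / m))) borel X"
      by (intro Levy_uniqueness real_dist[OF Pf] real_dist[OF Nf] ext)
        (simp only: char_eq[OF Pf] char_eq[OF Nf] eqc)
    then have "(\<integral>\<omega>. P \<omega> * indicator B (X \<omega>) \<partial>M) / m = (\<integral>\<omega>. N \<omega> * indicator B (X \<omega>) \<partial>M) / m"
      by (simp only: meas_eq[OF Pf, symmetric] meas_eq[OF Nf, symmetric])
    then show ?thesis using mpos by simp
  qed
  show ?thesis
    using Bochner_Integration.integral_diff[OF iPB iNB] * by (simp add: PN left_diff_distrib)
qed

text \<open>Complex factors arise when the exponentials of the remaining noise values are carried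
  along. Conjugating the hypothesis at frequency \<open>- c\<close> gives it for
  \<open>cnj Z\<close>, hence for the real and the imaginary part.\<close>

lemma (in prob_space) integral_zero_of_fourier_zero_complex:
  fixes Z :: "'a \<Rightarrow> complex" and X :: "'a \<Rightarrow> real"
  assumes Z: "integrable M Z" and X[measurable]: "X \<in> borel_measurable M"
    and zero: "\<And>c. (CLINT \<omega>|M. Z \<omega> * iexp (c * X \<omega>)) = 0"
    and B[measurable]: "B \<in> sets borel"
  shows "(CLINT \<omega>|M. Z \<omega> * of_real (indicator B (X \<omega>))) = 0"
proof -
  have Zm[measurable]: "Z \<in> borel_measurable M" using Z by auto
  have int: "integrable M (\<lambda>\<omega>. Z \<omega> * iexp (c * X \<omega>))" for c
    by (rule Bochner_Integration.integrable_bound[OF Z]) (auto simp: norm_mult)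
  have cnj_m[measurable]: "(\<lambda>\<omega>. cnj (Z \<omega>)) \<in> borel_measurable M"
    by (rule borel_measurable_integrable[OF integrable_cnj[OF Z]])
  have int': "integrable M (\<lambda>\<omega>. cnj (Z \<omega>) * iexp (c * X \<omega>))" for c
    by (rule Bochner_Integration.integrable_bound[OF Z]) (auto simp: norm_mult)
  have intB: "integrable M (\<lambda>\<omega>. Z \<omega> * of_real (indicator B (X \<omega>)))"
    by (rule Bochner_Integration.integrable_bound[OF Z]) (auto simp: norm_mult indicator_def)
  have cz: "(CLINT \<omega>|M. cnj (Z \<omega>) * iexp (c * X \<omega>)) = 0" for c
  proof -
    have "(CLINT \<omega>|M. cnj (Z \<omega>) * iexp (c * X \<omega>)) = (CLINT \<omega>|M. cnj (Z \<omega> * iexp ((-c) * X \<omega>)))"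
      by (intro Bochner_Integration.integral_cong) (auto simp: exp_cnj)
    also have "\<dots> = 0" by (subst Bochner_Integration.integral_cnj, subst zero) simp
    finally show ?thesis .
  qed
  have re: "(CLINT \<omega>|M. of_real (Re (Z \<omega>)) * iexp (c * X \<omega>)) = 0" for c
  proof -
    have "(CLINT \<omega>|M. of_real (Re (Z \<omega>)) * iexp (c * X \<omega>)) = (CLINT \<omega>|M. (Z \<omega> * iexp (c * X \<omega>) + cnj (Z \<omega>) * iexp (c * X \<omega>)) / 2)"
      by (intro Bochner_Integration.integral_cong refl) (simp add: complex_add_cnj field_simps flip: distrib_left distrib_right)
    also have "\<dots> = 0" using int int' zero cz by simp
    finally show ?thesis .
  qed
  have im: "(CLINT \<omega>|M. of_real (Im (Z \<omega>)) * iexp (c * X \<omega>)) = 0" for c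
  proof -
    have *: "complex_of_real (Im z) = (z - cnj z) / (2 * \<i>)" for z
      by (subst eq_divide_eq) (simp add: complex_diff_cnj mult_ac)
    have "(CLINT \<omega>|M. of_real (Im (Z \<omega>)) * iexp (c * X \<omega>)) = (CLINT \<omega>|M. (Z \<omega> * iexp (c * X \<omega>) - cnj (Z \<omega>) * iexp (c * X \<omega>)) / (2 * \<i>))"
      by (intro Bochner_Integration.integral_cong refl) (simp add: * field_simps)
    also have "\<dots> = 0" using int int' zero cz by simp
    finally show ?thesis .
  qed
  have "integrable M (\<lambda>\<omega>. Re (Z \<omega>))" "integrable M (\<lambda>\<omega>. Im (Z \<omega>))" using Z by auto
  then have "(\<integral>\<omega>. Re (Z \<omega>) * indicator B (X \<omega>) \<partial>M) = 0" "(\<integral>\<omega>. Im (Z \<omega>) * indicator B (X \<omega>) \<partial>M) = 0"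
    using re im by (auto intro!: integral_zero_of_fourier_zero)
  then show ?thesis
    using integral_Re[OF intB] integral_Im[OF intB] by (intro complex_eqI) auto
qed

section \<open>Moments and characteristic function of a centred Gaussian variable\<close>

lemma (in prob_space) centered_gaussian_square_integrable:
  assumes "centered_gaussian M X"
  shows "integrable M (\<lambda>\<omega>. (X \<omega>)\<^sup>2)" "X \<in> borel_measurable M" "integrable M X" "(\<integral>\<omega>. X \<omega> \<partial>M) = 0"
proof -
  show m[measurable]: "X \<in> borel_measurable M" using assms by (simp add: centered_gaussian_def)
  consider "AE \<omega> in M. X \<omega> = 0" | s where "s > 0" "distributed M lborel X (\<lambda>x. ennreal (normal_density 0 s x))"
    using assms by (auto simp: centered_gaussian_def)
  then have "integrable M (\<lambda>\<omega>. (X \<omega>)\<^sup>2) \<and> (\<integral>\<omega>. X \<omega> \<partial>M) = 0"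
  proof cases
    case 1
    have "integrable M (\<lambda>\<omega>. (X \<omega>)\<^sup>2) \<longleftrightarrow> integrable M (\<lambda>\<omega>. 0::real)"
      using 1 by (intro integrable_cong_AE) auto
    moreover have "(\<integral>\<omega>. X \<omega> \<partial>M) = (\<integral>\<omega>. 0 \<partial>M)" using 1 by (intro integral_cong_AE) auto
    ultimately show ?thesis by simp
  next
    case 2
    have "integrable M (\<lambda>\<omega>. (X \<omega>)\<^sup>2) \<longleftrightarrow> integrable lborel (\<lambda>x. normal_density 0 s x * x\<^sup>2)"
      using 2 by (intro distributed_integrable[symmetric]) auto
    moreover have "(\<integral>\<omega>. X \<omega> \<partial>M) = 0" using normal_distributed_expectation[OF 2] by simp
    ultimately show ?thesis using integrable_normal_moment[OF 2(1), of 0 2] by simp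
  qed
  then show sq: "integrable M (\<lambda>\<omega>. (X \<omega>)\<^sup>2)" and "(\<integral>\<omega>. X \<omega> \<partial>M) = 0" by auto
  show "integrable M X" using sq m by (rule square_integrable_imp_integrable[rotated])
qed

text \<open>Through this formula independence becomes additivity of variances. The degenerate
  variable fits in with variance 0.\<close>

lemma (in prob_space) centered_gaussian_iexp:
  assumes "centered_gaussian M X"
  shows "(CLINT \<omega>|M. iexp (X \<omega>)) = of_real (exp (- (\<integral>\<omega>. (X \<omega>)\<^sup>2 \<partial>M) / 2))"
proof -
  have m[measurable]: "X \<in> borel_measurable M" using assms by (simp add: centered_gaussian_def)
  consider "AE \<omega> in M. X \<omega> = 0" | s where "s > 0" "distributed M lborel X (\<lambda>x. ennreal (normal_density 0 s x))"
    using assms by (auto simp: centered_gaussian_def)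
  then show ?thesis
  proof cases
    case 1
    have "(\<integral>\<omega>. (X \<omega>)\<^sup>2 \<partial>M) = (\<integral>\<omega>. 0 \<partial>M)" using 1 by (intro integral_cong_AE) auto
    moreover have "(CLINT \<omega>|M. iexp (X \<omega>)) = (CLINT \<omega>|M. 1)" using 1 by (intro integral_cong_AE) auto
    ultimately show ?thesis by (simp add: prob_space)
  next
    case 2
    have std: "distributed M lborel (\<lambda>\<omega>. X \<omega> / s) (\<lambda>x. ennreal (std_normal_density x))"
      using normal_standard_normal_convert[OF 2(1), of X 0] 2(2) by simp
    have "(CLINT \<omega>|M. iexp (X \<omega>)) = (CLINT \<omega>|M. iexp (s * (X \<omega> / s)))" using 2(1) by simp
    also have "\<dots> = (CLINT x|distr M lborel (\<lambda>\<omega>. X \<omega> / s). iexp (s * x))"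
      by (subst integral_distr) auto
    also have "\<dots> = char std_normal_distribution s"
      unfolding char_def distributed_distr_eq_density[OF std] by simp
    also have "\<dots> = of_real (exp (- s\<^sup>2 / 2))" by (simp add: char_std_normal_distribution)
    also have "s\<^sup>2 = (\<integral>\<omega>. (X \<omega>)\<^sup>2 \<partial>M)"
      using normal_distributed_variance[OF 2] normal_distributed_expectation[OF 2] by simp
    finally show ?thesis .
  qed
qed

section \<open>Finite linear combinations of white noise\<close>

locale noise = prob_space M for M :: "'a measure" +
  fixes L :: real and W :: "(real \<times> real) set \<Rightarrow> 'a \<Rightarrow> real"
  assumes white_noise: "white_noise M L W"
begin

text \<open>Joint Gaussianity is available only through these combinations: the joint characteristic
  function of finitely many noise values is the expectation of \<open>iexp\<close> of a
  \<open>comb\<close>, with the coefficients as frequencies.\<close>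

definition comb :: "((real \<times> real) set \<Rightarrow> real) \<Rightarrow> (real \<times> real) set set \<Rightarrow> 'a \<Rightarrow> real" where
  "comb c \<A> \<omega> = (\<Sum>A\<in>\<A>. c A * W A \<omega>)"

lemma comb_gaussian: "finite \<A> \<Longrightarrow> \<A> \<subseteq> noise_sets L \<Longrightarrow> centered_gaussian M (comb c \<A>)"
  using white_noise unfolding white_noise_def comb_def[abs_def] by blast

lemma W_gaussian: "A \<in> noise_sets L \<Longrightarrow> centered_gaussian M (W A)"
  using comb_gaussian[of "{A}" "\<lambda>_. 1"] by (simp add: comb_def[abs_def])

lemmas W_measurable = centered_gaussian_square_integrable(2)[OF W_gaussian]
lemmas W_square_integrable = centered_gaussian_square_integrable(1)[OF W_gaussian]

lemma comb_measurable: "finite \<A> \<Longrightarrow> \<A> \<subseteq> noise_sets L \<Longrightarrow> comb c \<A> \<in> borel_measurable M"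
  by (rule centered_gaussian_square_integrable(2)[OF comb_gaussian])

lemma W_mult_integrable:
  assumes "A \<in> noise_sets L" "B \<in> noise_sets L"
  shows "integrable M (\<lambda>\<omega>. W A \<omega> * W B \<omega>)"
proof -
  note [measurable] = W_measurable[OF assms(1)] W_measurable[OF assms(2)]
  have ineq: "\<bar>a * b\<bar> \<le> a\<^sup>2 + b\<^sup>2" for a b :: real
  proof -
    have "0 \<le> (\<bar>a\<bar> - \<bar>b\<bar>)\<^sup>2" by simp
    also have "\<dots> = a\<^sup>2 + b\<^sup>2 - 2 * \<bar>a * b\<bar>" by (simp add: power2_diff abs_mult)
    finally show ?thesis using abs_ge_zero[of "a*b"] by linarith
  qed
  show ?thesis
    by (rule Bochner_Integration.integrable_bound[OF Bochner_Integration.integrable_add[OF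
      W_square_integrable[OF assms(1)] W_square_integrable[OF assms(2)]]]) (auto intro: ineq order_trans)
qed

lemma W_covariance:
  "A \<in> noise_sets L \<Longrightarrow> B \<in> noise_sets L \<Longrightarrow> (\<integral>\<omega>. W A \<omega> * W B \<omega> \<partial>M) = measure lborel (A \<inter> B)"
  using white_noise unfolding white_noise_def by blast

lemma comb_covariance:
  assumes "finite \<A>" "\<A> \<subseteq> noise_sets L" "finite \<B>" "\<B> \<subseteq> noise_sets L"
  shows "integrable M (\<lambda>\<omega>. comb c \<A> \<omega> * comb d \<B> \<omega>)"
    and "(\<integral>\<omega>. comb c \<A> \<omega> * comb d \<B> \<omega> \<partial>M) = (\<Sum>A\<in>\<A>. \<Sum>B\<in>\<B>. c A * d B * measure lborel (A \<inter> B))"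
proof -
  have *: "comb c \<A> \<omega> * comb d \<B> \<omega> = (\<Sum>A\<in>\<A>. \<Sum>B\<in>\<B>. c A * d B * (W A \<omega> * W B \<omega>))" for \<omega>
    by (simp add: comb_def sum_product mult_ac)
  have int: "integrable M (\<lambda>\<omega>. c A * d B * (W A \<omega> * W B \<omega>))" if "A \<in> \<A>" "B \<in> \<B>" for A B
    using that assms by (intro integrable_mult_right W_mult_integrable) auto
  show "integrable M (\<lambda>\<omega>. comb c \<A> \<omega> * comb d \<B> \<omega>)"
    unfolding * by (intro Bochner_Integration.integrable_sum int)
  have "(\<integral>\<omega>. comb c \<A> \<omega> * comb d \<B> \<omega> \<partial>M) = (\<Sum>A\<in>\<A>. \<Sum>B\<in>\<B>. (\<integral>\<omega>. c A * d B * (W A \<omega> * W B \<omega>) \<partial>M))"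
    unfolding * by (subst Bochner_Integration.integral_sum, intro Bochner_Integration.integrable_sum int, assumption+)
      (intro sum.cong refl Bochner_Integration.integral_sum int)
  also have "\<dots> = (\<Sum>A\<in>\<A>. \<Sum>B\<in>\<B>. c A * d B * measure lborel (A \<inter> B))"
  proof (intro sum.cong refl)
    fix A B assume "A \<in> \<A>" "B \<in> \<B>"
    then show "(\<integral>\<omega>. c A * d B * (W A \<omega> * W B \<omega>) \<partial>M) = c A * d B * measure lborel (A \<inter> B)"
      using W_covariance[of A B] assms by (auto simp del: mult.assoc)
  qed
  finally show "(\<integral>\<omega>. comb c \<A> \<omega> * comb d \<B> \<omega> \<partial>M) = (\<Sum>A\<in>\<A>. \<Sum>B\<in>\<B>. c A * d B * measure lborel (A \<inter> B))" .
qed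

text \<open>Gaussianity is known of one combination at a time, so a sum of two must be written as
  one. A set that occurs in both families receives the sum of its coefficients.\<close>

lemma comb_Un:
  assumes "finite \<A>" "finite \<B>"
  shows "comb c \<A> \<omega> + comb d \<B> \<omega> =
    comb (\<lambda>A. (if A \<in> \<A> then c A else 0) + (if A \<in> \<B> then d A else 0)) (\<A> \<union> \<B>) \<omega>"
proof -
  have "comb c \<A> \<omega> = (\<Sum>A\<in>\<A>\<union>\<B>. (if A \<in> \<A> then c A else 0) * W A \<omega>)"
    unfolding comb_def using assms by (intro sum.mono_neutral_cong_left) auto
  moreover have "comb d \<B> \<omega> = (\<Sum>A\<in>\<A>\<union>\<B>. (if A \<in> \<B> then d A else 0) * W A \<omega>)"
    unfolding comb_def using assms by (intro sum.mono_neutral_cong_left) auto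
  ultimately show ?thesis by (simp add: comb_def sum.distrib distrib_right)
qed

text \<open>Disjoint sets have covariance 0, so the variance of the sum is the sum of the variances,
  and its exponential factorises.\<close>

lemma iexp_comb_disjoint:
  assumes A: "finite \<A>" "\<A> \<subseteq> noise_sets L" and B: "finite \<B>" "\<B> \<subseteq> noise_sets L"
    and disj: "\<And>A B. A \<in> \<A> \<Longrightarrow> B \<in> \<B> \<Longrightarrow> A \<inter> B = {}"
  shows "(CLINT \<omega>|M. iexp (comb c \<A> \<omega>) * iexp (comb d \<B> \<omega>)) =
    (CLINT \<omega>|M. iexp (comb c \<A> \<omega>)) * (CLINT \<omega>|M. iexp (comb d \<B> \<omega>))"
proof -
  let ?e = "\<lambda>A. (if A \<in> \<A> then c A else 0) + (if A \<in> \<B> then d A else 0)"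
  have AB: "finite (\<A> \<union> \<B>)" "\<A> \<union> \<B> \<subseteq> noise_sets L" using A B by auto
  note sq = centered_gaussian_square_integrable(1)[OF comb_gaussian]
  have "(\<integral>\<omega>. comb c \<A> \<omega> * comb d \<B> \<omega> \<partial>M) = 0"
    by (simp add: comb_covariance[OF A B] disj)
  moreover have "(\<integral>\<omega>. (comb c \<A> \<omega> + comb d \<B> \<omega>)\<^sup>2 \<partial>M) =
     (\<integral>\<omega>. (comb c \<A> \<omega>)\<^sup>2 + 2 * (comb c \<A> \<omega> * comb d \<B> \<omega>) + (comb d \<B> \<omega>)\<^sup>2 \<partial>M)"
    by (simp add: power2_sum algebra_simps)
  ultimately have var: "(\<integral>\<omega>. (comb c \<A> \<omega> + comb d \<B> \<omega>)\<^sup>2 \<partial>M) =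
     (\<integral>\<omega>. (comb c \<A> \<omega>)\<^sup>2 \<partial>M) + (\<integral>\<omega>. (comb d \<B> \<omega>)\<^sup>2 \<partial>M)"
    using sq[OF A] sq[OF B] comb_covariance(1)[OF A B] by simp
  have "(CLINT \<omega>|M. iexp (comb c \<A> \<omega>) * iexp (comb d \<B> \<omega>)) = (CLINT \<omega>|M. iexp (comb ?e (\<A> \<union> \<B>) \<omega>))"
    by (simp add: comb_Un[OF A(1) B(1), symmetric] exp_add distrib_left)
  also have "\<dots> = of_real (exp (- (\<integral>\<omega>. (comb ?e (\<A> \<union> \<B>) \<omega>)\<^sup>2 \<partial>M) / 2))"
    by (rule centered_gaussian_iexp[OF comb_gaussian[OF AB]])
  also have "\<dots> = of_real (exp (- (\<integral>\<omega>. (comb c \<A> \<omega>)\<^sup>2 \<partial>M) / 2)) * of_real (exp (- (\<integral>\<omega>. (comb d \<B> \<omega>)\<^sup>2 \<partial>M) / 2))"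
  proof -
    have *: "- (a + b) / 2 = - a / 2 + - b / 2" for a b :: real by (simp add: field_simps)
    show ?thesis unfolding comb_Un[OF A(1) B(1), symmetric] var * exp_add of_real_mult ..
  qed
  finally show ?thesis by (simp add: centered_gaussian_iexp comb_gaussian A B)
qed

text \<open>
  The exponentials are replaced by indicators one set at a time, so that uniqueness of the
  one-dimensional Fourier transform suffices.
\<close>

lemma annihilate_indicators:
  assumes B: "finite \<B>" "\<B> \<subseteq> noise_sets L"
    and Y: "integrable M Y" and zero: "\<And>c. (CLINT \<omega>|M. iexp (comb c \<B> \<omega>) * Y \<omega>) = 0"
    and E: "\<And>B. B \<in> \<B> \<Longrightarrow> E B \<in> sets borel"
  shows "(CLINT \<omega>|M. of_real (\<Prod>B\<in>\<B>. indicator (E B) (W B \<omega>)) * Y \<omega>) = 0"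
proof -
  have "\<forall>c. (CLINT \<omega>|M. of_real (\<Prod>B\<in>\<D>. indicator (E B) (W B \<omega>)) * iexp (comb c (\<B> - \<D>) \<omega>) * Y \<omega>) = 0"
    if "finite \<D>" "\<D> \<subseteq> \<B>" for \<D>
    using that
  proof (induction \<D>)
    case empty
    then show ?case using zero by simp
  next
    case (insert D \<D>)
    show ?case
    proof
      fix c
      have D: "D \<in> \<B>" "D \<in> noise_sets L" "\<D> \<subseteq> \<B>" using insert B by auto
      note [measurable] = W_measurable[OF D(2)] E[OF D(1)]
      define Z where "Z = (\<lambda>\<omega>. of_real (\<Prod>B\<in>\<D>. indicator (E B) (W B \<omega>)) * iexp (comb c (\<B> - insert D \<D>) \<omega>) * Y \<omega>)"
      have [measurable]: "comb c (\<B> - insert D \<D>) \<in> borel_measurable M"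
        using B by (intro comb_measurable) auto
      have [measurable]: "(\<lambda>\<omega>. \<Prod>B\<in>\<D>. indicator (E B) (W B \<omega>) :: real) \<in> borel_measurable M"
      proof (intro borel_measurable_prod)
        fix A assume "A \<in> \<D>"
        then have [measurable]: "W A \<in> borel_measurable M" "E A \<in> sets borel"
          using D B E by (auto intro!: W_measurable)
        show "(\<lambda>\<omega>. indicator (E A) (W A \<omega>) :: real) \<in> borel_measurable M" by measurable
      qed
      have [measurable]: "Y \<in> borel_measurable M" using Y by auto
      have le1: "\<bar>\<Prod>B\<in>\<D>. indicator (E B) (W B \<omega>) :: real\<bar> \<le> 1" for \<omega>
        by (subst abs_prod, rule prod_le_1) (auto simp: indicator_def)
      have "integrable M Z" unfolding Z_def
        by (rule Bochner_Integration.integrable_bound[OF Y])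
          (use le1 in \<open>auto simp: norm_mult simp del: of_real_prod intro!: mult_left_le_one_le\<close>)
      moreover have "(CLINT \<omega>|M. Z \<omega> * iexp (a * W D \<omega>)) = 0" for a
      proof -
        \<comment> \<open>The frequency \<open>a\<close> becomes the coefficient of
          \<open>D\<close>. This is why the claim proved by induction is quantified over all
          \<open>c\<close>.\<close>
        have "comb (c(D := a)) (\<B> - \<D>) \<omega> = a * W D \<omega> + comb c (\<B> - insert D \<D>) \<omega>" for \<omega>
        proof -
          have eq: "\<B> - \<D> = insert D (\<B> - insert D \<D>)" using insert D by auto
          show ?thesis unfolding comb_def
            by (subst eq, subst sum.insert) (use B in \<open>auto intro!: sum.cong\<close>)
        qed
        then have "(CLINT \<omega>|M. Z \<omega> * iexp (a * W D \<omega>)) =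
          (CLINT \<omega>|M. of_real (\<Prod>B\<in>\<D>. indicator (E B) (W B \<omega>)) * iexp (comb (c(D := a)) (\<B> - \<D>) \<omega>) * Y \<omega>)"
          by (simp add: Z_def exp_add distrib_left mult_ac)
        then show ?thesis using insert.IH D by simp
      qed
      ultimately have "(CLINT \<omega>|M. Z \<omega> * of_real (indicator (E D) (W D \<omega>))) = 0"
        by (intro integral_zero_of_fourier_zero_complex) auto
      then show "(CLINT \<omega>|M. of_real (\<Prod>B\<in>insert D \<D>. indicator (E B) (W B \<omega>)) *
          iexp (comb c (\<B> - insert D \<D>) \<omega>) * Y \<omega>) = 0"
        using insert by (simp add: Z_def mult_ac)
    qed
  qed
  from this[of \<B>] B(1) show ?thesis by (simp add: comb_def)
qed

text \<open>Fourier uniqueness is used on each side in turn. First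
  \<open>annihilate_indicators\<close>, with
  \<open>iexp (\<theta> * N \<omega>) - \<phi> \<theta>\<close> in the place of \<open>Y\<close>,
  turns the exponentials of the past into the indicator of \<open>F\<close>. Then uniqueness in the
  single variable \<open>N\<close>, applied to \<open>indicator F - prob F\<close>, turns the
  exponential of the future into the indicator of \<open>G\<close>.\<close>

lemma prob_past_future:
  assumes A: "finite \<A>" "\<A> \<subseteq> noise_sets L" and B: "finite \<B>" "\<B> \<subseteq> noise_sets L"
    and disj: "\<And>A B. A \<in> \<A> \<Longrightarrow> B \<in> \<B> \<Longrightarrow> A \<inter> B = {}"
    and E: "\<And>A. A \<in> \<A> \<Longrightarrow> E A \<in> sets borel" and G[measurable]: "G \<in> sets borel"
    and F: "F = {\<omega>\<in>space M. \<forall>A\<in>\<A>. W A \<omega> \<in> E A}"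
  shows "F \<in> events" "prob (F \<inter> (comb d \<B> -` G \<inter> space M)) = prob F * prob (comb d \<B> -` G \<inter> space M)"
proof -
  have m: "{\<omega>\<in>space M. W A \<omega> \<in> E A} \<in> events" if "A \<in> \<A>" for A
    using measurable_sets[OF W_measurable E[OF that], of A] that A
    by (auto simp: vimage_def Int_def conj_commute)
  show F_ev[measurable]: "F \<in> events"
    unfolding F using A m by (intro sets.sets_Collect_finite_All) auto
  have Find: "indicator F \<omega> = (\<Prod>A\<in>\<A>. indicator (E A) (W A \<omega>) :: real)" if "\<omega> \<in> space M" for \<omega>
    using that A(1) by (auto simp: F indicator_def prod_zero_iff)
  define N where "N = comb d \<B>"
  have [measurable]: "N \<in> borel_measurable M" unfolding N_def by (rule comb_measurable[OF B])
  define \<phi> where "\<phi> \<theta> = (CLINT \<omega>|M. iexp (\<theta> * N \<omega>))" for \<theta>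
  have ci: "integrable M (\<lambda>\<omega>. iexp (\<theta> * N \<omega>))" for \<theta>
    by (rule integrable_const_bound[of _ 1]) auto
  have FI: "(CLINT \<omega>|M. of_real (indicator F \<omega>) * (iexp (\<theta> * N \<omega>) - \<phi> \<theta>)) = 0" for \<theta>
  proof -
    have N\<theta>: "\<theta> * N \<omega> = comb (\<lambda>B. \<theta> * d B) \<B> \<omega>" for \<omega>
      by (simp add: N_def comb_def sum_distrib_left mult_ac)
    have "(CLINT \<omega>|M. of_real (\<Prod>A\<in>\<A>. indicator (E A) (W A \<omega>)) * (iexp (\<theta> * N \<omega>) - \<phi> \<theta>)) = 0"
    proof (rule annihilate_indicators[OF A _ _ E])
      show "integrable M (\<lambda>\<omega>. iexp (\<theta> * N \<omega>) - \<phi> \<theta>)" using ci by simp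
      fix c
      have [measurable]: "comb c \<A> \<in> borel_measurable M" by (rule comb_measurable[OF A])
      have i1: "integrable M (\<lambda>\<omega>. iexp (comb c \<A> \<omega>) * iexp (\<theta> * N \<omega>))"
        by (rule integrable_const_bound[of _ 1]) (auto simp: norm_mult)
      have i2: "integrable M (\<lambda>\<omega>. iexp (comb c \<A> \<omega>) * \<phi> \<theta>)"
        by (intro integrable_mult_left integrable_const_bound[of _ 1]) auto
      have "(CLINT \<omega>|M. iexp (comb c \<A> \<omega>) * (iexp (\<theta> * N \<omega>) - \<phi> \<theta>)) =
        (CLINT \<omega>|M. iexp (comb c \<A> \<omega>) * iexp (\<theta> * N \<omega>)) - (CLINT \<omega>|M. iexp (comb c \<A> \<omega>)) * \<phi> \<theta>"
        using Bochner_Integration.integral_diff[OF i1 i2] by (simp add: right_diff_distrib)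
      also have "\<dots> = 0"
        unfolding \<phi>_def N\<theta> using iexp_comb_disjoint[OF A B disj] by simp
      finally show "(CLINT \<omega>|M. iexp (comb c \<A> \<omega>) * (iexp (\<theta> * N \<omega>) - \<phi> \<theta>)) = 0" .
    qed
    moreover have "(CLINT \<omega>|M. of_real (\<Prod>A\<in>\<A>. indicator (E A) (W A \<omega>)) * (iexp (\<theta> * N \<omega>) - \<phi> \<theta>)) =
      (CLINT \<omega>|M. of_real (indicator F \<omega>) * (iexp (\<theta> * N \<omega>) - \<phi> \<theta>))"
      by (intro Bochner_Integration.integral_cong refl) (simp only: Find)
    ultimately show ?thesis by simp
  qed
  have "(CLINT \<omega>|M. of_real (indicator F \<omega> - prob F) * iexp (\<theta> * N \<omega>)) = 0" for \<theta>
  proof -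
    have i1: "integrable M (\<lambda>\<omega>. of_real (indicator F \<omega>) * iexp (\<theta> * N \<omega>))"
      by (rule integrable_const_bound[of _ 1]) (auto simp: norm_mult indicator_def)
    have i2: "integrable M (\<lambda>\<omega>. complex_of_real (indicator F \<omega>) * \<phi> \<theta>)"
      by (intro integrable_mult_left integrable_const_bound[of _ 1]) (auto simp: indicator_def)
    have i3: "integrable M (\<lambda>\<omega>. of_real (prob F) * iexp (\<theta> * N \<omega>))" using ci by simp
    have "(CLINT \<omega>|M. of_real (indicator F \<omega>) * iexp (\<theta> * N \<omega>)) = (CLINT \<omega>|M. complex_of_real (indicator F \<omega>) * \<phi> \<theta>)"
      using FI[of \<theta>] Bochner_Integration.integral_diff[OF i1 i2] by (simp add: right_diff_distrib)
    also have "\<dots> = of_real (prob F) * \<phi> \<theta>" by simp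
    finally show ?thesis
      using Bochner_Integration.integral_diff[OF i1 i3] by (simp add: left_diff_distrib \<phi>_def)
  qed
  moreover have "integrable M (\<lambda>\<omega>. indicator F \<omega> - prob F)"
    by (intro Bochner_Integration.integrable_diff integrable_const integrable_real_indicator)
      (auto simp: less_top[symmetric])
  ultimately have z: "(\<integral>\<omega>. (indicator F \<omega> - prob F) * indicator G (N \<omega>) \<partial>M) = 0"
    by (intro integral_zero_of_fourier_zero) auto
  have G_ev: "N -` G \<inter> space M \<in> events" by measurable
  have "(\<integral>\<omega>. (indicator F \<omega> - prob F) * indicator G (N \<omega>) \<partial>M) =
    (\<integral>\<omega>. indicator (F \<inter> (N -` G \<inter> space M)) \<omega> - prob F * indicator (N -` G \<inter> space M) \<omega> \<partial>M)"
    by (intro Bochner_Integration.integral_cong refl) (auto simp: left_diff_distrib indicator_def)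
  also have "\<dots> = prob (F \<inter> (N -` G \<inter> space M)) - prob F * prob (N -` G \<inter> space M)"
    using G_ev F_ev by (subst Bochner_Integration.integral_diff) (auto simp: Int_absorb2 sets.sets_into_space less_top[symmetric])
  finally show "prob (F \<inter> (comb d \<B> -` G \<inter> space M)) = prob F * prob (comb d \<B> -` G \<inter> space M)"
    using z by (simp add: N_def)
qed


section \<open>The filtration of the noise and its independence from later noise\<close>

lemma space_noise_filtration[simp]: "space (noise_filtration M L W a) = space M"
  by (simp add: noise_filtration_def space_measure_of_conv)

lemma sets_noise_filtration:
  "sets (noise_filtration M L W a) = sigma_sets (space M)
     ({W A -` B \<inter> space M |A B. A \<in> noise_sets L \<and> A \<subseteq> {0<..a} \<times> UNIV \<and> B \<in> sets borel} \<union> null_sets M)"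
  unfolding noise_filtration_def
  by (rule sets_measure_of) (auto dest: sets.sets_into_space)

lemma sets_noise_filtration_subset: "sets (noise_filtration M L W a) \<subseteq> sets M"
  unfolding sets_noise_filtration
  by (rule sets.sigma_sets_subset) (use measurable_sets[OF W_measurable] in auto)

lemma noise_filtration_mono:
  assumes "a \<le> b"
  shows "sets (noise_filtration M L W a) \<subseteq> sets (noise_filtration M L W b)"
  unfolding sets_noise_filtration using assms by (intro sigma_sets_mono') (fastforce simp: subset_eq)

lemma noise_filtration_measurable_imp:
  "X \<in> borel_measurable (noise_filtration M L W a) \<Longrightarrow> X \<in> borel_measurable M"
  using sets_noise_filtration_subset[of a] by (auto simp: measurable_def)

lemma noise_filtration_measurable_mono:
  "X \<in> borel_measurable (noise_filtration M L W a) \<Longrightarrow> a \<le> b \<Longrightarrow> X \<in> borel_measurable (noise_filtration M L W b)"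
  using noise_filtration_mono[of a b] by (auto simp: measurable_def)

lemma W_noise_filtration_measurable:
  assumes "A \<in> noise_sets L" "A \<subseteq> {0<..a} \<times> UNIV"
  shows "W A \<in> borel_measurable (noise_filtration M L W a)"
proof (rule measurableI)
  fix B :: "real set" assume "B \<in> sets borel"
  then show "W A -` B \<inter> space (noise_filtration M L W a) \<in> sets (noise_filtration M L W a)"
    using assms unfolding space_noise_filtration sets_noise_filtration
    by (intro sigma_sets.Basic) auto
qed simp

text \<open>Independence is known for cylinder events of finitely many past noise values. These are
  stable under intersection, so it extends to the sigma-algebra that they generate.\<close>

lemma indep_set_filtration_comb:
  assumes B: "finite \<B>" "\<B> \<subseteq> noise_sets L" and fut: "\<And>B. B \<in> \<B> \<Longrightarrow> B \<subseteq> {a<..} \<times> UNIV"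
  shows "indep_set (sets (noise_filtration M L W a)) (sigma_sets (space M) {comb d \<B> -` G \<inter> space M |G. G \<in> sets borel})"
proof -
  define cyl where "cyl \<A> E = {\<omega>\<in>space M. \<forall>A\<in>\<A>. W A \<omega> \<in> E A}" for \<A> and E :: "_ \<Rightarrow> real set"
  define past where "past \<A> \<longleftrightarrow> finite \<A> \<and> \<A> \<subseteq> noise_sets L \<and> (\<forall>A\<in>\<A>. A \<subseteq> {0<..a} \<times> UNIV)" for \<A>
  \<comment> \<open>Cylinders only up to null events: the filtration is augmented by all null sets,
    and these must belong to the intersection-stable class as well.\<close>
  define P where "P = {F \<in> events. \<exists>\<A> E. past \<A> \<and> (\<forall>A\<in>\<A>. E A \<in> sets borel) \<and> (AE \<omega> in M. \<omega> \<in> F \<longleftrightarrow> \<omega> \<in> cyl \<A> E)}"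
  define Q where "Q = {comb d \<B> -` G \<inter> space M |G. G \<in> sets borel}"
  have cyl: "cyl \<A> E \<in> events" "G \<in> sets borel \<Longrightarrow> prob (cyl \<A> E \<inter> (comb d \<B> -` G \<inter> space M)) = prob (cyl \<A> E) * prob (comb d \<B> -` G \<inter> space M)"
    if p: "past \<A>" and E: "\<forall>A\<in>\<A>. E A \<in> sets borel" for \<A> E G
  proof -
    have disj: "A \<inter> B = {}" if "A \<in> \<A>" "B \<in> \<B>" for A B
      using p fut[OF that(2)] that(1) unfolding past_def by fastforce
    have A: "finite \<A>" "\<A> \<subseteq> noise_sets L" using p by (auto simp: past_def)
    note * = prob_past_future[OF A B disj _ _ cyl_def, where E = E]
    show "cyl \<A> E \<in> events" using E by (intro *(1)[of UNIV]) auto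
    show "G \<in> sets borel \<Longrightarrow> prob (cyl \<A> E \<inter> (comb d \<B> -` G \<inter> space M)) = prob (cyl \<A> E) * prob (comb d \<B> -` G \<inter> space M)"
      using E by (intro *(2)) auto
  qed
  have comb_meas: "comb d \<B> \<in> borel_measurable M" by (rule comb_measurable[OF B])
  have "indep_set P Q"
  proof (rule indep_setI)
    show "P \<subseteq> events" by (auto simp: P_def)
    show "Q \<subseteq> events" using measurable_sets[OF comb_meas] by (auto simp: Q_def)
    fix F H assume "F \<in> P" "H \<in> Q"
    then obtain \<A> E G where *: "F \<in> events" "past \<A>" "\<forall>A\<in>\<A>. E A \<in> sets borel" "AE \<omega> in M. \<omega> \<in> F \<longleftrightarrow> \<omega> \<in> cyl \<A> E"
      "G \<in> sets borel" "H = comb d \<B> -` G \<inter> space M" by (auto simp: P_def Q_def)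
    have H: "H \<in> events" using measurable_sets[OF comb_meas *(5)] *(6) by simp
    have "prob (F \<inter> H) = prob (cyl \<A> E \<inter> H)" using *(4) H *(1) cyl(1)[OF *(2,3)]
      by (intro finite_measure_eq_AE) auto
    also have "\<dots> = prob (cyl \<A> E) * prob H" using cyl(2)[OF *(2,3,5)] *(6) by simp
    also have "prob (cyl \<A> E) = prob F" using *(4) *(1) cyl(1)[OF *(2,3)]
      by (intro finite_measure_eq_AE) auto
    finally show "prob (F \<inter> H) = prob F * prob H" .
  qed
  moreover have "Int_stable P"
  proof (rule Int_stableI)
    fix F F' assume "F \<in> P" "F' \<in> P"
    then obtain \<A> E \<A>' E' where 1: "F \<in> events" "past \<A>" "\<forall>A\<in>\<A>. E A \<in> sets borel" "AE \<omega> in M. \<omega> \<in> F \<longleftrightarrow> \<omega> \<in> cyl \<A> E"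
      and 2: "F' \<in> events" "past \<A>'" "\<forall>A\<in>\<A>'. E' A \<in> sets borel" "AE \<omega> in M. \<omega> \<in> F' \<longleftrightarrow> \<omega> \<in> cyl \<A>' E'"
      by (auto simp: P_def)
    define E'' where "E'' A = (if A \<in> \<A> then E A else UNIV) \<inter> (if A \<in> \<A>' then E' A else UNIV)" for A
    have "past (\<A> \<union> \<A>')" using 1 2 by (auto simp: past_def)
    moreover have "\<forall>A\<in>\<A> \<union> \<A>'. E'' A \<in> sets borel" using 1 2 by (auto simp: E''_def)
    moreover have "cyl (\<A> \<union> \<A>') E'' = cyl \<A> E \<inter> cyl \<A>' E'"
      by (auto simp: cyl_def E''_def)
    moreover have "AE \<omega> in M. \<omega> \<in> F \<inter> F' \<longleftrightarrow> \<omega> \<in> cyl \<A> E \<inter> cyl \<A>' E'"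
      using 1(4) 2(4) by eventually_elim auto
    ultimately show "F \<inter> F' \<in> P" using 1(1) 2(1) unfolding P_def by (auto intro!: exI[of _ "\<A> \<union> \<A>'"] exI[of _ E''])
  qed
  moreover have "Int_stable Q"
  proof (rule Int_stableI)
    fix H H' assume "H \<in> Q" "H' \<in> Q"
    then obtain G G' where "G \<in> sets borel" "H = comb d \<B> -` G \<inter> space M" "G' \<in> sets borel" "H' = comb d \<B> -` G' \<inter> space M"
      by (auto simp: Q_def)
    then show "H \<inter> H' \<in> Q" unfolding Q_def by (intro CollectI exI[of _ "G \<inter> G'"]) auto
  qed
  ultimately have ind: "indep_set (sigma_sets (space M) P) (sigma_sets (space M) Q)"
    by (rule indep_set_sigma_sets)
  have "W A -` G \<inter> space M \<in> P" if "A \<in> noise_sets L" "A \<subseteq> {0<..a} \<times> UNIV" "G \<in> sets borel" for A G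
    using that measurable_sets[OF W_measurable, of A G]
    by (auto simp: P_def past_def cyl_def intro!: exI[of _ "{A}"] exI[of _ "\<lambda>_. G"])
  \<comment> \<open>A null event agrees almost everywhere with the empty cylinder, which arises from
    an unsatisfiable condition on the noise of the empty set, a member of
    \<open>noise_sets\<close>.\<close>
  moreover have "F \<in> P" if "F \<in> null_sets M" for F
    using that AE_not_in[OF that]
    by (auto simp: P_def past_def cyl_def null_setsD2 intro!: exI[of _ "{{}}"] exI[of _ "\<lambda>_. {}"])
       (auto simp: noise_sets_def)
  ultimately have "sets (noise_filtration M L W a) \<subseteq> sigma_sets (space M) P"
    unfolding sets_noise_filtration by (intro sigma_sets_mono') auto
  then show ?thesis using ind unfolding Q_def[symmetric] indep_set_def
    by (rule_tac indep_sets_mono_sets) (auto split: bool.splits)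
qed

text \<open>Applied with \<open>g\<close> the identity for means and with \<open>g\<close> the
  square for covariances.\<close>

lemma indep_var_filtration_comb:
  fixes g :: "real \<Rightarrow> real"
  assumes B: "finite \<B>" "\<B> \<subseteq> noise_sets L" and fut: "\<And>B. B \<in> \<B> \<Longrightarrow> B \<subseteq> {a<..} \<times> UNIV"
    and Y: "Y \<in> borel_measurable (noise_filtration M L W a)"
    and g[measurable]: "g \<in> borel_measurable borel"
  shows "indep_var borel Y borel (\<lambda>\<omega>. g (comb d \<B> \<omega>))"
proof -
  have [measurable]: "comb d \<B> \<in> borel_measurable M" by (rule comb_measurable[OF B])
  have 1: "sigma_sets (space M) {Y -` A \<inter> space M |A. A \<in> sets borel} \<subseteq> sets (noise_filtration M L W a)"
    using sets.sigma_sets_subset[of "{Y -` A \<inter> space M |A. A \<in> sets borel}" "noise_filtration M L W a"]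
      measurable_sets[OF Y] by auto
  have "{(\<lambda>\<omega>. g (comb d \<B> \<omega>)) -` A \<inter> space M |A. A \<in> sets borel} \<subseteq> {comb d \<B> -` G \<inter> space M |G. G \<in> sets borel}"
  proof safe
    fix A :: "real set" assume "A \<in> sets borel"
    then have "g -` A \<in> sets borel" using measurable_sets[OF g, of A] by simp
    then show "\<exists>G. (\<lambda>\<omega>. g (comb d \<B> \<omega>)) -` A \<inter> space M = comb d \<B> -` G \<inter> space M \<and> G \<in> sets borel"
      by (intro exI[of _ "g -` A"]) auto
  qed
  then have 2: "sigma_sets (space M) {(\<lambda>\<omega>. g (comb d \<B> \<omega>)) -` A \<inter> space M |A. A \<in> sets borel}
      \<subseteq> sigma_sets (space M) {comb d \<B> -` G \<inter> space M |G. G \<in> sets borel}"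
    by (rule sigma_sets_mono')
  have "indep_set (sigma_sets (space M) {Y -` A \<inter> space M |A. A \<in> sets borel})
    (sigma_sets (space M) {(\<lambda>\<omega>. g (comb d \<B> \<omega>)) -` A \<inter> space M |A. A \<in> sets borel})"
    using indep_set_filtration_comb[OF B fut, of d] 1 2 unfolding indep_set_def
    by (rule_tac indep_sets_mono_sets) (auto split: bool.splits)
  then show ?thesis
    unfolding indep_var_eq using noise_filtration_measurable_imp[OF Y] by auto
qed

lemma expectation_filtration_W:
  assumes Y: "Y \<in> borel_measurable (noise_filtration M L W a)" "integrable M Y"
    and C: "C \<in> noise_sets L" "C \<subseteq> {a<..} \<times> UNIV"
  shows "integrable M (\<lambda>\<omega>. Y \<omega> * W C \<omega>)" "(\<integral>\<omega>. Y \<omega> * W C \<omega> \<partial>M) = 0"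
proof -
  have iv: "indep_var borel Y borel (W C)"
    using indep_var_filtration_comb[of "{C}" a Y "\<lambda>x. x" "\<lambda>_. 1"] C Y by (simp add: comb_def)
  note W = centered_gaussian_square_integrable(3,4)[OF W_gaussian[OF C(1)]]
  show "integrable M (\<lambda>\<omega>. Y \<omega> * W C \<omega>)" by (rule indep_var_integrable[OF iv Y(2) W(1)])
  show "(\<integral>\<omega>. Y \<omega> * W C \<omega> \<partial>M) = 0" using indep_var_lebesgue_integral[OF iv Y(2) W(1)] W(2) by simp
qed

text \<open>Independence from the past is available for functions of one combination only, so the
  product is recovered by polarisation from the squares of \<open>W C\<close>, \<open>W D\<close>
  and their sum. The case \<open>C = D\<close> is separate because there the family
  \<open>{C, D}\<close> has one member and its combination is not \<open>2 * W C\<close>.\<close>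

lemma expectation_filtration_W_W:
  assumes Y: "Y \<in> borel_measurable (noise_filtration M L W a)" "integrable M Y"
    and C: "C \<in> noise_sets L" "C \<subseteq> {a<..} \<times> UNIV" and D: "D \<in> noise_sets L" "D \<subseteq> {a<..} \<times> UNIV"
  shows "integrable M (\<lambda>\<omega>. Y \<omega> * (W C \<omega> * W D \<omega>))"
    "(\<integral>\<omega>. Y \<omega> * (W C \<omega> * W D \<omega>) \<partial>M) = (\<integral>\<omega>. Y \<omega> \<partial>M) * measure lborel (C \<inter> D)"
proof -
  have sq: "integrable M (\<lambda>\<omega>. Y \<omega> * (comb d \<B> \<omega>)\<^sup>2)"
    "(\<integral>\<omega>. Y \<omega> * (comb d \<B> \<omega>)\<^sup>2 \<partial>M) = (\<integral>\<omega>. Y \<omega> \<partial>M) * (\<integral>\<omega>. (comb d \<B> \<omega>)\<^sup>2 \<partial>M)"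
    if "\<B> \<subseteq> {C, D}" for \<B> d
  proof -
    have B: "finite \<B>" "\<B> \<subseteq> noise_sets L" "\<And>B. B \<in> \<B> \<Longrightarrow> B \<subseteq> {a<..} \<times> UNIV"
      using that C D by (auto intro: finite_subset)
    have iv: "indep_var borel Y borel (\<lambda>\<omega>. (comb d \<B> \<omega>)\<^sup>2)"
      using indep_var_filtration_comb[OF B Y(1), of power2 d] by simp
    note i2 = centered_gaussian_square_integrable(1)[OF comb_gaussian[OF B(1,2)]]
    show "integrable M (\<lambda>\<omega>. Y \<omega> * (comb d \<B> \<omega>)\<^sup>2)"
      "(\<integral>\<omega>. Y \<omega> * (comb d \<B> \<omega>)\<^sup>2 \<partial>M) = (\<integral>\<omega>. Y \<omega> \<partial>M) * (\<integral>\<omega>. (comb d \<B> \<omega>)\<^sup>2 \<partial>M)"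
      by (rule indep_var_integrable[OF iv Y(2) i2]) (rule indep_var_lebesgue_integral[OF iv Y(2) i2])
  qed
  have single: "integrable M (\<lambda>\<omega>. Y \<omega> * (W B \<omega>)\<^sup>2)" "(\<integral>\<omega>. Y \<omega> * (W B \<omega>)\<^sup>2 \<partial>M) = (\<integral>\<omega>. Y \<omega> \<partial>M) * measure lborel B"
    if "B \<in> {C, D}" for B
    using sq[of "{B}" "\<lambda>_. 1"] that W_covariance[of B B] C D by (auto simp: comb_def power2_eq_square)
  have "integrable M (\<lambda>\<omega>. Y \<omega> * (W C \<omega> * W D \<omega>)) \<and>
    (\<integral>\<omega>. Y \<omega> * (W C \<omega> * W D \<omega>) \<partial>M) = (\<integral>\<omega>. Y \<omega> \<partial>M) * measure lborel (C \<inter> D)"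
  proof (cases "C = D")
    case True
    then show ?thesis using single[of C] by (simp add: power2_eq_square)
  next
    case False
    then have c: "comb (\<lambda>_. 1) {C, D} \<omega> = W C \<omega> + W D \<omega>" for \<omega> by (simp add: comb_def)
    note s = sq[of "{C, D}" "\<lambda>_. 1", unfolded c, simplified]
    have eq: "Y \<omega> * (W C \<omega> * W D \<omega>) = (Y \<omega> * (W C \<omega> + W D \<omega>)\<^sup>2 - Y \<omega> * (W C \<omega>)\<^sup>2 - Y \<omega> * (W D \<omega>)\<^sup>2) / 2" for \<omega>
      by (simp add: power2_eq_square field_simps)
    have "(\<integral>\<omega>. (W C \<omega> + W D \<omega>)\<^sup>2 \<partial>M) = (\<integral>\<omega>. W C \<omega> * W C \<omega> + 2 * (W C \<omega> * W D \<omega>) + W D \<omega> * W D \<omega> \<partial>M)"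
      by (simp add: power2_eq_square algebra_simps)
    also have "\<dots> = measure lborel C + 2 * measure lborel (C \<inter> D) + measure lborel D"
      using C D by (simp add: W_mult_integrable W_covariance)
    finally have v: "(\<integral>\<omega>. (W C \<omega> + W D \<omega>)\<^sup>2 \<partial>M) = measure lborel C + 2 * measure lborel (C \<inter> D) + measure lborel D" .
    show ?thesis unfolding eq using s single[of C] single[of D] by (simp add: v field_simps)
  qed
  then show "integrable M (\<lambda>\<omega>. Y \<omega> * (W C \<omega> * W D \<omega>))"
    "(\<integral>\<omega>. Y \<omega> * (W C \<omega> * W D \<omega>) \<partial>M) = (\<integral>\<omega>. Y \<omega> \<partial>M) * measure lborel (C \<inter> D)" by auto
qed

text \<open>Additivity is no axiom of \<open>white_noise\<close>; the covariance shows that the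
  difference of the two sides has second moment 0.\<close>

lemma W_split:
  assumes A: "A \<in> noise_sets L" "B \<in> noise_sets L" and disj: "A \<inter> B = {}"
  shows "AE \<omega> in M. W (A \<union> B) \<omega> = W A \<omega> + W B \<omega>"
proof -
  have AB: "A \<union> B \<in> noise_sets L"
    using A plus_emeasure[of A lborel B] disj unfolding noise_sets_def
    by (auto simp: ennreal_add_less_top simp flip: plus_emeasure)
  define D where "D = (\<lambda>\<omega>. W (A \<union> B) \<omega> - W A \<omega> - W B \<omega>)"
  have m: "measure lborel (A \<union> B) = measure lborel A + measure lborel B"
    using A disj by (intro measure_Union) (auto simp: noise_sets_def)
  have D2: "(D \<omega>)\<^sup>2 = W (A \<union> B) \<omega> * W (A \<union> B) \<omega> + W A \<omega> * W A \<omega> + W B \<omega> * W B \<omega> - 2 * (W (A \<union> B) \<omega> * W A \<omega>)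
     - 2 * (W (A \<union> B) \<omega> * W B \<omega>) + 2 * (W A \<omega> * W B \<omega>)" for \<omega>
    by (simp add: D_def power2_eq_square algebra_simps)
  have "(A \<union> B) \<inter> A = A" "(A \<union> B) \<inter> B = B" by auto
  then have "(\<integral>\<omega>. (D \<omega>)\<^sup>2 \<partial>M) = 0" "integrable M (\<lambda>\<omega>. (D \<omega>)\<^sup>2)"
    unfolding D2 using A AB disj m by (simp_all add: W_mult_integrable W_covariance)
  then have "AE \<omega> in M. (D \<omega>)\<^sup>2 = 0" using integral_nonneg_eq_0_iff_AE[of M "\<lambda>\<omega>. (D \<omega>)\<^sup>2"] by simp
  then show ?thesis by eventually_elim (simp add: D_def)
qed

end

section \<open>The Walsh isometry\<close>

lemma (in prob_space) bounded_imp_integrable: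
  fixes X :: "'a \<Rightarrow> real"
  assumes "X \<in> borel_measurable M" "bounded (X ` space M)"
  shows "integrable M X"
proof -
  obtain B where "\<And>\<omega>. \<omega> \<in> space M \<Longrightarrow> norm (X \<omega>) \<le> B"
    using assms(2) by (auto simp: bounded_iff)
  then show ?thesis using assms(1) by (intro integrable_const_bound[of _ B]) auto
qed

lemma bounded_mult_image:
  fixes f g :: "'a \<Rightarrow> real"
  assumes "bounded (f ` A)" "bounded (g ` A)"
  shows "bounded ((\<lambda>x. f x * g x) ` A)"
proof -
  obtain B C where "\<And>x. x \<in> A \<Longrightarrow> norm (f x) \<le> B" "\<And>x. x \<in> A \<Longrightarrow> norm (g x) \<le> C"
    using assms by (auto simp: bounded_iff)
  then have "norm (f x * g x) \<le> B * C" if "x \<in> A" for x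
    using that by (auto simp: norm_mult simp del: real_norm_def intro!: mult_mono intro: order_trans[OF norm_ge_zero])
  then show ?thesis by (auto simp: bounded_iff)
qed

context noise
begin

definition elementary :: "('a \<Rightarrow> real) \<times> real \<times> real \<times> real set \<Rightarrow> bool" where
  "elementary = (\<lambda>(X, a, b, A). 0 \<le> a \<and> a < b \<and> A \<in> sets borel \<and> A \<subseteq> {0<..<L} \<and>
        X \<in> borel_measurable (noise_filtration M L W a) \<and> bounded (X ` space M))"

lemma is_simple_field_iff: "is_simple_field M L W h \<longleftrightarrow> (\<forall>e\<in>set h. elementary e)"
  by (auto simp: is_simple_field_def elementary_def)

lemma rectangle_noise_sets:
  assumes "0 \<le> a" "A \<in> sets borel" "A \<subseteq> {0<..<L}"
  shows "{a<..b} \<times> A \<in> noise_sets L"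
proof -
  have "emeasure lborel A \<le> emeasure lborel {0<..<L}"
    using assms by (intro emeasure_mono) auto
  also have "\<dots> < \<infinity>" by (cases "0 \<le> L") auto
  finally have A: "emeasure lborel A < \<infinity>" .
  have I: "emeasure lborel {a<..b} < \<infinity>" by (cases "a \<le> b") auto
  have "emeasure (lborel \<Otimes>\<^sub>M lborel) ({a<..b} \<times> A) = emeasure lborel {a<..b} * emeasure lborel A"
    using assms by (intro lborel.emeasure_pair_measure_Times) auto
  also have "\<dots> < \<infinity>" using A I by (simp add: ennreal_mult_less_top)
  finally show ?thesis using assms by (auto simp: noise_sets_def lborel_prod intro!: borel_Times)
qed

text \<open>
  The rectangle that starts first is cut at the starting time \<open>a'\<close> of the other one: the early part is
  known at time \<open>a'\<close> and contributes nothing.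
\<close>

lemma expectation_elementary_product:
  assumes e: "elementary (X, a, b, A)" and e': "elementary (X', a', b', A')"
  shows "integrable M (\<lambda>\<omega>. (X \<omega> * W ({a<..b} \<times> A) \<omega>) * (X' \<omega> * W ({a'<..b'} \<times> A') \<omega>)) \<and>
    (\<integral>\<omega>. (X \<omega> * W ({a<..b} \<times> A) \<omega>) * (X' \<omega> * W ({a'<..b'} \<times> A') \<omega>) \<partial>M) =
    (\<integral>\<omega>. X \<omega> * X' \<omega> \<partial>M) * measure lborel (({a<..b} \<times> A) \<inter> ({a'<..b'} \<times> A'))"
proof -
  have main: "integrable M (\<lambda>\<omega>. (X \<omega> * W ({a<..b} \<times> A) \<omega>) * (X' \<omega> * W ({a'<..b'} \<times> A') \<omega>)) \<and>
    (\<integral>\<omega>. (X \<omega> * W ({a<..b} \<times> A) \<omega>) * (X' \<omega> * W ({a'<..b'} \<times> A') \<omega>) \<partial>M) =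
    (\<integral>\<omega>. X \<omega> * X' \<omega> \<partial>M) * measure lborel (({a<..b} \<times> A) \<inter> ({a'<..b'} \<times> A'))"
    if e: "elementary (X, a, b, A)" and e': "elementary (X', a', b', A')" and le: "a \<le> a'"
    for X a b A X' a' b' A'
  proof -
    let ?R = "{a<..b} \<times> A" and ?R' = "{a'<..b'} \<times> A'"
    \<comment> \<open>The \<open>min\<close> covers a first rectangle that ends before
      \<open>a'\<close>; then \<open>?R2\<close> is empty.\<close>
    let ?R1 = "{a<..min b a'} \<times> A" and ?R2 = "{a'<..b} \<times> A"
    have R: "?R \<in> noise_sets L" "?R1 \<in> noise_sets L" "?R2 \<in> noise_sets L" "?R' \<in> noise_sets L"
      using e e' le by (auto simp: elementary_def intro!: rectangle_noise_sets)
    have eq: "?R = ?R1 \<union> ?R2" "?R1 \<inter> ?R2 = {}" using le by auto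
    have past: "?R1 \<subseteq> {0<..a'} \<times> UNIV" and fut: "?R2 \<subseteq> {a'<..} \<times> UNIV" "?R' \<subseteq> {a'<..} \<times> UNIV"
      using e by (auto simp: elementary_def)
    have split: "AE \<omega> in M. W ?R \<omega> = W ?R1 \<omega> + W ?R2 \<omega>"
      using W_split[OF R(2,3) eq(2)] eq(1) by simp
    define Y where "Y = (\<lambda>\<omega>. X \<omega> * X' \<omega>)"
    have XF: "X \<in> borel_measurable (noise_filtration M L W a)" "X' \<in> borel_measurable (noise_filtration M L W a')"
      and Xb: "bounded (X ` space M)" "bounded (X' ` space M)"
      using e e' by (simp_all add: elementary_def)
    have YF: "Y \<in> borel_measurable (noise_filtration M L W a')"
      unfolding Y_def by (rule borel_measurable_times[OF noise_filtration_measurable_mono[OF XF(1) le] XF(2)])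
    have Ym[measurable]: "Y \<in> borel_measurable M" by (rule noise_filtration_measurable_imp[OF YF])
    note [measurable] = XF[THEN noise_filtration_measurable_imp]
    have Yb: "bounded (Y ` space M)"
      unfolding Y_def by (rule bounded_mult_image[OF Xb])
    have Yi: "integrable M Y" by (rule bounded_imp_integrable[OF Ym Yb])
    note [measurable] = R[THEN W_measurable]
    obtain B where B: "\<And>\<omega>. \<omega> \<in> space M \<Longrightarrow> \<bar>Y \<omega>\<bar> \<le> B"
      using Yb by (auto simp: bounded_iff)
    have iW1: "integrable M (W ?R1)" by (rule centered_gaussian_square_integrable(3)[OF W_gaussian[OF R(2)]])
    have Y1F: "(\<lambda>\<omega>. Y \<omega> * W ?R1 \<omega>) \<in> borel_measurable (noise_filtration M L W a')"
      by (rule borel_measurable_times[OF YF W_noise_filtration_measurable[OF R(2) past]])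
    have Y1i: "integrable M (\<lambda>\<omega>. Y \<omega> * W ?R1 \<omega>)"
      by (rule Bochner_Integration.integrable_bound[OF integrable_mult_right[OF iW1, of B]])
        (use B in \<open>auto simp: abs_mult intro!: AE_I2 mult_right_mono intro: order_trans[OF _ abs_ge_self]\<close>)
    note s1 = expectation_filtration_W[OF Y1F Y1i R(4) fut(2)]
    note s2 = expectation_filtration_W_W[OF YF Yi R(3) fut(1) R(4) fut(2)]
    have ae: "AE \<omega> in M. (X \<omega> * W ?R \<omega>) * (X' \<omega> * W ?R' \<omega>) = Y \<omega> * W ?R1 \<omega> * W ?R' \<omega> + Y \<omega> * (W ?R2 \<omega> * W ?R' \<omega>)"
      using split by eventually_elim (simp add: Y_def algebra_simps)
    have inter: "?R \<inter> ?R' = ?R2 \<inter> ?R'" using le by auto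
    have int: "integrable M (\<lambda>\<omega>. Y \<omega> * W ?R1 \<omega> * W ?R' \<omega> + Y \<omega> * (W ?R2 \<omega> * W ?R' \<omega>))"
      using s1(1) s2(1) by simp
    have "integrable M (\<lambda>\<omega>. (X \<omega> * W ?R \<omega>) * (X' \<omega> * W ?R' \<omega>))"
      by (rule integrable_cong_AE_imp[OF int]) (use ae in auto)
    moreover have "(\<integral>\<omega>. (X \<omega> * W ?R \<omega>) * (X' \<omega> * W ?R' \<omega>) \<partial>M) =
        (\<integral>\<omega>. Y \<omega> * W ?R1 \<omega> * W ?R' \<omega> + Y \<omega> * (W ?R2 \<omega> * W ?R' \<omega>) \<partial>M)"
      by (rule integral_cong_AE) (use ae in auto)
    ultimately show ?thesis using s1 s2 by (simp add: inter Y_def)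
  qed
  show ?thesis
  proof (cases "a \<le> a'")
    case True
    then show ?thesis by (rule main[OF e e'])
  next
    case False
    then have "a' \<le> a" by simp
    from main[OF e' e this] show ?thesis by (simp add: mult.commute Int_commute)
  qed
qed

section \<open>The isometry for simple fields\<close>

lemma simple_walsh_integral_sum:
  "simple_walsh_integral W h \<omega> = (\<Sum>i<length h. (case h ! i of (X, a, b, A) \<Rightarrow> X \<omega> * W ({a<..b} \<times> A) \<omega>))"
  by (simp add: simple_walsh_integral_def sum_list_sum_nth atLeast0LessThan)

lemma simple_field_value_sum:
  "simple_field_value h s y \<omega> = (\<Sum>i<length h. (case h ! i of (X, a, b, A) \<Rightarrow> X \<omega> * indicator ({a<..b} \<times> A) (s, y)))"
  by (simp add: simple_field_value_def sum_list_sum_nth atLeast0LessThan)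

text \<open>The rectangles of a simple field may overlap and are not sorted in time, hence the full
  double sum over pairs instead of a diagonal sum.\<close>

lemma simple_walsh_expectation:
  assumes h: "is_simple_field M L W h"
  shows "integrable M (\<lambda>\<omega>. (simple_walsh_integral W h \<omega>)\<^sup>2)"
    and "(\<integral>\<omega>. (simple_walsh_integral W h \<omega>)\<^sup>2 \<partial>M) =
      (\<Sum>i<length h. \<Sum>j<length h. case (h ! i, h ! j) of ((X, a, b, A), (X', a', b', A')) \<Rightarrow>
         (\<integral>\<omega>. X \<omega> * X' \<omega> \<partial>M) * measure lborel (({a<..b} \<times> A) \<inter> ({a'<..b'} \<times> A')))"
    and "integrable M (simple_walsh_integral W h)"
    and "(\<integral>\<omega>. simple_walsh_integral W h \<omega> \<partial>M) = 0"
proof -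
  define T where "T i \<omega> = (case h ! i of (X, a, b, A) \<Rightarrow> X \<omega> * W ({a<..b} \<times> A) \<omega>)" for i \<omega>
  have el: "elementary (h ! i)" if "i < length h" for i
    using h that by (auto simp: is_simple_field_iff)
  have sq: "(simple_walsh_integral W h \<omega>)\<^sup>2 = (\<Sum>i<length h. \<Sum>j<length h. T i \<omega> * T j \<omega>)" for \<omega>
    unfolding simple_walsh_integral_sum T_def[symmetric] power2_eq_square sum_product ..
  have *: "integrable M (\<lambda>\<omega>. T i \<omega> * T j \<omega>) \<and> (\<integral>\<omega>. T i \<omega> * T j \<omega> \<partial>M) =
    (case (h ! i, h ! j) of ((X, a, b, A), (X', a', b', A')) \<Rightarrow>
         (\<integral>\<omega>. X \<omega> * X' \<omega> \<partial>M) * measure lborel (({a<..b} \<times> A) \<inter> ({a'<..b'} \<times> A')))"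
    if "i < length h" "j < length h" for i j
  proof -
    obtain X a b A X' a' b' A' where "h ! i = (X, a, b, A)" "h ! j = (X', a', b', A')"
      by (metis prod_cases4)
    then show ?thesis
      using expectation_elementary_product[of X a b A X' a' b' A'] el[OF that(1)] el[OF that(2)] by (simp add: T_def)
  qed
  show "integrable M (\<lambda>\<omega>. (simple_walsh_integral W h \<omega>)\<^sup>2)"
    unfolding sq using * by (intro Bochner_Integration.integrable_sum) auto
  show "(\<integral>\<omega>. (simple_walsh_integral W h \<omega>)\<^sup>2 \<partial>M) =
      (\<Sum>i<length h. \<Sum>j<length h. case (h ! i, h ! j) of ((X, a, b, A), (X', a', b', A')) \<Rightarrow>
         (\<integral>\<omega>. X \<omega> * X' \<omega> \<partial>M) * measure lborel (({a<..b} \<times> A) \<inter> ({a'<..b'} \<times> A')))"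
    unfolding sq using *
    by (subst Bochner_Integration.integral_sum, force intro!: Bochner_Integration.integrable_sum,
        intro sum.cong refl, subst Bochner_Integration.integral_sum) auto
  have **: "integrable M (T i) \<and> (\<integral>\<omega>. T i \<omega> \<partial>M) = 0" if "i < length h" for i
  proof -
    obtain X a b A where hi: "h ! i = (X, a, b, A)" by (metis prod_cases4)
    have e: "elementary (X, a, b, A)" using el[OF that] hi by simp
    then have F: "X \<in> borel_measurable (noise_filtration M L W a)" "bounded (X ` space M)" by (auto simp: elementary_def)
    have i: "integrable M X" by (rule bounded_imp_integrable[OF noise_filtration_measurable_imp[OF F(1)] F(2)])
    have "{a<..b} \<times> A \<in> noise_sets L" "{a<..b} \<times> A \<subseteq> {a<..} \<times> UNIV"
      using e by (auto simp: elementary_def intro!: rectangle_noise_sets)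
    from expectation_filtration_W[OF F(1) i this] show ?thesis by (simp add: T_def[abs_def] hi)
  qed
  have T: "simple_walsh_integral W h = (\<lambda>\<omega>. \<Sum>i<length h. T i \<omega>)"
    by (simp add: fun_eq_iff simple_walsh_integral_sum T_def)
  show "integrable M (simple_walsh_integral W h)" "(\<integral>\<omega>. simple_walsh_integral W h \<omega> \<partial>M) = 0"
    unfolding T using ** by (auto intro!: Bochner_Integration.integrable_sum)
qed

lemma nn_integral_triple:
  fixes f :: "real \<times> real \<times> 'a \<Rightarrow> ennreal"
  assumes f: "f \<in> borel_measurable (lborel \<Otimes>\<^sub>M lborel \<Otimes>\<^sub>M M)"
  shows "(\<integral>\<^sup>+ (s, y, \<omega>). f (s, y, \<omega>) \<partial>(lborel \<Otimes>\<^sub>M lborel \<Otimes>\<^sub>M M)) =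
    (\<integral>\<^sup>+ s. \<integral>\<^sup>+ y. \<integral>\<^sup>+ \<omega>. f (s, y, \<omega>) \<partial>M \<partial>lborel \<partial>lborel)"
proof -
  interpret yw: pair_sigma_finite "lborel :: real measure" M by unfold_locales
  note f[measurable]
  have "(\<integral>\<^sup>+ z. f z \<partial>(lborel \<Otimes>\<^sub>M lborel \<Otimes>\<^sub>M M)) = (\<integral>\<^sup>+ s. \<integral>\<^sup>+ z. f (s, z) \<partial>(lborel \<Otimes>\<^sub>M M) \<partial>lborel)"
    by (rule yw.P.nn_integral_fst[OF f, symmetric])
  also have "\<dots> = (\<integral>\<^sup>+ s. \<integral>\<^sup>+ y. \<integral>\<^sup>+ \<omega>. f (s, y, \<omega>) \<partial>M \<partial>lborel \<partial>lborel)"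
  proof (intro nn_integral_cong)
    fix s :: real
    have m: "(\<lambda>z. f (s, z)) \<in> borel_measurable (lborel \<Otimes>\<^sub>M M)" by measurable
    show "(\<integral>\<^sup>+ z. f (s, z) \<partial>(lborel \<Otimes>\<^sub>M M)) = (\<integral>\<^sup>+ y. \<integral>\<^sup>+ \<omega>. f (s, y, \<omega>) \<partial>M \<partial>lborel)"
      using nn_integral_fst[OF m] by simp
  qed
  finally show ?thesis by (simp add: case_prod_unfold)
qed

text \<open>For fixed \<open>(s, y)\<close> the second moment of the field is
  \<open>G (s, y)\<close>, a double sum of products of expectations and indicators of intersections.
  Integrated over the plane it becomes the double sum of \<open>simple_walsh_expectation\<close>,
  term by term.\<close>

lemma simple_walsh_isometry:
  assumes h: "is_simple_field M L W h"
  shows "(\<integral>\<^sup>+ (s, y, \<omega>). ennreal ((simple_field_value h s y \<omega>)\<^sup>2) \<partial>(lborel \<Otimes>\<^sub>M lborel \<Otimes>\<^sub>M M)) =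
    (\<integral>\<^sup>+ \<omega>. ennreal ((simple_walsh_integral W h \<omega>)\<^sup>2) \<partial>M)"
    and "(\<lambda>(s, y, \<omega>). simple_field_value h s y \<omega>) \<in> borel_measurable (lborel \<Otimes>\<^sub>M lborel \<Otimes>\<^sub>M M)"
proof -
  define X a b A where "X i = fst (h ! i)" and "a i = fst (snd (h ! i))" and
    "b i = fst (snd (snd (h ! i)))" and "A i = snd (snd (snd (h ! i)))" for i
  have hi: "h ! i = (X i, a i, b i, A i)" for i by (simp add: X_def a_def b_def A_def)
  define R where "R i = {a i<..b i} \<times> A i" for i
  have el: "elementary (X i, a i, b i, A i)" if "i < length h" for i
    using h that by (metis hi is_simple_field_iff nth_mem)
  have A_m: "A i \<in> sets borel" and Xm: "X i \<in> borel_measurable M" and Xb: "bounded (X i ` space M)"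
    and Rn: "R i \<in> noise_sets L" if "i < length h" for i
    using el[OF that] unfolding R_def elementary_def
    by (auto intro: noise_filtration_measurable_imp rectangle_noise_sets)
  have val: "simple_field_value h s y \<omega> = (\<Sum>i<length h. X i \<omega> * indicator (R i) (s, y))" for s y \<omega>
    by (simp add: simple_field_value_sum hi R_def)
  have m1: "(\<lambda>(s, y, \<omega>). X i \<omega> * indicator (R i) (s, y)) \<in> borel_measurable (lborel \<Otimes>\<^sub>M lborel \<Otimes>\<^sub>M M)"
    if i: "i < length h" for i
  proof -
    note [measurable] = Xm[OF i] A_m[OF i]
    show ?thesis unfolding R_def indicator_times by measurable
  qed
  show m: "(\<lambda>(s, y, \<omega>). simple_field_value h s y \<omega>) \<in> borel_measurable (lborel \<Otimes>\<^sub>M lborel \<Otimes>\<^sub>M M)"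
    unfolding val case_prod_unfold by (rule borel_measurable_sum) (rule m1[unfolded case_prod_unfold], simp)
  have XXi: "integrable M (\<lambda>\<omega>. X i \<omega> * X j \<omega>)" if "i < length h" "j < length h" for i j
    using Xm[OF that(1)] Xm[OF that(2)] Xb[OF that(1)] Xb[OF that(2)]
    by (intro bounded_imp_integrable bounded_mult_image) auto
  define G where "G z = (\<Sum>i<length h. \<Sum>j<length h. (\<integral>\<omega>. X i \<omega> * X j \<omega> \<partial>M) * indicator (R i \<inter> R j) z)" for z
  have sq: "(simple_field_value h s y \<omega>)\<^sup>2 =
      (\<Sum>i<length h. \<Sum>j<length h. (X i \<omega> * X j \<omega>) * indicator (R i \<inter> R j) (s, y))" for s y \<omega>
    unfolding val power2_eq_square sum_product
    by (intro sum.cong refl) (simp add: indicator_inter_arith mult_ac)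
  have inner: "(\<integral>\<^sup>+ \<omega>. ennreal ((simple_field_value h s y \<omega>)\<^sup>2) \<partial>M) = ennreal (G (s, y)) \<and> 0 \<le> G (s, y)" for s y
  proof -
    have i: "integrable M (\<lambda>\<omega>. (simple_field_value h s y \<omega>)\<^sup>2)"
      unfolding sq using XXi by (intro Bochner_Integration.integrable_sum integrable_mult_left) auto
    have "(\<integral>\<omega>. (simple_field_value h s y \<omega>)\<^sup>2 \<partial>M) = G (s, y)"
      unfolding sq G_def using XXi
      by (subst Bochner_Integration.integral_sum, force intro!: Bochner_Integration.integrable_sum,
        intro sum.cong refl, subst Bochner_Integration.integral_sum) auto
    moreover have "0 \<le> (\<integral>\<omega>. (simple_field_value h s y \<omega>)\<^sup>2 \<partial>M)" by simp
    ultimately show ?thesis using nn_integral_eq_integral[OF i] by simp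
  qed
  have fin: "emeasure lborel (R i \<inter> R j) < \<infinity>" "R i \<inter> R j \<in> sets borel" if "i < length h" "j < length h" for i j
  proof -
    have "emeasure lborel (R i \<inter> R j) \<le> emeasure lborel (R i)"
      using Rn[OF that(1)] by (intro emeasure_mono) (auto simp: noise_sets_def)
    also have "\<dots> < \<infinity>" using Rn[OF that(1)] by (auto simp: noise_sets_def)
    finally show "emeasure lborel (R i \<inter> R j) < \<infinity>" .
    show "R i \<inter> R j \<in> sets borel" using Rn[OF that(1)] Rn[OF that(2)] by (auto simp: noise_sets_def)
  qed
  have Gi: "integrable lborel G" unfolding G_def[abs_def] using fin
    by (intro Bochner_Integration.integrable_sum integrable_mult_right integrable_real_indicator) auto
  have Gint: "(\<integral>z. G z \<partial>lborel) = (\<Sum>i<length h. \<Sum>j<length h. (\<integral>\<omega>. X i \<omega> * X j \<omega> \<partial>M) * measure lborel (R i \<inter> R j))"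
    unfolding G_def[abs_def] using fin
    by (subst Bochner_Integration.integral_sum,
        force intro!: Bochner_Integration.integrable_sum integrable_mult_right integrable_real_indicator,
        intro sum.cong refl, subst Bochner_Integration.integral_sum)
       (auto intro!: integrable_mult_right integrable_real_indicator)
  have Gm[measurable]: "G \<in> borel_measurable borel" using Gi by auto
  have "(\<integral>\<^sup>+ (s, y, \<omega>). ennreal ((simple_field_value h s y \<omega>)\<^sup>2) \<partial>(lborel \<Otimes>\<^sub>M lborel \<Otimes>\<^sub>M M)) =
     (\<integral>\<^sup>+ s. \<integral>\<^sup>+ y. \<integral>\<^sup>+ \<omega>. ennreal ((simple_field_value h s y \<omega>)\<^sup>2) \<partial>M \<partial>lborel \<partial>lborel)"
    using nn_integral_triple[of "\<lambda>(s, y, \<omega>). ennreal ((simple_field_value h s y \<omega>)\<^sup>2)"] m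
    by (simp add: case_prod_unfold)
  also have "\<dots> = (\<integral>\<^sup>+ s. \<integral>\<^sup>+ y. ennreal (G (s, y)) \<partial>lborel \<partial>lborel)" using inner by simp
  also have "\<dots> = (\<integral>\<^sup>+ z. ennreal (G z) \<partial>(lborel \<Otimes>\<^sub>M lborel))"
    by (rule lborel.nn_integral_fst) (simp add: lborel_prod)
  also have "\<dots> = ennreal (\<integral>z. G z \<partial>lborel)"
    unfolding lborel_prod using Gi inner by (intro nn_integral_eq_integral) auto
  also have "(\<integral>z. G z \<partial>lborel) = (\<integral>\<omega>. (simple_walsh_integral W h \<omega>)\<^sup>2 \<partial>M)"
    unfolding Gint simple_walsh_expectation(2)[OF h] by (simp add: hi R_def)
  also have "ennreal \<dots> = (\<integral>\<^sup>+ \<omega>. ennreal ((simple_walsh_integral W h \<omega>)\<^sup>2) \<partial>M)"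
    by (rule nn_integral_eq_integral[OF simple_walsh_expectation(1)[OF h], symmetric]) simp
  finally show "(\<integral>\<^sup>+ (s, y, \<omega>). ennreal ((simple_field_value h s y \<omega>)\<^sup>2) \<partial>(lborel \<Otimes>\<^sub>M lborel \<Otimes>\<^sub>M M)) =
    (\<integral>\<^sup>+ \<omega>. ennreal ((simple_walsh_integral W h \<omega>)\<^sup>2) \<partial>M)" .
qed

end

section \<open>Passage to the limit in mean square\<close>

lemma power2_le_weighted:
  fixes x y \<eta> :: real
  assumes "0 < \<eta>"
  shows "x\<^sup>2 \<le> (1 + \<eta>) * y\<^sup>2 + (1 + 1 / \<eta>) * (x - y)\<^sup>2"
proof -
  define s where "s = sqrt \<eta>"
  have s: "0 < s" "\<eta> = s\<^sup>2" using assms by (auto simp: s_def)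
  \<comment> \<open>Young's inequality: this square absorbs the cross term in the expansion of
    \<open>x = y + (x - y)\<close>, with the weight \<open>\<eta>\<close> on
    \<open>y\<^sup>2\<close>.\<close>
  have "0 \<le> (s * y - (x - y) / s)\<^sup>2" by simp
  also have "\<dots> = \<eta> * y\<^sup>2 + (x - y)\<^sup>2 / \<eta> - 2 * y * (x - y)"
    using s(1) by (simp add: s(2) power2_eq_square field_simps)
  finally have "0 \<le> \<eta> * y\<^sup>2 + (x - y)\<^sup>2 / \<eta> - 2 * y * (x - y)" .
  moreover have "x\<^sup>2 = y\<^sup>2 + (x - y)\<^sup>2 + 2 * y * (x - y)" by (simp add: power2_eq_square algebra_simps)
  moreover have "(1 + \<eta>) * y\<^sup>2 + (1 + 1 / \<eta>) * (x - y)\<^sup>2 = y\<^sup>2 + \<eta> * y\<^sup>2 + (x - y)\<^sup>2 + (x - y)\<^sup>2 / \<eta>"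
    by (simp add: distrib_right)
  ultimately show ?thesis by linarith
qed

lemma nn_integral_power2_le_weighted:
  fixes f g :: "'a \<Rightarrow> real"
  assumes [measurable]: "f \<in> borel_measurable M" "g \<in> borel_measurable M" and "0 < \<eta>"
  shows "(\<integral>\<^sup>+ x. ennreal ((f x)\<^sup>2) \<partial>M) \<le>
    ennreal (1 + \<eta>) * (\<integral>\<^sup>+ x. ennreal ((g x)\<^sup>2) \<partial>M) + ennreal (1 + 1 / \<eta>) * (\<integral>\<^sup>+ x. ennreal ((f x - g x)\<^sup>2) \<partial>M)"
proof -
  have "(\<integral>\<^sup>+ x. ennreal ((f x)\<^sup>2) \<partial>M) \<le> (\<integral>\<^sup>+ x. ennreal (1 + \<eta>) * ennreal ((g x)\<^sup>2) + ennreal (1 + 1 / \<eta>) * ennreal ((f x - g x)\<^sup>2) \<partial>M)"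
    using power2_le_weighted[OF \<open>0 < \<eta>\<close>] \<open>0 < \<eta>\<close>
    by (intro nn_integral_mono) (simp flip: ennreal_mult ennreal_plus)
  also have "\<dots> = ennreal (1 + \<eta>) * (\<integral>\<^sup>+ x. ennreal ((g x)\<^sup>2) \<partial>M) + ennreal (1 + 1 / \<eta>) * (\<integral>\<^sup>+ x. ennreal ((f x - g x)\<^sup>2) \<partial>M)"
    by (simp add: nn_integral_add nn_integral_cmult)
  finally show ?thesis .
qed

text \<open>Continuity of the norm for integrals that may be infinite. For fixed
  \<open>\<eta>\<close> the error terms have finite factors and vanish as \<open>n\<close> grows;
  afterwards \<open>\<eta>\<close> tends to 0. Using it in both directions gives equality of the two
  norms.\<close>

lemma nn_integral_power2_limit_le:
  fixes f :: "'a \<Rightarrow> real" and g :: "'b \<Rightarrow> real"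
  assumes [measurable]: "f \<in> borel_measurable M" "\<And>n. fn n \<in> borel_measurable M"
      "g \<in> borel_measurable N" "\<And>n. gn n \<in> borel_measurable N"
    and eq: "\<And>n. (\<integral>\<^sup>+ x. ennreal ((fn n x)\<^sup>2) \<partial>M) = (\<integral>\<^sup>+ x. ennreal ((gn n x)\<^sup>2) \<partial>N)"
    and f: "(\<lambda>n. \<integral>\<^sup>+ x. ennreal ((f x - fn n x)\<^sup>2) \<partial>M) \<longlonglongrightarrow> 0"
    and g: "(\<lambda>n. \<integral>\<^sup>+ x. ennreal ((g x - gn n x)\<^sup>2) \<partial>N) \<longlonglongrightarrow> 0"
  shows "(\<integral>\<^sup>+ x. ennreal ((f x)\<^sup>2) \<partial>M) \<le> (\<integral>\<^sup>+ x. ennreal ((g x)\<^sup>2) \<partial>N)" (is "?F \<le> ?G")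
proof -
  have step: "?F \<le> ennreal ((1 + \<eta>) * (1 + \<eta>)) * ?G" if "0 < \<eta>" for \<eta> :: real
  proof -
    define \<alpha> \<beta> where "\<alpha> = ennreal (1 + \<eta>)" and "\<beta> = ennreal (1 + 1 / \<eta>)"
    have bound: "?F \<le> \<alpha> * \<alpha> * ?G + (\<alpha> * \<beta> * (\<integral>\<^sup>+ x. ennreal ((g x - gn n x)\<^sup>2) \<partial>N)
        + \<beta> * (\<integral>\<^sup>+ x. ennreal ((f x - fn n x)\<^sup>2) \<partial>M))" for n
    proof -
      have "?F \<le> \<alpha> * (\<integral>\<^sup>+ x. ennreal ((gn n x)\<^sup>2) \<partial>N) + \<beta> * (\<integral>\<^sup>+ x. ennreal ((f x - fn n x)\<^sup>2) \<partial>M)"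
        using nn_integral_power2_le_weighted[of f M "fn n", OF _ _ that] eq by (simp only: \<alpha>_def \<beta>_def assms)
      moreover have "(\<integral>\<^sup>+ x. ennreal ((gn n x)\<^sup>2) \<partial>N) \<le>
          \<alpha> * ?G + \<beta> * (\<integral>\<^sup>+ x. ennreal ((g x - gn n x)\<^sup>2) \<partial>N)"
        using nn_integral_power2_le_weighted[of "gn n" N g, OF _ _ that]
        by (simp only: \<alpha>_def \<beta>_def assms power2_commute[of "g _"])
      ultimately have "?F \<le> \<alpha> * (\<alpha> * ?G + \<beta> * (\<integral>\<^sup>+ x. ennreal ((g x - gn n x)\<^sup>2) \<partial>N)) + \<beta> * (\<integral>\<^sup>+ x. ennreal ((f x - fn n x)\<^sup>2) \<partial>M)"
        by (meson add_right_mono mult_left_mono order_trans zero_le)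
      then show ?thesis by (simp only: distrib_left mult.assoc add.assoc)
    qed
    have "(\<lambda>n. \<alpha> * \<alpha> * ?G + (\<alpha> * \<beta> * (\<integral>\<^sup>+ x. ennreal ((g x - gn n x)\<^sup>2) \<partial>N)
        + \<beta> * (\<integral>\<^sup>+ x. ennreal ((f x - fn n x)\<^sup>2) \<partial>M))) \<longlonglongrightarrow> \<alpha> * \<alpha> * ?G + (\<alpha> * \<beta> * 0 + \<beta> * 0)"
      by (intro tendsto_add tendsto_const ennreal_tendsto_cmult f g) (auto simp: \<alpha>_def \<beta>_def ennreal_mult_less_top)
    from tendsto_lowerbound[OF this always_eventually[OF allI[OF bound]]]
    have "?F \<le> \<alpha> * \<alpha> * ?G" by simp
    also have "\<alpha> * \<alpha> = ennreal ((1 + \<eta>) * (1 + \<eta>))"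
      using that unfolding \<alpha>_def by (intro ennreal_mult[symmetric]) auto
    finally show ?thesis .
  qed
  show ?thesis
  proof (cases "?G = \<top>")
    case False
    then obtain G where G: "?G = ennreal G" "0 \<le> G" by (cases ?G) auto
    \<comment> \<open>The crude bound with \<open>\<eta> = 1\<close> makes the left side finite as
      well, so that the limit in \<open>\<eta>\<close> is one of real numbers.\<close>
    from step[of 1] G have "?F < \<top>" by (auto simp: ennreal_mult_less_top elim!: le_less_trans)
    then obtain F where F: "?F = ennreal F" "0 \<le> F" by (cases ?F) auto
    have le: "F \<le> (1 + \<eta>) * (1 + \<eta>) * G" if "0 < \<eta>" for \<eta>
      using step[OF that] that F G by (simp flip: ennreal_mult)
    have "((\<lambda>\<eta>. (1 + \<eta>) * (1 + \<eta>) * G) \<longlongrightarrow> (1 + 0) * (1 + 0) * G) (at_right 0)"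
      by (intro tendsto_intros)
    then have "F \<le> (1 + 0) * (1 + 0) * G"
      by (rule tendsto_lowerbound) (auto simp: eventually_at_right_field intro!: le exI[of _ 1])
    then show ?thesis using F G by simp
  qed simp
qed

context noise
begin

text \<open>Connects the predictable sets with the product sigma-algebra on which Tonelli's theorem
  is available. It suffices to look at the generating rectangles, since every sigma-algebra of the
  filtration lies in that of \<open>M\<close>.\<close>

lemma predictable_algebra_measurable:
  "(\<lambda>z. z) \<in> measurable (restrict_space (lborel \<Otimes>\<^sub>M lborel \<Otimes>\<^sub>M M) ({0<..} \<times> {0..L} \<times> space M)) (predictable_algebra M L W)"
  unfolding predictable_algebra_def
proof (rule measurable_sigma_sets)
  let ?S = "{{a<..b} \<times> A \<times> F |a b A F.
          0 \<le> a \<and> a < b \<and> A \<in> sets borel \<and> A \<subseteq> {0..L} \<and> F \<in> sets (noise_filtration M L W a)}"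
  show "?S \<subseteq> Pow ({0<..} \<times> {0..L} \<times> space M)"
  proof
    fix B assume "B \<in> ?S"
    then obtain a b A F where B: "B = {a<..b} \<times> A \<times> F" "0 \<le> a" "A \<subseteq> {0..L}" "F \<in> sets (noise_filtration M L W a)"
      by blast
    have "F \<subseteq> space M" using sets.sets_into_space[OF B(4)] by simp
    then show "B \<in> Pow ({0<..} \<times> {0..L} \<times> space M)" using B by auto
  qed
  show "sets (measure_of ({0<..} \<times> {0..L} \<times> space M) ?S (\<lambda>x. 0)) = sigma_sets ({0<..} \<times> {0..L} \<times> space M) ?S"
    by (rule sets_measure_of) fact
  show "(\<lambda>z. z) \<in> space (restrict_space (lborel \<Otimes>\<^sub>M lborel \<Otimes>\<^sub>M M) ({0<..} \<times> {0..L} \<times> space M)) \<rightarrow> {0<..} \<times> {0..L} \<times> space M"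
    by (auto simp: space_restrict_space)
  fix B assume "B \<in> ?S"
  then obtain a b A F where B: "B = {a<..b} \<times> A \<times> F" "0 \<le> a" "A \<in> sets borel" "A \<subseteq> {0..L}" "F \<in> sets (noise_filtration M L W a)"
    by blast
  then have F: "F \<in> sets M" using sets_noise_filtration_subset by auto
  have "B \<in> sets (lborel \<Otimes>\<^sub>M lborel \<Otimes>\<^sub>M M)" using B F by auto
  moreover have "B \<subseteq> {0<..} \<times> {0..L} \<times> space M" using B sets.sets_into_space[OF F] by auto
  ultimately show "(\<lambda>z. z) -` B \<inter> space (restrict_space (lborel \<Otimes>\<^sub>M lborel \<Otimes>\<^sub>M M) ({0<..} \<times> {0..L} \<times> space M))
      \<in> sets (restrict_space (lborel \<Otimes>\<^sub>M lborel \<Otimes>\<^sub>M M) ({0<..} \<times> {0..L} \<times> space M))"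
    by (subst sets_restrict_space_iff) (auto simp: space_restrict_space space_pair_measure Int_absorb2 Int_absorb1)
qed

text \<open>The indicator is there because predictability says nothing about the field at
  nonpositive times or outside \<open>[0, L]\<close>.\<close>

lemma predictable_measurable:
  assumes "predictable M L W \<Phi>"
  shows "(\<lambda>(s, y, \<omega>). \<Phi> s y \<omega> * indicator ({0<..} \<times> {0..L}) (s, y)) \<in> borel_measurable (lborel \<Otimes>\<^sub>M lborel \<Otimes>\<^sub>M M)"
proof -
  have "(\<lambda>(s, y, \<omega>). \<Phi> s y \<omega>) \<in> borel_measurable (restrict_space (lborel \<Otimes>\<^sub>M lborel \<Otimes>\<^sub>M M) ({0<..} \<times> {0..L} \<times> space M))"
    using measurable_comp[OF predictable_algebra_measurable assms[unfolded predictable_def]] by (simp add: comp_def)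
  then have "(\<lambda>z. (case z of (s, y, \<omega>) \<Rightarrow> \<Phi> s y \<omega>) * indicator ({0<..} \<times> {0..L} \<times> space M) z) \<in> borel_measurable (lborel \<Otimes>\<^sub>M lborel \<Otimes>\<^sub>M M)"
    by (subst (asm) borel_measurable_restrict_space_iff) (auto simp: mult.commute space_pair_measure)
  then show ?thesis
    by (rule measurable_cong[THEN iffD1, rotated]) (auto simp: space_pair_measure indicator_def)
qed

lemma predictable_measurable_section:
  assumes "predictable M L W \<Phi>" "0 < s" "y \<in> {0..L}"
  shows "\<Phi> s y \<in> borel_measurable M"
proof -
  have m: "(\<lambda>\<omega>. (s, y, \<omega>)) \<in> measurable M (lborel \<Otimes>\<^sub>M lborel \<Otimes>\<^sub>M M)" by measurable
  from measurable_comp[OF m predictable_measurable[OF assms(1)]] show ?thesis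
    using assms(2,3) by (simp add: comp_def)
qed

lemma walsh_isometry:
  assumes "has_walsh_integral M L W \<Phi> I"
  shows "(\<integral>\<^sup>+ \<omega>. ennreal ((I \<omega>)\<^sup>2) \<partial>M) =
     (\<integral>\<^sup>+ s. \<integral>\<^sup>+ y. \<integral>\<^sup>+ \<omega>. ennreal ((\<Phi> s y \<omega>)\<^sup>2) * indicator ({0<..} \<times> {0<..<L}) (s, y) \<partial>M \<partial>lborel \<partial>lborel)"
    (is "?I = ?\<Phi>")
    and "I \<in> borel_measurable M"
    and "(\<integral>\<^sup>+ \<omega>. ennreal ((I \<omega>)\<^sup>2) \<partial>M) < \<infinity> \<Longrightarrow> (\<integral>\<omega>. I \<omega> \<partial>M) = 0"
proof -
  let ?\<mu> = "lborel \<Otimes>\<^sub>M lborel \<Otimes>\<^sub>M M :: (real \<times> real \<times> 'a) measure"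
  obtain h where P: "predictable M L W \<Phi>" and Im[measurable]: "I \<in> borel_measurable M"
    and h: "\<And>n. is_simple_field M L W (h n)"
    and lim1: "(\<lambda>n. \<integral>\<^sup>+ (s, y, \<omega>). ennreal ((\<Phi> s y \<omega> - simple_field_value (h n) s y \<omega>)\<^sup>2)
               * indicator ({0<..} \<times> {0<..<L}) (s, y) \<partial>?\<mu>) \<longlonglongrightarrow> 0"
    and lim2: "(\<lambda>n. \<integral>\<^sup>+ \<omega>. ennreal ((I \<omega> - simple_walsh_integral W (h n) \<omega>)\<^sup>2) \<partial>M) \<longlonglongrightarrow> 0"
    using assms unfolding has_walsh_integral_def by auto
  show "I \<in> borel_measurable M" by fact
  note sw = simple_walsh_expectation[OF h]
  have swm[measurable]: "simple_walsh_integral W (h n) \<in> borel_measurable M" for n using sw(3)[of n] by auto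
  define f where "f = (\<lambda>(s, y, \<omega>). \<Phi> s y \<omega> * indicator ({0<..} \<times> {0<..<L}) (s, y))"
  define fn where "fn n = (\<lambda>(s, y, \<omega>). simple_field_value (h n) s y \<omega>)" for n
  have fnm[measurable]: "fn n \<in> borel_measurable ?\<mu>" for n
    unfolding fn_def by (rule simple_walsh_isometry(2)[OF h])
  have fm[measurable]: "f \<in> borel_measurable ?\<mu>"
  proof -
    have "f = (\<lambda>z. (case z of (s, y, \<omega>) \<Rightarrow> \<Phi> s y \<omega> * indicator ({0<..} \<times> {0..L}) (s, y)) * indicator {0<..<L} (fst (snd z)))"
      by (auto simp: f_def fun_eq_iff indicator_def)
    then show ?thesis using predictable_measurable[OF P] by simp
  qed
  \<comment> \<open>Simple fields vanish off the open strip, so the weight in the definition of the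
    integral may be moved onto \<open>\<Phi>\<close> alone, which is the field
    \<open>f\<close>.\<close>
  have supp: "simple_field_value (h n) s y \<omega> = simple_field_value (h n) s y \<omega> * indicator ({0<..} \<times> {0<..<L}) (s, y)" for n s y \<omega>
  proof (cases "(s, y) \<in> {0<..} \<times> {0<..<L}")
    case False
    have "\<forall>(X, a, b, A)\<in>set (h n). X \<omega> * indicator ({a<..b} \<times> A) (s, y) = 0"
    proof clarify
      fix X a b A assume "(X, a, b, A) \<in> set (h n)"
      then have "0 \<le> a" "A \<subseteq> {0<..<L}" using h[of n] by (auto simp: is_simple_field_def)
      then have "(s, y) \<notin> {a<..b} \<times> A" using False by auto
      then show "X \<omega> * indicator ({a<..b} \<times> A) (s, y) = 0" by (simp only: indicator_simps mult_zero_right not_False_eq_True)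
    qed
    then have "simple_field_value (h n) s y \<omega> = 0"
      unfolding simple_field_value_def by (intro sum_list_nonneg_eq_0_iff[THEN iffD2] ballI) auto
    then show ?thesis by simp
  qed simp
  have lim1': "(\<lambda>n. \<integral>\<^sup>+ z. ennreal ((f z - fn n z)\<^sup>2) \<partial>?\<mu>) \<longlonglongrightarrow> 0"
  proof -
    have "ennreal ((f z - fn n z)\<^sup>2) = (case z of (s, y, \<omega>) \<Rightarrow> ennreal ((\<Phi> s y \<omega> - simple_field_value (h n) s y \<omega>)\<^sup>2)
               * indicator ({0<..} \<times> {0<..<L}) (s, y))" for z n
    proof -
      obtain s y \<omega> where z: "z = (s, y, \<omega>)" by (cases z)
      show ?thesis unfolding z f_def fn_def prod.case
        by (subst (1) supp) (auto simp: indicator_def)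
    qed
    then show ?thesis using lim1 by simp
  qed
  have iso: "(\<integral>\<^sup>+ z. ennreal ((fn n z)\<^sup>2) \<partial>?\<mu>) = (\<integral>\<^sup>+ \<omega>. ennreal ((simple_walsh_integral W (h n) \<omega>)\<^sup>2) \<partial>M)" for n
    using simple_walsh_isometry(1)[OF h[of n]] by (simp add: fn_def case_prod_unfold)
  have "?I = (\<integral>\<^sup>+ z. ennreal ((f z)\<^sup>2) \<partial>?\<mu>)"
    by (rule antisym; rule nn_integral_power2_limit_le[OF _ _ _ _ _ lim2 lim1'] nn_integral_power2_limit_le[OF _ _ _ _ _ lim1' lim2])
      (simp_all add: iso)
  also have "\<dots> = (\<integral>\<^sup>+ s. \<integral>\<^sup>+ y. \<integral>\<^sup>+ \<omega>. ennreal ((f (s, y, \<omega>))\<^sup>2) \<partial>M \<partial>lborel \<partial>lborel)"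
    using nn_integral_triple[of "\<lambda>z. ennreal ((f z)\<^sup>2)"] by (simp add: case_prod_unfold)
  also have "\<dots> = ?\<Phi>"
    by (intro nn_integral_cong) (auto simp: f_def indicator_def)
  finally show "?I = ?\<Phi>" .
  assume fin: "?I < \<infinity>"
  have sqi: "integrable M (\<lambda>\<omega>. (I \<omega>)\<^sup>2)"
    using fin by (intro integrableI_bounded) auto
  have Ii: "integrable M I" by (rule square_integrable_imp_integrable[OF Im sqi])
  \<comment> \<open>The approximating integrals have mean 0, so \<open>I\<close> has the same mean
    as the error \<open>J\<close>, and nonnegativity of the variance bounds the square of that mean
    by the second moment of the error.\<close>
  have le: "ennreal ((\<integral>\<omega>. I \<omega> \<partial>M)\<^sup>2) \<le> (\<integral>\<^sup>+ \<omega>. ennreal ((I \<omega> - simple_walsh_integral W (h n) \<omega>)\<^sup>2) \<partial>M)" for n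
  proof -
    define J where "J = (\<lambda>\<omega>. I \<omega> - simple_walsh_integral W (h n) \<omega>)"
    have [measurable]: "J \<in> borel_measurable M" unfolding J_def by measurable
    have Ji: "integrable M J" unfolding J_def using Ii sw(3) by simp
    have EJ: "(\<integral>\<omega>. J \<omega> \<partial>M) = (\<integral>\<omega>. I \<omega> \<partial>M)" unfolding J_def using Ii sw(3,4) by simp
    have "integrable M (\<lambda>\<omega>. (J \<omega>)\<^sup>2)"
    proof (rule Bochner_Integration.integrable_bound)
      show "integrable M (\<lambda>\<omega>. 2 * (I \<omega>)\<^sup>2 + 2 * (simple_walsh_integral W (h n) \<omega>)\<^sup>2)" using sqi sw(1) by simp
      have "(x - y)\<^sup>2 \<le> 2 * x\<^sup>2 + 2 * y\<^sup>2" for x y :: real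
        using zero_le_power2[of "x + y"] by (simp add: power2_eq_square algebra_simps)
      then show "AE \<omega> in M. norm ((J \<omega>)\<^sup>2) \<le> norm (2 * (I \<omega>)\<^sup>2 + 2 * (simple_walsh_integral W (h n) \<omega>)\<^sup>2)"
        by (simp add: J_def)
    qed simp
    note J2 = this
    have "(\<integral>\<omega>. J \<omega> \<partial>M)\<^sup>2 \<le> (\<integral>\<omega>. (J \<omega>)\<^sup>2 \<partial>M)"
      using variance_eq[OF Ji J2] variance_positive[of J] by simp
    then show ?thesis
      unfolding EJ using nn_integral_eq_integral[OF J2] by (simp add: J_def)
  qed
  have "ennreal ((\<integral>\<omega>. I \<omega> \<partial>M)\<^sup>2) \<le> 0"
    by (rule tendsto_lowerbound[OF lim2]) (use le in auto)
  then show "(\<integral>\<omega>. I \<omega> \<partial>M) = 0" by simp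
qed

end

section \<open>Gaussian bounds for the Neumann heat kernel\<close>

text \<open>A negative value would give the perturbed function \<open>z\<close> a negative minimum
  over a compact rectangle. There the time derivative is at most 0, so the differential inequality
  makes the profile in \<open>x\<close> strictly concave, which no interior minimum allows; at the
  end points the slopes exclude a minimum. Nothing is assumed at time 0 itself, hence an initial
  condition in the form of a lower bound near time 0, uniform in \<open>x\<close>.\<close>

lemma neumann_maximum_principle:
  fixes v vt vx vxx :: "real \<Rightarrow> real \<Rightarrow> real"
  assumes L: "0 < L"
    and cont: "continuous_on ({0<..} \<times> {0..L}) (\<lambda>(t, x). v t x)"
    and dt: "\<And>t x. 0 < t \<Longrightarrow> x \<in> {0..L} \<Longrightarrow> ((\<lambda>s. v s x) has_real_derivative vt t x) (at t)"
    and dx: "\<And>t x. 0 < t \<Longrightarrow> x \<in> {0..L} \<Longrightarrow> (v t has_real_derivative vx t x) (at x within {0..L})"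
    and dxx: "\<And>t x. 0 < t \<Longrightarrow> x \<in> {0..L} \<Longrightarrow> (vx t has_real_derivative vxx t x) (at x within {0..L})"
    and super: "\<And>t x. 0 < t \<Longrightarrow> x \<in> {0..L} \<Longrightarrow> 1/2 * vxx t x \<le> vt t x"
    and bc: "\<And>t. 0 < t \<Longrightarrow> vx t 0 \<le> 0" "\<And>t. 0 < t \<Longrightarrow> 0 \<le> vx t L"
    and init: "\<And>\<eta>. 0 < \<eta> \<Longrightarrow> \<exists>\<tau>>0. \<forall>s\<in>{0<..\<tau>}. \<forall>x\<in>{0..L}. - \<eta> \<le> v s x"
    and T: "0 < T" and x0: "x0 \<in> {0..L}"
  shows "0 \<le> v T x0"
proof -
  have main: "0 \<le> v T x0 + \<eta> * (1 + (x0 - L/2)\<^sup>2 + 2 * T)" if \<eta>: "0 < \<eta>" for \<eta>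
  proof (rule ccontr)
    assume neg: "\<not> 0 \<le> v T x0 + \<eta> * (1 + (x0 - L/2)\<^sup>2 + 2 * T)"
    \<comment> \<open>The perturbation makes the differential inequality and both boundary conditions strict.\<close>
    define z where "z s x = v s x + \<eta> * (1 + (x - L/2)\<^sup>2 + 2 * s)" for s x
    define zx where "zx s x = vx s x + 2 * \<eta> * (x - L/2)" for s x
    obtain \<tau>0 where \<tau>0: "\<tau>0 > 0" "\<forall>s\<in>{0<..\<tau>0}. \<forall>x\<in>{0..L}. - \<eta> \<le> v s x"
      using init[OF \<eta>] by auto
    define \<tau> where "\<tau> = min \<tau>0 (T/2)"
    have \<tau>: "0 < \<tau>" "\<tau> < T" "\<forall>s\<in>{0<..\<tau>}. \<forall>x\<in>{0..L}. - \<eta> \<le> v s x"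
      using \<tau>0 T by (auto simp: \<tau>_def)
    have znn: "0 \<le> z s x" if "s \<in> {0<..\<tau>}" "x \<in> {0..L}" for s x
    proof -
      have "0 \<le> \<eta> * ((x - L/2)\<^sup>2 + 2 * s)" using that \<eta> by auto
      moreover have "- \<eta> \<le> v s x" using \<tau>(3) that by auto
      ultimately show ?thesis by (simp add: z_def algebra_simps)
    qed
    have "continuous_on ({\<tau>..T} \<times> {0..L}) (\<lambda>(s, x). v s x)"
      by (rule continuous_on_subset[OF cont]) (use \<tau> in auto)
    then have zc: "continuous_on ({\<tau>..T} \<times> {0..L}) (\<lambda>(s, x). z s x)"
      unfolding z_def case_prod_unfold by (intro continuous_intros)
    have "compact ({\<tau>..T} \<times> {0..L})" by (intro compact_Times) auto
    moreover have "{\<tau>..T} \<times> {0..L} \<noteq> {}" using \<tau> L by auto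
    ultimately obtain q where q: "q \<in> {\<tau>..T} \<times> {0..L}" "\<And>r. r \<in> {\<tau>..T} \<times> {0..L} \<Longrightarrow> (\<lambda>(s, x). z s x) q \<le> (\<lambda>(s, x). z s x) r"
      using continuous_attains_inf[OF _ _ zc] by metis
    obtain s x where qe: "q = (s, x)" by (cases q)
    have sx: "s \<in> {\<tau>..T}" "x \<in> {0..L}" and le: "\<And>s' x'. s' \<in> {\<tau>..T} \<Longrightarrow> x' \<in> {0..L} \<Longrightarrow> z s x \<le> z s' x'"
      using q qe by auto
    have "z s x \<le> z T x0" using le[of T x0] \<tau> x0 by auto
    then have zneg: "z s x < 0" using neg by (simp add: z_def)
    have s: "\<tau> < s" using znn[of \<tau> x] sx zneg \<tau> by (cases "s = \<tau>") auto
    then have s0: "0 < s" using \<tau> by simp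
    have dzt: "((\<lambda>s. z s x) has_real_derivative vt s x + 2 * \<eta>) (at s)"
      unfolding z_def using dt[OF s0 sx(2)] by (auto intro!: derivative_eq_intros)
    have dzx: "(z s has_real_derivative zx s x') (at x' within {0..L})" if "x' \<in> {0..L}" for x'
      unfolding z_def zx_def using dx[OF s0 that] by (auto intro!: derivative_eq_intros)
    have dzxx: "(zx s has_real_derivative vxx s x + 2 * \<eta>) (at x within {0..L})"
      unfolding zx_def using dxx[OF s0 sx(2)] by (auto intro!: derivative_eq_intros)
    \<comment> \<open>Only earlier times are compared, because the minimum may be attained at the
      final time \<open>T\<close>.\<close>
    have t_le: "vt s x + 2 * \<eta> \<le> 0"
    proof (rule ccontr)
      assume "\<not> vt s x + 2 * \<eta> \<le> 0"
      then obtain d where d: "d > 0" "\<And>h. h > 0 \<Longrightarrow> h < d \<Longrightarrow> z (s - h) x < z s x"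
        using DERIV_pos_inc_left[OF dzt] by force
      define h where "h = min (d/2) (s - \<tau>)"
      have "h > 0" "h < d" "s - h \<in> {\<tau>..T}" using d(1) s sx by (auto simp: h_def)
      then show False using d(2)[of h] le[of "s - h" x] sx by force
    qed
    have neg_right: "False" if zn: "zx s x < 0" "x < L"
    proof -
      obtain d where d: "d > 0" "\<And>h. h > 0 \<Longrightarrow> x + h \<in> {0..L} \<Longrightarrow> h < d \<Longrightarrow> z s (x + h) < z s x"
        using has_real_derivative_neg_dec_right[OF dzx[OF sx(2)] zn(1)] by force
      define h where "h = min (d/2) (L - x)"
      have "h > 0" "h < d" "x + h \<in> {0..L}" using d(1) sx zn by (auto simp: h_def)
      then show False using d(2)[of h] le[of s "x + h"] sx by force
    qed
    have pos_left: "False" if zn: "zx s x > 0" "0 < x"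
    proof -
      obtain d where d: "d > 0" "\<And>h. h > 0 \<Longrightarrow> x - h \<in> {0..L} \<Longrightarrow> h < d \<Longrightarrow> z s (x - h) < z s x"
        using has_real_derivative_pos_inc_left[OF dzx[OF sx(2)] zn(1)] by force
      define h where "h = min (d/2) x"
      have "h > 0" "h < d" "x - h \<in> {0..L}" using d(1) sx zn by (auto simp: h_def)
      then show False using d(2)[of h] le[of s "x - h"] sx by force
    qed
    show False
    proof (cases "x = 0 \<or> x = L")
      case True
      have "\<eta> * L > 0" using \<eta> L by simp
      then have "zx s 0 < 0" "zx s L > 0" using bc[OF s0] by (auto simp: zx_def algebra_simps)
      then show False using True neg_right pos_left L by auto
    next
      case False
      then have x: "0 < x" "x < L" using sx by auto
      then have zx0: "zx s x = 0" using neg_right pos_left by (meson linorder_neqE_linordered_idom)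
      \<comment> \<open>Here \<open>vxx s x \<le> 2 * vt s x \<le> - 4 * \<eta>\<close>, which
        outweighs the \<open>2 * \<eta>\<close> that the perturbation adds to the second
        derivative.\<close>
      have "vxx s x + 2 * \<eta> < 0" using super[OF s0 sx(2)] t_le \<eta> by simp
      then obtain d where d: "d > 0" "\<And>h. h > 0 \<Longrightarrow> x + h \<in> {0..L} \<Longrightarrow> h < d \<Longrightarrow> zx s (x + h) < zx s x"
        using has_real_derivative_neg_dec_right[OF dzxx] by force
      define h where "h = min (d/2) ((L - x)/2)"
      have h: "h > 0" "h < d" "x + h < L" using d(1) x by (auto simp: h_def min_def field_simps)
      \<comment> \<open>The second derivative at \<open>x\<close> only tells that \<open>zx\<close>
        is negative just to the right of \<open>x\<close>; the mean value theorem converts this into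
        a value of \<open>z\<close> below its minimum.\<close>
      have "\<exists>\<xi>. x < \<xi> \<and> \<xi> < x + h \<and> z s (x + h) - z s x = (x + h - x) * zx s \<xi>"
      proof (rule MVT2)
        fix y assume y: "x \<le> y" "y \<le> x + h"
        then have "y \<in> {0..L}" "y \<in> interior {0..L}" using x h by auto
        then show "(z s has_real_derivative zx s y) (at y)" using dzx[of y] at_within_interior[of y "{0..L}"] by simp
      qed (use h in simp)
      then obtain \<xi> where \<xi>: "x < \<xi>" "\<xi> < x + h" "z s (x + h) - z s x = h * zx s \<xi>" by auto
      have "zx s (x + (\<xi> - x)) < zx s x" by (rule d(2)) (use \<xi> h x in auto)
      then have "h * zx s \<xi> < 0" using zx0 h by (simp add: mult_pos_neg)
      then show False using \<xi>(3) le[of s "x + h"] sx h x by auto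
    qed
  qed
  have "((\<lambda>\<eta>. v T x0 + \<eta> * (1 + (x0 - L/2)\<^sup>2 + 2 * T)) \<longlongrightarrow> v T x0 + 0 * (1 + (x0 - L/2)\<^sup>2 + 2 * T)) (at_right 0)"
    by (intro tendsto_intros)
  then have "0 \<le> v T x0 + 0 * (1 + (x0 - L/2)\<^sup>2 + 2 * T)"
    by (rule tendsto_lowerbound) (auto simp: eventually_at_right_field intro!: main exI[of _ 1])
  then show ?thesis by simp
qed

section \<open>Comparison principle for the Neumann heat semigroup\<close>

locale neumann_kernel =
  fixes L :: real and p :: "real \<Rightarrow> real \<Rightarrow> real \<Rightarrow> real"
  assumes L: "0 < L" and kernel: "neumann_heat_kernel L p"
begin

text \<open>The Neumann heat semigroup; it carries information about the kernel because the unit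
  mass is approached by continuous \<open>f\<close>, to which the initial condition in
  \<open>neumann_heat_kernel\<close> applies.\<close>

definition P :: "(real \<Rightarrow> real) \<Rightarrow> real \<Rightarrow> real \<Rightarrow> real" where
  "P f t x = (LBINT y:{0..L}. p t x y * f y)"

lemma continuous_on_kernel: "continuous_on ({0<..} \<times> {0..L} \<times> {0..L}) (\<lambda>(t, x, y). p t x y)"
  using kernel unfolding neumann_heat_kernel_def by auto

lemma continuous_on_kernel_section:
  assumes "0 < t" "x \<in> {0..L}"
  shows "continuous_on {0..L} (p t x)"
proof -
  have "continuous_on {0..L} (\<lambda>y. (\<lambda>(t, x, y). p t x y) (t, x, y))"
    by (rule continuous_on_compose2[OF continuous_on_kernel]) (use assms in \<open>auto intro!: continuous_intros\<close>)
  then show ?thesis by simp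
qed

lemma P_integral:
  assumes f: "continuous_on {0..L} f" and "0 < t" "x \<in> {0..L}"
  shows "P f t x = integral {0..L} (\<lambda>y. p t x y * f y)"
proof -
  have "set_integrable lborel {0..L} (\<lambda>y. p t x y * f y)"
    unfolding set_integrable_def
    by (rule borel_integrable_compact[of "{0..L}", simplified indicator_scaleR_eq_if[symmetric]])
      (use assms in \<open>auto intro!: continuous_intros continuous_on_kernel_section\<close>)
  then show ?thesis unfolding P_def by (rule set_borel_integral_eq_integral)
qed

text \<open>The maximum principle for \<open>w - P f\<close>. Joint continuity of the kernel and its
  derivatives permits differentiation under the integral, and the flux of \<open>P f\<close>
  vanishes at both ends, so \<open>w\<close> needs only the right signs there.\<close>

lemma P_le_supersolution:
  assumes f: "continuous_on {0..L} f"
    and cont: "continuous_on ({0..} \<times> {0..L}) (\<lambda>(t, x). w t x)"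
    and dt: "\<And>t x. 0 < t \<Longrightarrow> x \<in> {0..L} \<Longrightarrow> ((\<lambda>s. w s x) has_real_derivative wt t x) (at t)"
    and dx: "\<And>t x. 0 < t \<Longrightarrow> x \<in> {0..L} \<Longrightarrow> (w t has_real_derivative wx t x) (at x within {0..L})"
    and dxx: "\<And>t x. 0 < t \<Longrightarrow> x \<in> {0..L} \<Longrightarrow> (wx t has_real_derivative wxx t x) (at x within {0..L})"
    and super: "\<And>t x. 0 < t \<Longrightarrow> x \<in> {0..L} \<Longrightarrow> 1/2 * wxx t x \<le> wt t x"
    and bc: "\<And>t. 0 < t \<Longrightarrow> wx t 0 \<le> 0" "\<And>t. 0 < t \<Longrightarrow> 0 \<le> wx t L"
    and init: "\<And>x. x \<in> {0..L} \<Longrightarrow> f x \<le> w 0 x"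
    and t: "0 < t" and x: "x \<in> {0..L}"
  shows "P f t x \<le> w t x"
proof -
  obtain pt px pxx where
      D: "\<forall>t>0. \<forall>x\<in>{0..L}. \<forall>y\<in>{0..L}.
           ((\<lambda>s. p s x y) has_real_derivative pt t x y) (at t) \<and>
           ((\<lambda>z. p t z y) has_real_derivative px t x y) (at x within {0..L}) \<and>
           ((\<lambda>z. px t z y) has_real_derivative pxx t x y) (at x within {0..L}) \<and>
           pt t x y = 1/2 * pxx t x y"
    and flux: "\<forall>t>0. \<forall>y\<in>{0..L}. px t 0 y = 0 \<and> px t L y = 0"
    and C: "\<forall>q\<in>{p, pt, px, pxx}. continuous_on ({0<..} \<times> {0..L} \<times> {0..L}) (\<lambda>(t, x, y). q t x y)"
    using kernel unfolding neumann_heat_kernel_def by (elim conjE exE) (rule that)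
  have deriv: "((\<lambda>s. p s x y) has_real_derivative pt t x y) (at t)"
       "((\<lambda>z. p t z y) has_real_derivative px t x y) (at x within {0..L})"
       "((\<lambda>z. px t z y) has_real_derivative pxx t x y) (at x within {0..L})"
       "pt t x y = 1/2 * pxx t x y" if "0 < t" "x \<in> {0..L}" "y \<in> {0..L}" for t x y
    using D that by simp_all
  have cp: "continuous_on ({0<..} \<times> {0..L} \<times> {0..L}) (\<lambda>(t, x, y). p t x y)"
    and cpt: "continuous_on ({0<..} \<times> {0..L} \<times> {0..L}) (\<lambda>(t, x, y). pt t x y)"
    and cpx: "continuous_on ({0<..} \<times> {0..L} \<times> {0..L}) (\<lambda>(t, x, y). px t x y)"
    and cpxx: "continuous_on ({0<..} \<times> {0..L} \<times> {0..L}) (\<lambda>(t, x, y). pxx t x y)"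
    using C by simp_all
  have lim: "uniform_limit {0..L} (\<lambda>t x. P f t x) f (at_right 0)"
    using kernel f unfolding neumann_heat_kernel_def P_def by auto
  \<comment> \<open>Left generic in \<open>q\<close>, so that one continuity proof and one space
    derivative serve for the kernel and for its derivatives.\<close>
  define I where "I q t x = integral {0..L} (\<lambda>y. q t x y * f y)" for q :: "real \<Rightarrow> real \<Rightarrow> real \<Rightarrow> real" and t x
  have P_I: "P f t x = I p t x" if "0 < t" "x \<in> {0..L}" for t x
    using P_integral[OF f that] by (simp add: I_def)
  have cont_f: "continuous_on ({0<..} \<times> {0..L} \<times> {0..L}) (\<lambda>(t, x, y). q t x y * f y)"
    if "continuous_on ({0<..} \<times> {0..L} \<times> {0..L}) (\<lambda>(t, x, y). q t x y)" for q
    unfolding case_prod_unfold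
    by (intro continuous_on_mult that[unfolded case_prod_unfold] continuous_on_compose2[OF f] continuous_on_snd continuous_on_id) auto
  have cI: "continuous_on ({0<..} \<times> {0..L}) (\<lambda>(t, x). I q t x)"
    if "continuous_on ({0<..} \<times> {0..L} \<times> {0..L}) (\<lambda>(t, x, y). q t x y)" for q
  proof -
    have "continuous_on (({0<..} \<times> {0..L}) \<times> cbox 0 L) (\<lambda>(z, y). q (fst z) (snd z) y * f y)"
      unfolding case_prod_unfold
      by (rule continuous_on_compose2[OF cont_f[OF that, unfolded case_prod_unfold],
            where f = "\<lambda>z. (fst (fst z), snd (fst z), snd z)", simplified]) (auto intro!: continuous_intros)
    from integral_continuous_on_param[OF this] show ?thesis by (simp add: I_def case_prod_unfold)
  qed
  have slice: "continuous_on {0..L} (\<lambda>y. q t x y * f y)"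
    if "continuous_on ({0<..} \<times> {0..L} \<times> {0..L}) (\<lambda>(t, x, y). q t x y)" "0 < t" "x \<in> {0..L}" for q t x
    by (rule continuous_on_compose2[OF cont_f[OF that(1), unfolded case_prod_unfold],
            where f = "\<lambda>y. (t, x, y)", simplified]) (use that in \<open>auto intro!: continuous_intros\<close>)
  have Idt: "((\<lambda>s. I p s x) has_real_derivative I pt t x) (at t)" if t: "0 < t" and x: "x \<in> {0..L}" for t x
  proof -
    have "((\<lambda>s. integral (cbox 0 L) (\<lambda>y. p s x y * f y)) has_real_derivative
        integral (cbox 0 L) (\<lambda>y. pt t x y * f y)) (at t within {0<..})"
    proof (rule leibniz_rule_field_derivative)
      show "((\<lambda>s. p s x y * f y) has_real_derivative pt s x y * f y) (at s within {0<..})"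
        if "s \<in> {0<..}" "y \<in> cbox 0 L" for s y
        using that x by (intro DERIV_cmult_right has_field_derivative_at_within[OF deriv(1)]) auto
      show "(\<lambda>y. p s x y * f y) integrable_on cbox 0 L" if "s \<in> {0<..}" for s
        using slice[OF cp, of s x] that x by (auto intro!: integrable_continuous_real)
      show "continuous_on ({0<..} \<times> cbox 0 L) (\<lambda>(s, y). pt s x y * f y)"
        unfolding case_prod_unfold
        by (rule continuous_on_compose2[OF cont_f[OF cpt, unfolded case_prod_unfold],
            where f = "\<lambda>z. (fst z, x, snd z)", simplified]) (use x in \<open>auto intro!: continuous_intros\<close>)
    qed (use t in auto)
    moreover have "at t within {0<..} = at t" using t by (intro at_within_open) auto
    ultimately show ?thesis by (simp add: I_def)
  qed
  have Idx: "(I q t has_real_derivative I q' t x) (at x within {0..L})"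
    if t: "0 < t" and x: "x \<in> {0..L}"
      and q: "\<And>x y. x \<in> {0..L} \<Longrightarrow> y \<in> {0..L} \<Longrightarrow> ((\<lambda>z. q t z y) has_real_derivative q' t x y) (at x within {0..L})"
      and cq: "continuous_on ({0<..} \<times> {0..L} \<times> {0..L}) (\<lambda>(t, x, y). q t x y)"
      and cq': "continuous_on ({0<..} \<times> {0..L} \<times> {0..L}) (\<lambda>(t, x, y). q' t x y)" for q q' t x
  proof -
    have "((\<lambda>z. integral (cbox 0 L) (\<lambda>y. q t z y * f y)) has_real_derivative
        integral (cbox 0 L) (\<lambda>y. q' t x y * f y)) (at x within {0..L})"
    proof (rule leibniz_rule_field_derivative)
      show "((\<lambda>z. q t z y * f y) has_real_derivative q' t z y * f y) (at z within {0..L})"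
        if "z \<in> {0..L}" "y \<in> cbox 0 L" for z y
        using that by (intro DERIV_cmult_right q) auto
      show "(\<lambda>y. q t z y * f y) integrable_on cbox 0 L" if "z \<in> {0..L}" for z
        using slice[OF cq, of t z] that t by (auto intro!: integrable_continuous_real)
      show "continuous_on ({0..L} \<times> cbox 0 L) (\<lambda>(z, y). q' t z y * f y)"
        unfolding case_prod_unfold
        by (rule continuous_on_compose2[OF cont_f[OF cq', unfolded case_prod_unfold],
            where f = "\<lambda>z. (t, fst z, snd z)", simplified]) (use t in \<open>auto intro!: continuous_intros\<close>)
    qed (use x in auto)
    then show ?thesis by (simp add: I_def[abs_def])
  qed
  have "0 \<le> w t x - I p t x"
  proof (rule neumann_maximum_principle[where L = L and v = "\<lambda>t x. w t x - I p t x" and vt = "\<lambda>t x. wt t x - I pt t x"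
        and vx = "\<lambda>t x. wx t x - I px t x" and vxx = "\<lambda>t x. wxx t x - I pxx t x" and T = t and ?x0.0 = x])
    have "continuous_on ({0<..} \<times> {0..L}) (\<lambda>(t, x). w t x)"
      by (rule continuous_on_subset[OF cont]) auto
    then show "continuous_on ({0<..} \<times> {0..L}) (\<lambda>(t, x). w t x - I p t x)"
      using cI[OF cp] unfolding case_prod_unfold by (rule continuous_on_diff)
  next
    fix t x :: real assume tx: "0 < t" "x \<in> {0..L}"
    show "((\<lambda>s. w s x - I p s x) has_real_derivative wt t x - I pt t x) (at t)"
      by (intro DERIV_diff dt Idt tx)
    show "((\<lambda>x. w t x - I p t x) has_real_derivative wx t x - I px t x) (at x within {0..L})"
      by (intro DERIV_diff dx Idx tx cp cpx deriv(2))
    show "((\<lambda>x. wx t x - I px t x) has_real_derivative wxx t x - I pxx t x) (at x within {0..L})"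
      by (intro DERIV_diff dxx Idx tx cpx cpxx deriv(3))
    have "I pt t x = integral {0..L} (\<lambda>y. 1/2 * (pxx t x y * f y))"
      unfolding I_def using deriv(4)[OF tx] by (intro integral_cong) simp
    then have "I pt t x = 1/2 * I pxx t x" by (simp add: I_def)
    then show "1/2 * (wxx t x - I pxx t x) \<le> wt t x - I pt t x"
      using super[OF tx] by simp
  next
    fix t :: real assume t: "0 < t"
    have "I px t 0 = integral {0..L} (\<lambda>y. 0)" "I px t L = integral {0..L} (\<lambda>y. 0)"
      unfolding I_def by (intro integral_cong; use flux t in simp)+
    then show "wx t 0 - I px t 0 \<le> 0" "0 \<le> wx t L - I px t L" using bc[OF t] by auto
  next
    fix \<eta> :: real assume \<eta>: "0 < \<eta>"
    \<comment> \<open>Half of \<open>\<eta>\<close> pays for the uniform convergence of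
      \<open>P f\<close> to \<open>f\<close>, the other half for the uniform continuity of
      \<open>w\<close> up to time 0.\<close>
    have "\<forall>\<^sub>F t in at_right 0. \<forall>x\<in>{0..L}. dist (P f t x) (f x) < \<eta>/2"
      using uniform_limitD[OF lim, of "\<eta>/2"] \<eta> by simp
    then obtain b where b: "b > 0" "\<And>t x. 0 < t \<Longrightarrow> t < b \<Longrightarrow> x \<in> {0..L} \<Longrightarrow> dist (P f t x) (f x) < \<eta>/2"
      unfolding eventually_at_right_field by auto
    have "continuous_on ({0..1} \<times> {0..L}) (\<lambda>(t, x). w t x)"
      by (rule continuous_on_subset[OF cont]) auto
    then have "uniformly_continuous_on ({0..1} \<times> {0..L}) (\<lambda>(t, x). w t x)"
      by (rule compact_uniformly_continuous) (intro compact_Times compact_Icc)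
    then obtain d where d: "d > 0" "\<And>z z'. z \<in> {0..1} \<times> {0..L} \<Longrightarrow> z' \<in> {0..1} \<times> {0..L} \<Longrightarrow> dist z' z < d \<Longrightarrow>
        dist ((\<lambda>(t, x). w t x) z') ((\<lambda>(t, x). w t x) z) < \<eta>/2"
      unfolding uniformly_continuous_on_def using \<eta> by (meson half_gt_zero)
    define \<tau> where "\<tau> = min (b/2) (min (d/2) 1)"
    have "- \<eta> \<le> w s x - I p s x" if s: "s \<in> {0<..\<tau>}" and x: "x \<in> {0..L}" for s x
    proof -
      have 1: "dist (P f s x) (f x) < \<eta>/2" using b s x by (intro b(2)) (auto simp: \<tau>_def)
      have "dist (w s x) (w 0 x) < \<eta>/2"
        using d(2)[of "(0, x)" "(s, x)"] s x d(1) by (auto simp: \<tau>_def dist_Pair_Pair)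
      then show ?thesis using 1 init[OF x] P_I[of s x] s x by (auto simp: dist_real_def abs_if split: if_splits)
    qed
    then show "\<exists>\<tau>>0. \<forall>s\<in>{0<..\<tau>}. \<forall>x\<in>{0..L}. - \<eta> \<le> w s x - I p s x"
      using b(1) d(1) by (intro exI[of _ \<tau>]) (auto simp: \<tau>_def)
  qed (use L t x in auto)
  then show ?thesis using P_I[OF t x] by simp
qed

lemma P_uminus: "P (\<lambda>y. - f y) t x = - P f t x"
  by (simp add: P_def set_lebesgue_integral_def)

lemma subsolution_le_P:
  assumes f: "continuous_on {0..L} f"
    and cont: "continuous_on ({0..} \<times> {0..L}) (\<lambda>(t, x). w t x)"
    and dt: "\<And>t x. 0 < t \<Longrightarrow> x \<in> {0..L} \<Longrightarrow> ((\<lambda>s. w s x) has_real_derivative wt t x) (at t)"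
    and dx: "\<And>t x. 0 < t \<Longrightarrow> x \<in> {0..L} \<Longrightarrow> (w t has_real_derivative wx t x) (at x within {0..L})"
    and dxx: "\<And>t x. 0 < t \<Longrightarrow> x \<in> {0..L} \<Longrightarrow> (wx t has_real_derivative wxx t x) (at x within {0..L})"
    and sub: "\<And>t x. 0 < t \<Longrightarrow> x \<in> {0..L} \<Longrightarrow> wt t x \<le> 1/2 * wxx t x"
    and bc: "\<And>t. 0 < t \<Longrightarrow> 0 \<le> wx t 0" "\<And>t. 0 < t \<Longrightarrow> wx t L \<le> 0"
    and init: "\<And>x. x \<in> {0..L} \<Longrightarrow> w 0 x \<le> f x"
    and t: "0 < t" and x: "x \<in> {0..L}"
  shows "w t x \<le> P f t x"
proof -
  have "P (\<lambda>y. - f y) t x \<le> - w t x"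
    by (rule P_le_supersolution[where w = "\<lambda>t x. - w t x" and wt = "\<lambda>t x. - wt t x" and wx = "\<lambda>t x. - wx t x" and wxx = "\<lambda>t x. - wxx t x"])
      (use assms in \<open>auto simp: case_prod_unfold intro!: continuous_intros DERIV_minus\<close>)
  then show ?thesis by (simp add: P_uminus)
qed

end

text \<open>The heat kernel of the whole line for half the Laplacian: the centred normal density of
  variance \<open>t\<close>.\<close>

definition gauss :: "real \<Rightarrow> real \<Rightarrow> real" where
  "gauss t z = exp (- z\<^sup>2 / (2 * t)) / sqrt (2 * pi * t)"

lemma gauss_pos: "0 < t \<Longrightarrow> 0 < gauss t z"
  by (simp add: gauss_def)

lemma gauss_minus: "gauss t (- z) = gauss t z"
  by (simp add: gauss_def)

lemma gauss_le: "0 < t \<Longrightarrow> gauss t z \<le> 1 / sqrt t"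
proof -
  assume t: "0 < t"
  have "1 * t \<le> 2 * pi * t" using pi_ge_two t by (intro mult_right_mono) auto
  then have "sqrt t \<le> sqrt (2 * pi * t)" by simp
  then have "exp (- z\<^sup>2 / (2 * t)) / sqrt (2 * pi * t) \<le> 1 / sqrt t"
    using t by (intro frac_le) auto
  then show ?thesis by (simp add: gauss_def)
qed

lemma continuous_on_gauss[continuous_intros]:
  assumes "continuous_on A f" "continuous_on A g" "\<And>x. x \<in> A \<Longrightarrow> 0 < f x"
  shows "continuous_on A (\<lambda>x. gauss (f x) (g x))"
  unfolding gauss_def using assms by (intro continuous_intros) (auto dest!: assms(3))

lemma DERIV_gauss_space:
  assumes "0 < t"
  shows "(gauss t has_real_derivative (- z / t * gauss t z)) (at z within A)"
  unfolding gauss_def[abs_def] using assms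
  by (auto intro!: derivative_eq_intros simp: power2_eq_square field_simps)

lemma DERIV_gauss_space2:
  assumes "0 < t"
  shows "((\<lambda>z. - z / t * gauss t z) has_real_derivative ((z\<^sup>2 / t\<^sup>2 - 1 / t) * gauss t z)) (at z within A)"
  using assms by (auto intro!: derivative_eq_intros DERIV_gauss_space simp: power2_eq_square field_simps)

lemma DERIV_gauss_space_chain:
  assumes "0 < t" "(g has_real_derivative 1) (at x within A)"
  shows "((\<lambda>x. gauss t (g x)) has_real_derivative (- g x / t * gauss t (g x))) (at x within A)"
    and "((\<lambda>x. - g x / t * gauss t (g x)) has_real_derivative (((g x)\<^sup>2 / t\<^sup>2 - 1 / t) * gauss t (g x))) (at x within A)"
  using DERIV_chain2[OF DERIV_gauss_space[OF assms(1)] assms(2)]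
    DERIV_chain2[OF DERIV_gauss_space2[OF assms(1)] assms(2)] by simp_all

text \<open>The derivative is half the second space derivative found in
  \<open>DERIV_gauss_space2\<close>, so \<open>gauss\<close> solves the heat equation.\<close>

lemma DERIV_gauss_time:
  assumes "0 < t"
  shows "((\<lambda>t. gauss t z) has_real_derivative (1/2 * ((z\<^sup>2 / t\<^sup>2 - 1 / t) * gauss t z))) (at t)"
proof -
  define e where "e = exp (- z\<^sup>2 / (2 * t))"
  define s where "s = sqrt (2 * pi * t)"
  have s: "0 < s" "s * s = 2 * pi * t" using assms by (auto simp: s_def)
  have "((\<lambda>t. gauss t z) has_real_derivative
      (e * (z\<^sup>2 * 2 / (2 * t)\<^sup>2) * s - e * (2 * pi * (inverse s / 2))) / (s * s)) (at t)"
    unfolding gauss_def e_def s_def using assms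
    by (auto intro!: derivative_eq_intros simp: power2_eq_square mult_less_0_iff)
  also have "(e * (z\<^sup>2 * 2 / (2 * t)\<^sup>2) * s - e * (2 * pi * (inverse s / 2))) / (s * s) =
     (1/2 * (z\<^sup>2 / t\<^sup>2)) * (e / s) - e / s * (pi / (s * s))"
    using s(1) assms by (simp add: field_simps power2_eq_square)
  also have "\<dots> = 1/2 * ((z\<^sup>2 / t\<^sup>2 - 1 / t) * (e / s))"
  proof -
    have *: "1/2 * a * q - q * (1 / (2 * t)) = 1/2 * ((a - 1 / t) * q)" for a q
      using assms by (simp add: field_simps)
    have "pi / (s * s) = 1 / (2 * t)" unfolding s(2) by simp
    then show ?thesis by (simp only: *)
  qed
  finally show ?thesis by (simp add: gauss_def e_def s_def)
qed

text \<open>Bounds, uniformly in time, the flux that a source sends through a point at distance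
  \<open>d\<close>. As \<open>d\<close> stays away from 0, the exponential defeats the blow-up of
  the prefactor \<open>d / t powr (3/2)\<close> for small \<open>t\<close>, while for large
  \<open>t\<close> the prefactor itself is small.\<close>

lemma gauss_flux_bound:
  assumes L: "0 < L" and d: "L \<le> d" "d \<le> 2 * L" and t: "0 < t"
  shows "d / t * gauss t d \<le> 8 / L\<^sup>2"
proof -
  define s where "s = sqrt t"
  have s: "0 < s" "t = s\<^sup>2" using t by (auto simp: s_def)
  have dp: "0 < d" using L d by simp
  have le: "d / t * gauss t d \<le> d / s ^ 3 * exp (- (d\<^sup>2 / (2 * t)))"
  proof -
    have "1 * t \<le> 2 * pi * t" using pi_ge_two t by (intro mult_right_mono) auto
    then have "s \<le> sqrt (2 * pi * t)" by (simp add: s_def)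
    then have "gauss t d \<le> exp (- (d\<^sup>2 / (2 * t))) / s"
      unfolding gauss_def using s by (auto intro!: divide_left_mono mult_pos_pos t)
    then have "d / t * gauss t d \<le> d / t * (exp (- (d\<^sup>2 / (2 * t))) / s)"
      using dp t by (intro mult_left_mono) auto
    also have "\<dots> = d / s ^ 3 * exp (- (d\<^sup>2 / (2 * t)))"
      using s by (simp add: power3_eq_cube power2_eq_square)
    finally show ?thesis .
  qed
  show ?thesis
  \<comment> \<open>With \<open>u = d\<^sup>2 / (2 * t)\<close> the quadratic Taylor term of the
    exponential suffices: \<open>2 / u\<^sup>2\<close> turns the bound into
    \<open>8 * s / d ^ 3\<close>, which no longer blows up as \<open>s\<close> tends to 0.\<close>
  proof (cases "s \<le> L")
    case True
    define u where "u = d\<^sup>2 / (2 * t)"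
    have u: "0 < u" unfolding u_def using dp t by simp
    have "u\<^sup>2 / 2 \<le> exp u"
      using exp_lower_Taylor_quadratic[of u] u by simp
    then have "exp (- u) \<le> 2 / u\<^sup>2"
      using u by (simp add: exp_minus field_simps)
    then have "d / s ^ 3 * exp (- u) \<le> d / s ^ 3 * (2 / u\<^sup>2)"
      using dp s by (intro mult_left_mono) auto
    also have "\<dots> = 8 * s / d ^ 3"
      unfolding u_def s(2) using s(1) dp by (simp add: field_simps power2_eq_square power3_eq_cube)
    also have "\<dots> \<le> 8 * L / L ^ 3"
      using True d L by (intro frac_le mult_left_mono power_mono) auto
    also have "\<dots> = 8 / L\<^sup>2" using L by (simp add: power2_eq_square power3_eq_cube)
    finally show ?thesis using le by (simp add: u_def)
  next
    case False
    have "d / s ^ 3 * exp (- (d\<^sup>2 / (2 * t))) \<le> d / s ^ 3 * 1"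
      using dp s by (intro mult_left_mono) auto
    also have "\<dots> \<le> 2 * L / L ^ 3"
      using False d L dp by (simp, intro frac_le power_mono) auto
    also have "\<dots> \<le> 8 / L\<^sup>2" using L by (simp add: power2_eq_square power3_eq_cube divide_simps)
    finally show ?thesis using le by simp
  qed
qed

text \<open>Variance \<open>1 / (real (Suc n))\<^sup>2\<close> means standard deviation
  \<open>1 / real (Suc n)\<close>, so rescaling leads to one fixed standard normal density and
  dominated convergence applies.\<close>

lemma gauss_approximate_identity:
  fixes h :: "real \<Rightarrow> real"
  assumes h[measurable]: "h \<in> borel_measurable borel" and bd: "\<And>z. \<bar>h z\<bar> \<le> B" and cont: "isCont h y"
  shows "(\<lambda>n. \<integral>z. h z * gauss (1 / (real (Suc n))\<^sup>2) (z - y) \<partial>lborel) \<longlonglongrightarrow> h y"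
proof -
  have eq: "(\<integral>z. h z * gauss (1 / (real (Suc n))\<^sup>2) (z - y) \<partial>lborel) =
     (\<integral>u. h (y + u / real (Suc n)) * std_normal_density u \<partial>lborel)" for n
  proof -
    define c where "c = 1 / real (Suc n)"
    have c: "0 < c" by (simp add: c_def)
    have g: "c * gauss (c\<^sup>2) (c * u) = std_normal_density u" for u
      using c by (simp add: gauss_def std_normal_density_def real_sqrt_mult power_mult_distrib)
    have "(\<integral>z. h z * gauss (c\<^sup>2) (z - y) \<partial>lborel) = \<bar>c\<bar> *\<^sub>R (\<integral>u. h (y + c * u) * gauss (c\<^sup>2) ((y + c * u) - y) \<partial>lborel)"
      using c by (intro lborel_integral_real_affine) auto
    also have "\<dots> = (\<integral>u. h (y + c * u) * (c * gauss (c\<^sup>2) (c * u)) \<partial>lborel)"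
      using c by (subst Bochner_Integration.integral_scaleR_right[symmetric]) (simp add: mult_ac)
    finally show ?thesis unfolding g by (simp add: c_def power_divide)
  qed
  have "(\<lambda>n. \<integral>u. h (y + u / real (Suc n)) * std_normal_density u \<partial>lborel) \<longlonglongrightarrow> (\<integral>u. h y * std_normal_density u \<partial>lborel)"
  proof (rule integral_dominated_convergence[where w = "\<lambda>u. B * std_normal_density u"])
    show "AE u in lborel. (\<lambda>n. h (y + u / real (Suc n)) * std_normal_density u) \<longlonglongrightarrow> h y * std_normal_density u"
    proof (intro AE_I2 tendsto_mult tendsto_const)
      fix u :: real
      have "(\<lambda>n. u / real (Suc n)) \<longlonglongrightarrow> 0"
        by (rule LIMSEQ_Suc[OF lim_const_over_n])
      then have "(\<lambda>n. y + u / real (Suc n)) \<longlonglongrightarrow> y + 0"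
        by (intro tendsto_add tendsto_const)
      then show "(\<lambda>n. h (y + u / real (Suc n))) \<longlonglongrightarrow> h y"
        using isCont_tendsto_compose[OF cont] by simp
    qed
    show "AE u in lborel. norm (h (y + u / real (Suc n)) * std_normal_density u) \<le> B * std_normal_density u" for n
      using bd by (intro AE_I2) (auto simp: abs_mult intro!: mult_right_mono)
  qed (auto intro!: integrable_mult_right)
  then show ?thesis unfolding eq by simp
qed

context neumann_kernel
begin

text \<open>Turns bounds on the semigroup into pointwise bounds on the kernel. The point
  \<open>y\<close> is interior because the kernel cut off to \<open>[0, L]\<close> has to be
  continuous there.\<close>

lemma P_gauss_tendsto:
  assumes t: "0 < t" and x: "x \<in> {0..L}" and y: "y \<in> {0<..<L}"
  shows "(\<lambda>n. P (\<lambda>z. gauss (1 / (real (Suc n))\<^sup>2) (z - y)) t x) \<longlonglongrightarrow> p t x y"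
proof -
  define h where "h z = indicator {0..L} z * p t x z" for z
  have c: "continuous_on {0..L} (p t x)" by (rule continuous_on_kernel_section[OF t x])
  have m: "h \<in> borel_measurable borel"
    unfolding h_def using borel_measurable_continuous_on_indicator[OF _ c] by simp
  obtain B where B: "\<And>z. z \<in> {0..L} \<Longrightarrow> \<bar>p t x z\<bar> \<le> B"
    using compact_imp_bounded[OF compact_continuous_image[OF c compact_Icc]] by (fastforce simp: bounded_iff)
  have "0 \<le> B" using B[of 0] L by fastforce
  then have bd: "\<bar>h z\<bar> \<le> B" for z using B by (auto simp: h_def indicator_def)
  have "continuous_on {0<..<L} (p t x)" by (rule continuous_on_subset[OF c]) auto
  then have "isCont (p t x) y" using y by (auto simp: continuous_on_eq_continuous_at)
  moreover have "\<forall>\<^sub>F z in nhds y. h z = p t x z"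
  proof -
    have "\<forall>\<^sub>F z in nhds y. z \<in> {0<..<L}" using y by (intro eventually_nhds_in_open) auto
    then show ?thesis by (rule eventually_mono) (auto simp: h_def)
  qed
  ultimately have "isCont h y" by (simp cong: isCont_cong)
  from gauss_approximate_identity[OF m bd this]
  show ?thesis using y by (simp add: P_def set_lebesgue_integral_def h_def mult.assoc)
qed

text \<open>
  Starting from \<open>gauss \<epsilon> (\<cdot> - y)\<close> instead of a unit mass makes the comparison functions smooth up to
  time \<open>0\<close>. A Gaussian centred in the interval decreases towards both end points, hence it is a subsolution.
\<close>

lemma kernel_ge_on_interior:
  assumes "0 < t" "x \<in> {0..L}" "y \<in> {0<..<L}"
  shows "gauss t (x - y) \<le> p t x y"
proof -
  have "gauss (t + \<epsilon>) (x - y) \<le> P (\<lambda>z. gauss \<epsilon> (z - y)) t x" if \<epsilon>: "0 < \<epsilon>" for \<epsilon>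
  proof (rule subsolution_le_P[where w = "\<lambda>t x. gauss (t + \<epsilon>) (x - y)"
      and wt = "\<lambda>t x. 1/2 * (((x - y)\<^sup>2 / (t + \<epsilon>)\<^sup>2 - 1 / (t + \<epsilon>)) * gauss (t + \<epsilon>) (x - y))"
      and wx = "\<lambda>t x. - (x - y) / (t + \<epsilon>) * gauss (t + \<epsilon>) (x - y)"
      and wxx = "\<lambda>t x. ((x - y)\<^sup>2 / (t + \<epsilon>)\<^sup>2 - 1 / (t + \<epsilon>)) * gauss (t + \<epsilon>) (x - y)"])
    show "continuous_on {0..L} (\<lambda>z. gauss \<epsilon> (z - y))"
      "continuous_on ({0..} \<times> {0..L}) (\<lambda>(t, x). gauss (t + \<epsilon>) (x - y))"
      using \<epsilon> by (auto simp: case_prod_unfold intro!: continuous_intros)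
    fix t x :: real assume tx: "0 < t"
    then have p: "0 < t + \<epsilon>" using \<epsilon> by simp
    show "((\<lambda>s. gauss (s + \<epsilon>) (x - y)) has_real_derivative 1/2 * (((x - y)\<^sup>2 / (t + \<epsilon>)\<^sup>2 - 1 / (t + \<epsilon>)) * gauss (t + \<epsilon>) (x - y))) (at t)"
      using DERIV_shift[THEN iffD1, OF DERIV_gauss_time[OF p]] by simp
    show "((\<lambda>x. gauss (t + \<epsilon>) (x - y)) has_real_derivative - (x - y) / (t + \<epsilon>) * gauss (t + \<epsilon>) (x - y)) (at x within {0..L})"
      by (rule DERIV_gauss_space_chain[OF p]) (auto intro!: derivative_eq_intros)
    show "((\<lambda>x. - (x - y) / (t + \<epsilon>) * gauss (t + \<epsilon>) (x - y)) has_real_derivative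
        ((x - y)\<^sup>2 / (t + \<epsilon>)\<^sup>2 - 1 / (t + \<epsilon>)) * gauss (t + \<epsilon>) (x - y)) (at x within {0..L})"
      by (rule DERIV_gauss_space_chain[OF p]) (auto intro!: derivative_eq_intros)
    show "0 \<le> - (0 - y) / (t + \<epsilon>) * gauss (t + \<epsilon>) (0 - y)" "- (L - y) / (t + \<epsilon>) * gauss (t + \<epsilon>) (L - y) \<le> 0"
      using assms p gauss_pos[OF p] by (auto intro!: mult_nonneg_nonneg mult_nonpos_nonneg divide_nonpos_pos simp: less_imp_le simp del: times_divide_eq_left minus_diff_eq)
  qed (use assms in auto)
  then have le: "gauss (t + 1 / (real (Suc n))\<^sup>2) (x - y) \<le> P (\<lambda>z. gauss (1 / (real (Suc n))\<^sup>2) (z - y)) t x" for n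
    by simp
  have "(\<lambda>n. gauss (t + 1 / (real (Suc n))\<^sup>2) (x - y)) \<longlonglongrightarrow> gauss (t + 0) (x - y)"
  proof (rule isCont_tendsto_compose[of _ "\<lambda>s. gauss s (x - y)"])
    show "isCont (\<lambda>s. gauss s (x - y)) (t + 0)"
      using DERIV_isCont[OF DERIV_gauss_time[of t "x - y"]] assms by simp
    show "(\<lambda>n. t + 1 / (real (Suc n))\<^sup>2) \<longlonglongrightarrow> t + 0"
      by (intro tendsto_intros) real_asymp
  qed
  from LIMSEQ_le[OF this P_gauss_tendsto[OF assms]] le show ?thesis by simp
qed

lemma kernel_ge:
  assumes t: "0 < t" and x: "x \<in> {0..L}" and y: "y \<in> {0..L}"
  shows "gauss t (x - y) \<le> p t x y"
proof -
  have "gauss t (x - y) - p t x y \<le> 0"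
  proof (rule continuous_le_on_closure[where S = "{0<..<L}" and f = "\<lambda>y. gauss t (x - y) - p t x y" and x = y and a = 0])
    show "continuous_on (closure {0<..<L}) (\<lambda>y. gauss t (x - y) - p t x y)"
      using L t continuous_on_kernel_section[OF t x] by (auto intro!: continuous_intros)
    show "y \<in> closure {0<..<L}" using y L by simp
    show "gauss t (x - y) - p t x y \<le> 0" if "y \<in> {0<..<L}" for y
      using kernel_ge_on_interior[OF t x that] by simp
  qed
  then show ?thesis by simp
qed

lemma kernel_nonneg: "0 < t \<Longrightarrow> x \<in> {0..L} \<Longrightarrow> y \<in> {0..L} \<Longrightarrow> 0 \<le> p t x y"
  using kernel_ge[of t x y] gauss_pos[of t "x - y"] by linarith


text \<open>
  The image at \<open>- y\<close> cancels the flux of the source at \<open>0\<close>, the image at \<open>2 L - y\<close> the flux at \<open>L\<close>. What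
  each image adds at the opposite end point is bounded and absorbed by the caloric function
  \<open>(x - L/2)\<^sup>2 + t\<close>.
\<close>

lemma kernel_le_on_interior:
  assumes "0 < t" "x \<in> {0..L}" "y \<in> {0<..<L}"
  shows "p t x y \<le> gauss t (x - y) + gauss t (x + y) + gauss t (x + y - 2 * L) + 8 / L ^ 3 * ((x - L/2)\<^sup>2 + t)"
proof -
  \<comment> \<open>The slope of \<open>A * (x - L/2)\<^sup>2\<close> at the end points is
    \<open>- A * L\<close> and \<open>A * L\<close>; this \<open>A\<close> makes
    \<open>A * L\<close> equal to the bound of \<open>gauss_flux_bound\<close>.\<close>
  define A where "A = 8 / L ^ 3"
  have A: "A * L = 8 / L\<^sup>2" using L by (simp add: A_def power2_eq_square power3_eq_cube)
  have upper: "P (\<lambda>z. gauss \<epsilon> (z - y)) t x \<le>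
      gauss (t + \<epsilon>) (x - y) + gauss (t + \<epsilon>) (x + y) + gauss (t + \<epsilon>) (x + y - 2 * L) + A * ((x - L/2)\<^sup>2 + t)"
    if \<epsilon>: "0 < \<epsilon>" for \<epsilon>
  proof -
    define g where "g t z = (z\<^sup>2 / (t + \<epsilon>)\<^sup>2 - 1 / (t + \<epsilon>)) * gauss (t + \<epsilon>) z" for t z
    define k where "k t z = - z / (t + \<epsilon>) * gauss (t + \<epsilon>) z" for t z
    have time: "((\<lambda>s. gauss (s + \<epsilon>) z) has_real_derivative 1/2 * g t z) (at t)" if "0 < t" for t z
      using DERIV_shift[THEN iffD1, OF DERIV_gauss_time[of "t + \<epsilon>" z]] that \<epsilon> by (simp add: g_def)
    have space: "((\<lambda>x. gauss (t + \<epsilon>) (h x)) has_real_derivative k t (h x)) (at x within {0..L})"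
        "((\<lambda>x. k t (h x)) has_real_derivative g t (h x)) (at x within {0..L})"
      if "0 < t" "(h has_real_derivative 1) (at x within {0..L})" for t x h
      unfolding k_def g_def using DERIV_gauss_space_chain[of "t + \<epsilon>" h x "{0..L}"] that \<epsilon> by simp_all
    have h: "((\<lambda>x. x - y) has_real_derivative 1) (at x within {0..L})"
      "((\<lambda>x. x + y) has_real_derivative 1) (at x within {0..L})"
      "((\<lambda>x. x + y - 2 * L) has_real_derivative 1) (at x within {0..L})" for x
      by (auto intro!: derivative_eq_intros)
    have k_odd: "k t (- z) = - k t z" for t z by (simp add: k_def gauss_minus)
    have k_bound: "\<bar>k t d\<bar> \<le> A * L" if "0 < t" "L \<le> d" "d \<le> 2 * L" for t d
      using gauss_flux_bound[OF L that(2,3), of "t + \<epsilon>"] gauss_pos[of "t + \<epsilon>" d] that \<epsilon> L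
      by (simp add: k_def A abs_mult)
    show ?thesis
    proof (rule P_le_supersolution[where w = "\<lambda>t x. gauss (t + \<epsilon>) (x - y) + gauss (t + \<epsilon>) (x + y) + gauss (t + \<epsilon>) (x + y - 2 * L) + A * ((x - L/2)\<^sup>2 + t)"
        and wt = "\<lambda>t x. 1/2 * g t (x - y) + 1/2 * g t (x + y) + 1/2 * g t (x + y - 2 * L) + A"
        and wx = "\<lambda>t x. k t (x - y) + k t (x + y) + k t (x + y - 2 * L) + A * (2 * (x - L/2))"
        and wxx = "\<lambda>t x. g t (x - y) + g t (x + y) + g t (x + y - 2 * L) + A * 2"])
      show "continuous_on {0..L} (\<lambda>z. gauss \<epsilon> (z - y))"
        "continuous_on ({0..} \<times> {0..L}) (\<lambda>(t, x). gauss (t + \<epsilon>) (x - y) + gauss (t + \<epsilon>) (x + y) + gauss (t + \<epsilon>) (x + y - 2 * L) + A * ((x - L/2)\<^sup>2 + t))"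
        using \<epsilon> by (auto simp: case_prod_unfold intro!: continuous_intros)
      fix t x :: real assume t: "0 < t"
      show "((\<lambda>t. gauss (t + \<epsilon>) (x - y) + gauss (t + \<epsilon>) (x + y) + gauss (t + \<epsilon>) (x + y - 2 * L) + A * ((x - L/2)\<^sup>2 + t))
          has_real_derivative 1/2 * g t (x - y) + 1/2 * g t (x + y) + 1/2 * g t (x + y - 2 * L) + A) (at t)"
        by (intro DERIV_add time t) (auto intro!: derivative_eq_intros)
      show "((\<lambda>x. gauss (t + \<epsilon>) (x - y) + gauss (t + \<epsilon>) (x + y) + gauss (t + \<epsilon>) (x + y - 2 * L) + A * ((x - L/2)\<^sup>2 + t))
          has_real_derivative k t (x - y) + k t (x + y) + k t (x + y - 2 * L) + A * (2 * (x - L/2))) (at x within {0..L})"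
        by (intro DERIV_add space(1) t h) (auto intro!: derivative_eq_intros)
      show "((\<lambda>x. k t (x - y) + k t (x + y) + k t (x + y - 2 * L) + A * (2 * (x - L/2)))
          has_real_derivative g t (x - y) + g t (x + y) + g t (x + y - 2 * L) + A * 2) (at x within {0..L})"
        by (intro DERIV_add space(2) t h) (auto intro!: derivative_eq_intros)
      show "1/2 * (g t (x - y) + g t (x + y) + g t (x + y - 2 * L) + A * 2) \<le> 1/2 * g t (x - y) + 1/2 * g t (x + y) + 1/2 * g t (x + y - 2 * L) + A"
        by simp
      \<comment> \<open>The first two terms cancel because \<open>k\<close> is odd. The third is the
        flux of the far image, at distance \<open>2 * L - y\<close> from 0; at the other end the far
        image is the one at \<open>- y\<close>, at distance \<open>L + y\<close>. Both distances lie
        between \<open>L\<close> and \<open>2 * L\<close>.\<close>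
      show "k t (0 - y) + k t (0 + y) + k t (0 + y - 2 * L) + A * (2 * (0 - L/2)) \<le> 0"
        using k_odd[of t y] k_odd[of t "2 * L - y"] k_bound[OF t, of "2 * L - y"] assms by auto
      show "0 \<le> k t (L - y) + k t (L + y) + k t (L + y - 2 * L) + A * (2 * (L - L/2))"
        using k_odd[of t "L - y"] k_bound[OF t, of "L + y"] assms by (auto simp: algebra_simps)
    next
      fix x :: real
      have "0 \<le> A * ((x - L/2)\<^sup>2 + 0)" using L by (simp add: A_def)
      moreover have "0 < gauss (0 + \<epsilon>) z" for z using \<epsilon> by (simp add: gauss_pos)
      ultimately show "gauss \<epsilon> (x - y) \<le> gauss (0 + \<epsilon>) (x - y) + gauss (0 + \<epsilon>) (x + y) + gauss (0 + \<epsilon>) (x + y - 2 * L) + A * ((x - L/2)\<^sup>2 + 0)"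
        by (smt (verit, ccfv_threshold) add_0)
    qed (use assms in auto)
  qed
  have tend: "(\<lambda>n. gauss (t + 1 / (real (Suc n))\<^sup>2) z) \<longlonglongrightarrow> gauss (t + 0) z" for z
  proof (rule isCont_tendsto_compose[of _ "\<lambda>s. gauss s z"])
    show "isCont (\<lambda>s. gauss s z) (t + 0)"
      using DERIV_isCont[OF DERIV_gauss_time[of t z]] assms by simp
    show "(\<lambda>n. t + 1 / (real (Suc n))\<^sup>2) \<longlonglongrightarrow> t + 0"
      by (intro tendsto_intros) real_asymp
  qed
  have "p t x y \<le> gauss (t + 0) (x - y) + gauss (t + 0) (x + y) + gauss (t + 0) (x + y - 2 * L) + A * ((x - L/2)\<^sup>2 + t)"
    by (rule LIMSEQ_le[OF P_gauss_tendsto[OF assms] tendsto_add[OF tendsto_add[OF tendsto_add[OF tend tend] tend] tendsto_const]])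
      (use upper in auto)
  then show ?thesis by (simp add: A_def)
qed

lemma kernel_le:
  assumes t: "0 < t" and x: "x \<in> {0..L}" and y: "y \<in> {0..L}"
  shows "p t x y \<le> 3 / sqrt t + 8 / L ^ 3 * (L\<^sup>2 + t)"
proof (rule continuous_le_on_closure[where S = "{0<..<L}" and f = "p t x" and x = y])
  show "continuous_on (closure {0<..<L}) (p t x)"
    using L t continuous_on_kernel_section[OF t x] by auto
  show "y \<in> closure {0<..<L}" using y L by simp
  fix y assume y: "y \<in> {0<..<L}"
  have "\<bar>x - L/2\<bar> \<le> \<bar>L\<bar>" using x L by auto
  then have "(x - L/2)\<^sup>2 \<le> L\<^sup>2" by (simp only: abs_le_square_iff)
  then have "8 / L ^ 3 * ((x - L/2)\<^sup>2 + t) \<le> 8 / L ^ 3 * (L\<^sup>2 + t)"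
    using L by (intro mult_left_mono) auto
  then show "p t x y \<le> 3 / sqrt t + 8 / L ^ 3 * (L\<^sup>2 + t)"
    using kernel_le_on_interior[OF t x y] gauss_le[OF t, of "x - y"] gauss_le[OF t, of "x + y"] gauss_le[OF t, of "x + y - 2 * L"]
    by simp
qed

section \<open>Mass and square integral of the kernel\<close>

lemma kernel_set_integrable:
  assumes "0 < t" "x \<in> {0..L}"
  shows "set_integrable lborel {0..L} (p t x)"
  unfolding set_integrable_def
  by (rule borel_integrable_compact[of "{0..L}", simplified indicator_scaleR_eq_if[symmetric]])
    (use assms in \<open>auto intro!: continuous_on_kernel_section\<close>)

lemma kernel_mass_le:
  assumes t: "0 < t" and x: "x \<in> {0..L}"
  shows "(LBINT y:{0..L}. p t x y) \<le> 1"
proof -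
  have "P (\<lambda>_. 1) t x \<le> (\<lambda>t x. 1) t x"
    by (rule P_le_supersolution[where wt = "\<lambda>_ _. 0" and wx = "\<lambda>_ _. 0" and wxx = "\<lambda>_ _. 0"])
      (use t x in \<open>auto simp: case_prod_unfold\<close>)
  then show ?thesis by (simp add: P_def)
qed

text \<open>Supremum times mass: the mass is at most 1, so the square integral inherits the order
  \<open>1 / sqrt t\<close> of the supremum.\<close>

lemma nn_integral_kernel_square_le:
  assumes t: "0 < t" and x: "x \<in> {0..L}"
  shows "(\<integral>\<^sup>+y. ennreal ((p t x y)\<^sup>2) * indicator {0..L} y \<partial>lborel) \<le> ennreal (3 / sqrt t + 8 / L ^ 3 * (L\<^sup>2 + t))"
proof -
  define C where "C = 3 / sqrt t + 8 / L ^ 3 * (L\<^sup>2 + t)"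
  have C: "0 \<le> C" using t L by (simp add: C_def)
  have i: "integrable lborel (\<lambda>y. C * (indicator {0..L} y *\<^sub>R p t x y))"
    using kernel_set_integrable[OF t x] by (simp add: set_integrable_def)
  have nn: "0 \<le> C * (indicator {0..L} y *\<^sub>R p t x y)" for y
    using C kernel_nonneg[OF t x] by (auto simp: indicator_def)
  have "(\<integral>\<^sup>+y. ennreal ((p t x y)\<^sup>2) * indicator {0..L} y \<partial>lborel) \<le> (\<integral>\<^sup>+y. ennreal (C * (indicator {0..L} y *\<^sub>R p t x y)) \<partial>lborel)"
  proof (rule nn_integral_mono)
    fix y
    show "ennreal ((p t x y)\<^sup>2) * indicator {0..L} y \<le> ennreal (C * (indicator {0..L} y *\<^sub>R p t x y))"
      using mult_right_mono[OF kernel_le[OF t x] kernel_nonneg[OF t x], of y y]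
      by (auto simp: indicator_def C_def power2_eq_square intro!: ennreal_leI)
  qed
  also have "\<dots> = ennreal (\<integral>y. C * (indicator {0..L} y *\<^sub>R p t x y) \<partial>lborel)"
    by (rule nn_integral_eq_integral[OF i]) (use nn in auto)
  also have "\<dots> = ennreal (C * (LBINT y:{0..L}. p t x y))"
    by (simp add: set_lebesgue_integral_def)
  also have "\<dots> \<le> ennreal (C * 1)"
    using kernel_mass_le[OF t x] C by (intro ennreal_leI mult_left_mono)
  finally show ?thesis by (simp add: C_def)
qed

text \<open>On a window of length \<open>sqrt t\<close> next to \<open>x\<close> the kernel
  dominates a Gaussian whose square is at least \<open>exp (- 1) / (2 * pi * t)\<close>. The
  integral runs over the open interval because the Walsh integral does.\<close>

lemma nn_integral_kernel_square_ge:
  assumes t: "0 < t" "sqrt t \<le> L / 2" and x: "x \<in> {0..L}"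
  shows "ennreal (exp (- 1) / (2 * pi) / sqrt t) \<le> (\<integral>\<^sup>+y. ennreal ((p t x y)\<^sup>2) * indicator {0<..<L} y \<partial>lborel)"
proof -
  define s where "s = sqrt t"
  have s: "0 < s" "t = s\<^sup>2" using t by (auto simp: s_def)
  \<comment> \<open>The window lies to the right of \<open>x\<close> when \<open>x\<close> is in the
    left half of the interval and to its left otherwise; by \<open>sqrt t \<le> L / 2\<close> it
    never leaves the interval.\<close>
  define a where "a = (if x \<le> L/2 then x else x - s)"
  have a: "{a<..<a + s} \<subseteq> {0<..<L}" "\<And>y. y \<in> {a<..<a + s} \<Longrightarrow> \<bar>x - y\<bar> \<le> s"
    using x t(2) s by (auto simp: a_def s_def[symmetric] split: if_splits)
  define c where "c = exp (- 1) / (2 * pi * t)"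
  have c: "0 \<le> c" using t by (simp add: c_def)
  have "ennreal (exp (- 1) / (2 * pi) / sqrt t) = ennreal c * emeasure lborel {a<..<a + s}"
    using s by (simp add: c_def s(2) power2_eq_square flip: ennreal_mult)
  also have "\<dots> = (\<integral>\<^sup>+y. ennreal c * indicator {a<..<a + s} y \<partial>lborel)"
    by (simp add: nn_integral_cmult)
  also have "\<dots> \<le> (\<integral>\<^sup>+y. ennreal ((p t x y)\<^sup>2) * indicator {0<..<L} y \<partial>lborel)"
  proof (rule nn_integral_mono)
    fix y
    show "ennreal c * indicator {a<..<a + s} y \<le> ennreal ((p t x y)\<^sup>2) * indicator {0<..<L} y"
    proof (cases "y \<in> {a<..<a + s}")
      case True
      then have y: "y \<in> {0<..<L}" using a(1) by auto
      have "\<bar>x - y\<bar> \<le> \<bar>s\<bar>" using a(2)[OF True] s by simp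
      then have "(x - y)\<^sup>2 \<le> s\<^sup>2" by (simp only: abs_le_square_iff)
      then have "exp (- 1) \<le> exp (- (x - y)\<^sup>2 / t)" using t by (simp add: s(2))
      then have "c \<le> exp (- (x - y)\<^sup>2 / t) / (2 * pi * t)"
        unfolding c_def using t by (intro divide_right_mono) auto
      also have "\<dots> = (gauss t (x - y))\<^sup>2"
        using t by (simp add: gauss_def power_divide flip: exp_double)
      also have "\<dots> \<le> (p t x y)\<^sup>2"
        using kernel_ge[OF t(1) x, of y] y gauss_pos[OF t(1)] by (intro power_mono) (auto intro: less_imp_le)
      finally show ?thesis using True y by (auto intro!: ennreal_leI)
    qed simp
  qed
  finally show ?thesis .
qed

end

section \<open>The renewal equation of the second moment\<close>

text \<open>The exponential weight \<open>exp (\<beta> * r)\<close> is reproduced by the singular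
  time kernel up to the factor \<open>Gamma (1/2) / sqrt \<beta>\<close>, small for large
  \<open>\<beta>\<close>. Substituting \<open>w = \<beta> * (s - r)\<close> produces the integral
  for \<open>Gamma (1/2)\<close>; taking all \<open>r < s\<close> makes the value exact.\<close>

lemma Gamma_weight_nn_integral:
  fixes \<beta> s :: real
  assumes \<beta>: "0 < \<beta>"
  shows "(\<integral>\<^sup>+ r. ennreal (exp (\<beta> * r) / sqrt (s - r)) * indicator {..<s} r \<partial>lborel) = ennreal (exp (\<beta> * s) * (Gamma (1/2) / sqrt \<beta>))"
proof -
  have "(\<integral>\<^sup>+ r. ennreal (exp (\<beta> * r) / sqrt (s - r)) * indicator {..<s} r \<partial>lborel) =
    ennreal (1 / \<beta>) * (\<integral>\<^sup>+ w. ennreal (exp (\<beta> * (s + (- 1 / \<beta>) * w)) / sqrt (s - (s + (- 1 / \<beta>) * w))) * indicator {..<s} (s + (- 1 / \<beta>) * w) \<partial>lborel)"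
    using \<beta> by (subst nn_integral_real_affine[where c = "- 1 / \<beta>" and t = s]) auto
  also have "(\<integral>\<^sup>+ w. ennreal (exp (\<beta> * (s + (- 1 / \<beta>) * w)) / sqrt (s - (s + (- 1 / \<beta>) * w))) * indicator {..<s} (s + (- 1 / \<beta>) * w) \<partial>lborel)
     = (\<integral>\<^sup>+ w. ennreal (exp (\<beta> * s) * sqrt \<beta>) * ennreal (indicator {0..} w * w powr (1/2 - 1) / exp w) \<partial>lborel)"
  proof (rule nn_integral_cong)
    fix w :: real
    show "ennreal (exp (\<beta> * (s + (- 1 / \<beta>) * w)) / sqrt (s - (s + (- 1 / \<beta>) * w))) * indicator {..<s} (s + (- 1 / \<beta>) * w) =
      ennreal (exp (\<beta> * s) * sqrt \<beta>) * ennreal (indicator {0..} w * w powr (1/2 - 1) / exp w)"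
    proof (cases "0 < w")
      case True
      have "exp (\<beta> * (s + (- 1 / \<beta>) * w)) = exp (\<beta> * s) / exp w"
      proof -
        have "\<beta> * (s + (- 1 / \<beta>) * w) = \<beta> * s - w" using \<beta> by (simp add: field_simps)
        then show ?thesis by (simp only: exp_diff)
      qed
      moreover have "sqrt (s - (s + (- 1 / \<beta>) * w)) = sqrt w / sqrt \<beta>" by (simp add: real_sqrt_divide)
      moreover have "w powr (1/2 - 1) = 1 / sqrt w"
        using True powr_minus_divide[of w "1/2"] by (simp add: powr_half_sqrt)
      moreover have "s + (- 1 / \<beta>) * w < s" using True \<beta> by simp
      ultimately show ?thesis using True \<beta>
        by (simp add: ennreal_mult[symmetric] mult.commute)
    next
      case False
      then have "\<not> s + (- 1 / \<beta>) * w < s" using \<beta> by (simp add: zero_less_divide_iff)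
      \<comment> \<open>At \<open>w = 0\<close> both sides are 0: the left one by its indicator, the
        right one because \<open>0 powr a = 0\<close>.\<close>
      then show ?thesis using False by (cases "w = 0") (auto simp: indicator_def)
    qed
  qed
  also have "\<dots> = ennreal (exp (\<beta> * s) * sqrt \<beta>) * ennreal (Gamma (1/2))"
    by (subst nn_integral_cmult) (simp_all add: Gamma_conv_nn_integral_real)
  finally have "(\<integral>\<^sup>+ r. ennreal (exp (\<beta> * r) / sqrt (s - r)) * indicator {..<s} r \<partial>lborel) =
    ennreal (1 / \<beta>) * (ennreal (exp (\<beta> * s) * sqrt \<beta>) * ennreal (Gamma (1/2)))" .
  also have "\<dots> = ennreal (1 / \<beta> * (exp (\<beta> * s) * sqrt \<beta> * Gamma (1/2)))"
    using \<beta> by (simp add: ennreal_mult[symmetric] Gamma_real_nonneg)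
  also have "1 / \<beta> * (exp (\<beta> * s) * sqrt \<beta> * Gamma (1/2)) = exp (\<beta> * s) * (Gamma (1/2) / sqrt \<beta>)"
    using \<beta> by (simp add: field_simps)
  finally show ?thesis .
qed

section \<open>Constants from the initial function and from the nonlinearity\<close>

context neumann_kernel
begin

lemma admissible_initial_integrable:
  assumes "admissible_initial L u0"
  obtains U where "0 \<le> U" "\<And>y. y \<in> {0..L} \<Longrightarrow> 0 \<le> u0 y \<and> u0 y \<le> U"
    "(\<lambda>y. indicator {0..L} y * u0 y) \<in> borel_measurable borel"
    "integrable lborel (\<lambda>y. indicator {0..L} y * u0 y)"
    "0 < (\<integral>y. indicator {0..L} y * u0 y \<partial>lborel)"
proof -
  note A = assms[unfolded admissible_initial_def]
  obtain U where U: "\<And>y. y \<in> {0..L} \<Longrightarrow> norm (u0 y) \<le> U"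
    using A unfolding bounded_iff by blast
  have nn: "0 \<le> u0 y" if "y \<in> {0..L}" for y using A that by blast
  have U': "u0 y \<le> U" if "y \<in> {0..L}" for y using U[OF that] by simp
  have U0: "0 \<le> U" using U[of 0] L norm_ge_zero[of "u0 0"] by fastforce
  have m: "(\<lambda>y. indicator {0..L} y * u0 y) \<in> borel_measurable borel"
    using A by (subst (asm) borel_measurable_restrict_space_iff) auto
  have i: "integrable lborel (\<lambda>y. indicator {0..L} y * u0 y)"
  proof (rule Bochner_Integration.integrable_bound)
    show "integrable lborel (\<lambda>y. U * indicator {0..L} y :: real)"
      using L by (intro integrable_mult_right integrable_real_indicator) auto
    show "AE y in lborel. norm (indicator {0..L} y * u0 y) \<le> norm (U * indicator {0..L} y)"
      using U U0 by (intro AE_I2) (auto simp: indicator_def)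
  qed (use m in simp)
  have "(\<integral>y. indicator {0..L} y * u0 y \<partial>lborel) \<noteq> 0"
  proof
    assume "(\<integral>y. indicator {0..L} y * u0 y \<partial>lborel) = 0"
    then have "AE y in lborel. indicator {0..L} y * u0 y = 0"
      using nn by (subst (asm) integral_nonneg_eq_0_iff_AE[OF i]) (auto simp: indicator_def)
    then have "AE y in lborel. y \<in> {0..L} \<longrightarrow> u0 y = 0" by eventually_elim auto
    then show False using A by blast
  qed
  moreover have "0 \<le> (\<integral>y. indicator {0..L} y * u0 y \<partial>lborel)"
    using nn by (intro Bochner_Integration.integral_nonneg) (auto simp: indicator_def)
  ultimately show thesis using that[OF U0 _ m i] nn U' by simp
qed

text \<open>Above: kernel mass at most 1. Below: at times comparable to \<open>T\<close> the kernel
  has a positive lower bound over the whole square, and it multiplies the positive mass of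
  \<open>u0\<close>, wherever that mass sits.\<close>

lemma initial_flow_bounds:
  assumes u0: "admissible_initial L u0" and T: "0 < T"
  obtains U j where "0 \<le> U" "0 < j"
    "\<forall>t>0. \<forall>x\<in>{0..L}. \<bar>LBINT y:{0..L}. u0 y * p t x y\<bar> \<le> U"
    "\<forall>t\<in>{T/2..T}. \<forall>x\<in>{0..L}. j \<le> (LBINT y:{0..L}. u0 y * p t x y)"
proof -
  obtain U where U: "0 \<le> U" "\<And>y. y \<in> {0..L} \<Longrightarrow> 0 \<le> u0 y \<and> u0 y \<le> U"
    and m[measurable]: "(\<lambda>y. indicator {0..L} y * u0 y) \<in> borel_measurable borel"
    and i: "integrable lborel (\<lambda>y. indicator {0..L} y * u0 y)"
    and pos: "0 < (\<integral>y. indicator {0..L} y * u0 y \<partial>lborel)"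
    using admissible_initial_integrable[OF u0] by metis
  have eq: "(LBINT y:{0..L}. u0 y * p t x y) = (\<integral>y. (indicator {0..L} y * u0 y) * (indicator {0..L} y * p t x y) \<partial>lborel)" for t x :: real
    unfolding set_lebesgue_integral_def by (intro Bochner_Integration.integral_cong) (auto simp: indicator_def)
  have ip: "integrable lborel (\<lambda>y. indicator {0..L} y * p t x y)" if "0 < t" "x \<in> {0..L}" for t x :: real
    using kernel_set_integrable[OF that] by (simp add: set_integrable_def)
  have int: "integrable lborel (\<lambda>y. (indicator {0..L} y * u0 y) * (indicator {0..L} y * p t x y))"
    if "0 < t" "x \<in> {0..L}" for t x
  proof (rule Bochner_Integration.integrable_bound[OF integrable_mult_right[OF ip[OF that], of U]])
    have "(\<lambda>y. indicator {0..L} y * p t x y) \<in> borel_measurable borel"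
      using borel_measurable_integrable[OF ip[OF that]] by (simp only: measurable_lborel2)
    then show "(\<lambda>y. (indicator {0..L} y * u0 y) * (indicator {0..L} y * p t x y)) \<in> borel_measurable lborel"
      using borel_measurable_times[OF m] by (simp only: measurable_lborel2)
    show "AE y in lborel. norm ((indicator {0..L} y * u0 y) * (indicator {0..L} y * p t x y)) \<le> norm (U * (indicator {0..L} y * p t x y))"
      using U by (intro AE_I2) (auto simp: indicator_def abs_mult intro!: mult_right_mono)
  qed
  \<comment> \<open>The smallest value that the Gaussian bound guarantees: distance
    \<open>L\<close>, time at least \<open>T/2\<close> in the exponent and at most \<open>T\<close>
    in the prefactor.\<close>
  define g where "g = exp (- L\<^sup>2 / T) / sqrt (2 * pi * T)"
  have g: "0 < g" using T by (simp add: g_def)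
  show thesis
  proof (rule that[OF U(1), of "g * (\<integral>y. indicator {0..L} y * u0 y \<partial>lborel)"]; (intro allI ballI impI)?)
    show "0 < g * (\<integral>y. indicator {0..L} y * u0 y \<partial>lborel)" using g pos by simp
    fix t x :: real assume t: "0 < t" and x: "x \<in> {0..L}"
    have nn: "0 \<le> (LBINT y:{0..L}. u0 y * p t x y)"
      unfolding eq using U kernel_nonneg[OF t x] by (intro Bochner_Integration.integral_nonneg) (auto simp: indicator_def)
    have "(LBINT y:{0..L}. u0 y * p t x y) \<le> (\<integral>y. U * (indicator {0..L} y * p t x y) \<partial>lborel)"
      unfolding eq using U kernel_nonneg[OF t x] 
      by (intro integral_mono int[OF t x] integrable_mult_right ip[OF t x]) (auto simp: indicator_def intro!: mult_right_mono)
    also have "\<dots> = U * (LBINT y:{0..L}. p t x y)" by (simp add: set_lebesgue_integral_def)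
    also have "\<dots> \<le> U * 1" using kernel_mass_le[OF t x] U(1) by (intro mult_left_mono)
    finally show "\<bar>LBINT y:{0..L}. u0 y * p t x y\<bar> \<le> U" using nn by simp
  next
    fix t x assume "t \<in> {T/2..T}" and x: "x \<in> {0..L}"
    then have t: "T/2 \<le> t" "t \<le> T" by auto
    have t0: "0 < t" using t T by simp
    have "g \<le> p t x y" if y: "y \<in> {0..L}" for y
    proof -
      have "\<bar>x - y\<bar> \<le> \<bar>L\<bar>" using x y by auto
      then have "(x - y)\<^sup>2 \<le> L\<^sup>2" by (simp only: abs_le_square_iff)
      then have "(x - y)\<^sup>2 / (2 * t) \<le> L\<^sup>2 / T" using t T by (intro frac_le) auto
      then have "g \<le> gauss t (x - y)"
        unfolding g_def gauss_def using t t0 by (intro frac_le) auto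
      then show ?thesis using kernel_ge[OF t0 x y] by simp
    qed
    then have "g * (indicator {0..L} y * u0 y) \<le> (indicator {0..L} y * u0 y) * (indicator {0..L} y * p t x y)" for y
      using U(2)[of y] mult_right_mono[of g "p t x y" "u0 y"] by (cases "y \<in> {0..L}") (auto simp: mult.commute)
    then have "(\<integral>y. g * (indicator {0..L} y * u0 y) \<partial>lborel) \<le> (LBINT y:{0..L}. u0 y * p t x y)"
      unfolding eq by (intro integral_mono int[OF t0 x] integrable_mult_right i)
    then show "g * (\<integral>y. indicator {0..L} y * u0 y \<partial>lborel) \<le> (LBINT y:{0..L}. u0 y * p t x y)" by simp
  qed
qed

end

lemma admissible_sigma_bounds:
  assumes "admissible_sigma \<sigma>"
  obtains l K where "0 < l" "0 < K" "\<And>x. l * \<bar>x\<bar> \<le> \<bar>\<sigma> x\<bar>" "\<And>x. \<bar>\<sigma> x\<bar> \<le> K * \<bar>x\<bar>"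
    "\<sigma> \<in> borel_measurable borel"
proof -
  note A = assms[unfolded admissible_sigma_def]
  obtain C where "C-lipschitz_on UNIV \<sigma>" using A by blast
  then have m: "\<sigma> \<in> borel_measurable borel"
    by (intro borel_measurable_continuous_onI lipschitz_on_continuous_on)
  \<comment> \<open>A real number strictly between 0 and the extended-real infimum keeps all later
    estimates in the reals; \<open>K\<close> is chosen likewise above the supremum.\<close>
  obtain l where l: "0 < ereal l" "ereal l < lower_slope \<sigma>"
    using A ereal_dense2[of 0 "lower_slope \<sigma>"] by auto
  obtain K where K: "upper_slope \<sigma> < ereal K"
    using A ereal_dense2[of "upper_slope \<sigma>" \<infinity>] by auto
  have 1: "l * \<bar>x\<bar> \<le> \<bar>\<sigma> x\<bar>" and 2: "\<bar>\<sigma> x\<bar> \<le> K * \<bar>x\<bar>" for x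
  proof -
    have "l * \<bar>x\<bar> \<le> \<bar>\<sigma> x\<bar> \<and> \<bar>\<sigma> x\<bar> \<le> K * \<bar>x\<bar>"
    proof (cases "x = 0")
      case False
      have "lower_slope \<sigma> \<le> ereal \<bar>\<sigma> x / x\<bar>" unfolding lower_slope_def using False by (intro INF_lower) auto
      moreover have "ereal \<bar>\<sigma> x / x\<bar> \<le> upper_slope \<sigma>" unfolding upper_slope_def using False by (intro SUP_upper) auto
      ultimately have "l < \<bar>\<sigma> x / x\<bar>" "\<bar>\<sigma> x / x\<bar> < K"
        using l(2) K by (metis ereal_less(2) less_ereal.simps(1) order_less_le_trans, metis less_ereal.simps(1) order_le_less_trans)
      then show ?thesis using False by (simp add: abs_divide field_simps)
    qed (use A in simp)
    then show "l * \<bar>x\<bar> \<le> \<bar>\<sigma> x\<bar>" "\<bar>\<sigma> x\<bar> \<le> K * \<bar>x\<bar>" by auto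
  qed
  have "l \<le> K" using 1[of 1] 2[of 1] by simp
  then show thesis using that[of l K] l 1 2 m by simp
qed

text \<open>One noise level is fixed. The slope constants \<open>l\<close> and \<open>K\<close> are
  parameters, so that the same ones can be used for every \<open>lam\<close>.\<close>

locale mild_field = noise M L W + neumann_kernel L p
  for M :: "'a measure" and L W p +
  fixes \<sigma> u0 :: "real \<Rightarrow> real" and lam :: real and u :: "real \<Rightarrow> real \<Rightarrow> 'a \<Rightarrow> real" and l K :: real
  assumes mild: "mild_solution M L W p \<sigma> u0 lam u" and lam: "0 < lam"
    and \<sigma>[measurable]: "\<sigma> \<in> borel_measurable borel"
    and lK: "0 < l" "0 < K" and \<sigma>_ge: "\<And>x. l * \<bar>x\<bar> \<le> \<bar>\<sigma> x\<bar>" and \<sigma>_le: "\<And>x. \<bar>\<sigma> x\<bar> \<le> K * \<bar>x\<bar>"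
begin

text \<open>Valued in \<open>ennreal\<close>, so that the renewal equation and its estimates can be
  integrated without integrability conditions.\<close>

definition F :: "real \<Rightarrow> real \<Rightarrow> ennreal" where
  "F t x = (\<integral>\<^sup>+ \<omega>. ennreal ((u t x \<omega>)\<^sup>2) \<partial>M)"

definition J :: "real \<Rightarrow> real \<Rightarrow> real" where
  "J t x = (LBINT y:{0..L}. u0 y * p t x y)"

lemma u_predictable: "predictable M L W u"
  using mild unfolding mild_solution_def by (elim conjE)

lemma u_moments:
  "\<forall>T>0. \<forall>k\<ge>2. (SUP x\<in>{0..L}. SUP t\<in>{0..T}. \<integral>\<^sup>+ \<omega>. ennreal (\<bar>u t x \<omega>\<bar> powr k) \<partial>M) < \<infinity>"
  using mild unfolding mild_solution_def by (elim conjE)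

lemma u_mild:
  "\<forall>t>0. \<forall>x\<in>{0..L}. \<exists>I. has_walsh_integral M L W (\<lambda>s y \<omega>. if s < t then p (t - s) x y * \<sigma> (u s y \<omega>) else 0) I \<and>
        (AE \<omega> in M. u t x \<omega> = J t x + lam * I \<omega>)"
  using mild unfolding mild_solution_def J_def by (elim conjE)

lemma u_measurable: "0 < t \<Longrightarrow> x \<in> {0..L} \<Longrightarrow> u t x \<in> borel_measurable M"
  by (rule predictable_measurable_section[OF u_predictable])

lemma F_bounded:
  assumes "0 < T"
  obtains B where "0 \<le> B" "\<And>t x. 0 \<le> t \<Longrightarrow> t \<le> T \<Longrightarrow> x \<in> {0..L} \<Longrightarrow> F t x \<le> ennreal B"
proof -
  have eq: "(\<integral>\<^sup>+ \<omega>. ennreal (\<bar>u t x \<omega>\<bar> powr 2) \<partial>M) = F t x" for t x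
    unfolding F_def by (intro nn_integral_cong) simp
  have "(SUP x\<in>{0..L}. SUP t\<in>{0..T}. \<integral>\<^sup>+ \<omega>. ennreal (\<bar>u t x \<omega>\<bar> powr 2) \<partial>M) < \<infinity>"
    by (rule u_moments[rule_format, OF assms]) simp
  then have fin: "(SUP x\<in>{0..L}. SUP t\<in>{0..T}. F t x) < \<infinity>" unfolding eq .
  then obtain B where B: "0 \<le> B" "(SUP x\<in>{0..L}. SUP t\<in>{0..T}. F t x) = ennreal B"
    by (cases "SUP x\<in>{0..L}. SUP t\<in>{0..T}. F t x") auto
  show thesis
  proof (rule that[OF B(1)])
    fix t x assume *: "0 \<le> t" "t \<le> T" "x \<in> {0..L}"
    have "F t x \<le> (SUP t\<in>{0..T}. F t x)" using * by (intro SUP_upper) auto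
    also have "\<dots> \<le> (SUP x\<in>{0..L}. SUP t\<in>{0..T}. F t x)" using * by (intro SUP_upper) auto
    finally show "F t x \<le> ennreal B" using B by simp
  qed
qed

lemma F_finite:
  assumes "0 < t" "x \<in> {0..L}"
  shows "F t x < \<infinity>"
proof -
  obtain B where "\<And>s x. 0 \<le> s \<Longrightarrow> s \<le> t \<Longrightarrow> x \<in> {0..L} \<Longrightarrow> F s x \<le> ennreal B"
    using F_bounded[OF assms(1)] by blast
  then have "F t x \<le> ennreal B" using assms by simp
  also have "\<dots> < \<infinity>" by simp
  finally show ?thesis .
qed

text \<open>The square of the mild equation: the cross term disappears because the Walsh integral
  has mean 0, and the isometry evaluates its second moment.\<close>

lemma second_moment_eq:
  assumes t: "0 < t" and x: "x \<in> {0..L}"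
  shows "F t x = ennreal ((J t x)\<^sup>2) + ennreal (lam\<^sup>2) *
    (\<integral>\<^sup>+ s. \<integral>\<^sup>+ y. \<integral>\<^sup>+ \<omega>. ennreal ((if s < t then p (t - s) x y * \<sigma> (u s y \<omega>) else 0)\<^sup>2) * indicator ({0<..} \<times> {0<..<L}) (s, y) \<partial>M \<partial>lborel \<partial>lborel)"
proof -
  obtain I where I: "has_walsh_integral M L W (\<lambda>s y \<omega>. if s < t then p (t - s) x y * \<sigma> (u s y \<omega>) else 0) I"
    and ae: "AE \<omega> in M. u t x \<omega> = J t x + lam * I \<omega>"
    using u_mild[rule_format, OF t x] by (elim exE conjE)
  note iso = walsh_isometry[OF I]
  note [measurable] = iso(2) u_measurable[OF t x]
  have sq: "integrable M (\<lambda>\<omega>. (u t x \<omega>)\<^sup>2)"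
    using F_finite[OF t x] unfolding F_def by (intro integrableI_bounded) auto
  \<comment> \<open>\<open>has_walsh_integral\<close> does not assert that the second moment is
    finite. It is inherited from \<open>u\<close>, since \<open>I\<close> is
    \<open>(u t x - J t x) / lam\<close> almost surely.\<close>
  have "integrable M (\<lambda>\<omega>. (I \<omega>)\<^sup>2)"
  proof (rule Bochner_Integration.integrable_bound)
    show "integrable M (\<lambda>\<omega>. (2 * (u t x \<omega>)\<^sup>2 + 2 * (J t x)\<^sup>2) / lam\<^sup>2)" using sq by simp
    have *: "(a - b)\<^sup>2 \<le> 2 * a\<^sup>2 + 2 * b\<^sup>2" for a b :: real
      using zero_le_power2[of "a + b"] by (simp add: power2_eq_square algebra_simps)
    show "AE \<omega> in M. norm ((I \<omega>)\<^sup>2) \<le> norm ((2 * (u t x \<omega>)\<^sup>2 + 2 * (J t x)\<^sup>2) / lam\<^sup>2)"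
      using ae
    proof eventually_elim
      case (elim \<omega>)
      then have "lam\<^sup>2 * (I \<omega>)\<^sup>2 = (u t x \<omega> - J t x)\<^sup>2" by (simp add: power_mult_distrib)
      also have "\<dots> \<le> 2 * (u t x \<omega>)\<^sup>2 + 2 * (J t x)\<^sup>2" by (rule *)
      finally show ?case using lam by (simp add: field_simps)
    qed
  qed simp
  note I2 = this
  have "(\<integral>\<^sup>+ \<omega>. ennreal ((I \<omega>)\<^sup>2) \<partial>M) < \<infinity>"
    using nn_integral_eq_integral[OF I2] by simp
  then have EI: "(\<integral>\<omega>. I \<omega> \<partial>M) = 0" by (rule iso(3))
  have Ii: "integrable M I" by (rule square_integrable_imp_integrable[OF iso(2) I2])
  have "F t x = (\<integral>\<^sup>+ \<omega>. ennreal ((J t x + lam * I \<omega>)\<^sup>2) \<partial>M)"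
    unfolding F_def by (rule nn_integral_cong_AE) (use ae in auto)
  also have "\<dots> = ennreal (\<integral>\<omega>. (J t x + lam * I \<omega>)\<^sup>2 \<partial>M)"
  proof (rule nn_integral_eq_integral)
    show "integrable M (\<lambda>\<omega>. (J t x + lam * I \<omega>)\<^sup>2)" using Ii I2 by (simp add: power2_sum power_mult_distrib)
  qed simp
  also have "(\<integral>\<omega>. (J t x + lam * I \<omega>)\<^sup>2 \<partial>M) = (\<integral>\<omega>. (J t x)\<^sup>2 + lam\<^sup>2 * (I \<omega>)\<^sup>2 + 2 * J t x * lam * I \<omega> \<partial>M)"
    by (intro Bochner_Integration.integral_cong) (auto simp: power2_sum power_mult_distrib)
  also have "\<dots> = (J t x)\<^sup>2 + lam\<^sup>2 * (\<integral>\<omega>. (I \<omega>)\<^sup>2 \<partial>M)"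
    using Ii I2 EI by (simp add: prob_space)
  also have "ennreal \<dots> = ennreal ((J t x)\<^sup>2) + ennreal (lam\<^sup>2) * (\<integral>\<^sup>+ \<omega>. ennreal ((I \<omega>)\<^sup>2) \<partial>M)"
    using nn_integral_eq_integral[OF I2] by (simp add: ennreal_mult)
  finally show ?thesis unfolding iso(1) .
qed

lemma sigma_moment_le:
  assumes "0 < s" "y \<in> {0..L}"
  shows "(\<integral>\<^sup>+ \<omega>. ennreal ((q * \<sigma> (u s y \<omega>))\<^sup>2) \<partial>M) \<le> ennreal (K\<^sup>2 * q\<^sup>2) * F s y"
proof -
  note [measurable] = u_measurable[OF assms]
  have "(\<integral>\<^sup>+ \<omega>. ennreal ((q * \<sigma> (u s y \<omega>))\<^sup>2) \<partial>M) \<le> (\<integral>\<^sup>+ \<omega>. ennreal (K\<^sup>2 * q\<^sup>2) * ennreal ((u s y \<omega>)\<^sup>2) \<partial>M)"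
  proof (rule nn_integral_mono)
    fix \<omega>
    have "\<bar>q * \<sigma> (u s y \<omega>)\<bar> \<le> \<bar>K * q * u s y \<omega>\<bar>"
      using mult_left_mono[OF \<sigma>_le[of "u s y \<omega>"], of "\<bar>q\<bar>"] lK by (simp add: abs_mult mult_ac)
    then have "(q * \<sigma> (u s y \<omega>))\<^sup>2 \<le> (K * q * u s y \<omega>)\<^sup>2" by (simp only: abs_le_square_iff)
    then show "ennreal ((q * \<sigma> (u s y \<omega>))\<^sup>2) \<le> ennreal (K\<^sup>2 * q\<^sup>2) * ennreal ((u s y \<omega>)\<^sup>2)"
      by (simp add: ennreal_mult[symmetric] power_mult_distrib)
  qed
  then show ?thesis by (simp add: F_def nn_integral_cmult)
qed

lemma sigma_moment_ge:
  assumes "0 < s" "y \<in> {0..L}"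
  shows "ennreal (l\<^sup>2 * q\<^sup>2) * F s y \<le> (\<integral>\<^sup>+ \<omega>. ennreal ((q * \<sigma> (u s y \<omega>))\<^sup>2) \<partial>M)"
proof -
  note [measurable] = u_measurable[OF assms]
  have "(\<integral>\<^sup>+ \<omega>. ennreal (l\<^sup>2 * q\<^sup>2) * ennreal ((u s y \<omega>)\<^sup>2) \<partial>M) \<le> (\<integral>\<^sup>+ \<omega>. ennreal ((q * \<sigma> (u s y \<omega>))\<^sup>2) \<partial>M)"
  proof (rule nn_integral_mono)
    fix \<omega>
    have "\<bar>l * q * u s y \<omega>\<bar> \<le> \<bar>q * \<sigma> (u s y \<omega>)\<bar>"
      using mult_left_mono[OF \<sigma>_ge[of "u s y \<omega>"], of "\<bar>q\<bar>"] lK by (simp add: abs_mult mult_ac)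
    then have "(l * q * u s y \<omega>)\<^sup>2 \<le> (q * \<sigma> (u s y \<omega>))\<^sup>2" by (simp only: abs_le_square_iff)
    then show "ennreal (l\<^sup>2 * q\<^sup>2) * ennreal ((u s y \<omega>)\<^sup>2) \<le> ennreal ((q * \<sigma> (u s y \<omega>))\<^sup>2)"
      by (simp add: ennreal_mult[symmetric] power_mult_distrib)
  qed
  then show ?thesis by (simp add: F_def nn_integral_cmult)
qed

lemma F_ge_initial: "0 < t \<Longrightarrow> x \<in> {0..L} \<Longrightarrow> ennreal ((J t x)\<^sup>2) \<le> F t x"
  by (simp add: second_moment_eq)

lemma kernel_section_measurable:
  assumes "0 < t" "x \<in> {0..L}"
  shows "(\<lambda>y. ennreal ((p t x y)\<^sup>2) * indicator {0..L} y) \<in> borel_measurable borel"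
    and "(\<lambda>y. ennreal ((p t x y)\<^sup>2) * indicator {0<..<L} y) \<in> borel_measurable borel"
proof -
  have m[measurable]: "(\<lambda>y. indicator {0..L} y *\<^sub>R p t x y) \<in> borel_measurable borel"
    by (rule borel_measurable_continuous_on_indicator) (auto intro: continuous_on_kernel_section assms)
  have "(\<lambda>y. ennreal ((indicator {0..L} y *\<^sub>R p t x y)\<^sup>2)) \<in> borel_measurable borel"
    "(\<lambda>y. ennreal ((indicator {0..L} y *\<^sub>R p t x y)\<^sup>2) * indicator {0<..<L} y) \<in> borel_measurable borel"
    by measurable
  moreover have "(\<lambda>y. ennreal ((p t x y)\<^sup>2) * indicator {0..L} y) = (\<lambda>y. ennreal ((indicator {0..L} y *\<^sub>R p t x y)\<^sup>2))"
    "(\<lambda>y. ennreal ((p t x y)\<^sup>2) * indicator {0<..<L} y) = (\<lambda>y. ennreal ((indicator {0..L} y *\<^sub>R p t x y)\<^sup>2) * indicator {0<..<L} y)"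
    by (auto simp: fun_eq_iff indicator_def)
  ultimately show "(\<lambda>y. ennreal ((p t x y)\<^sup>2) * indicator {0..L} y) \<in> borel_measurable borel"
    "(\<lambda>y. ennreal ((p t x y)\<^sup>2) * indicator {0<..<L} y) \<in> borel_measurable borel" by simp_all
qed

text \<open>The majorant \<open>G\<close> depends on time only, so the space integral falls on the
  squared kernel alone, and \<open>G\<close> supplies the measurability in time. Extending the time
  integral to negative \<open>s\<close> only increases it and matches
  \<open>Gamma_weight_nn_integral\<close>.\<close>

lemma F_le:
  assumes t: "0 < t" and x: "x \<in> {0..L}"
    and G: "\<And>s y. 0 < s \<Longrightarrow> s < t \<Longrightarrow> y \<in> {0..L} \<Longrightarrow> F s y \<le> ennreal (G s)"
    and G0: "\<And>s. 0 \<le> G s" and C: "0 \<le> C" and Gm[measurable]: "G \<in> borel_measurable borel"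
    and ker: "\<And>r. 0 < r \<Longrightarrow> r < t \<Longrightarrow> 3 / sqrt r + 8 / L ^ 3 * (L\<^sup>2 + r) \<le> C / sqrt r"
  shows "F t x \<le> ennreal ((J t x)\<^sup>2) + ennreal (lam\<^sup>2 * K\<^sup>2 * C) * (\<integral>\<^sup>+ s. ennreal (G s / sqrt (t - s)) * indicator {..<t} s \<partial>lborel)"
proof -
  have inner: "(\<integral>\<^sup>+ y. \<integral>\<^sup>+ \<omega>. ennreal ((if s < t then p (t - s) x y * \<sigma> (u s y \<omega>) else 0)\<^sup>2) * indicator ({0<..} \<times> {0<..<L}) (s, y) \<partial>M \<partial>lborel)
      \<le> ennreal (K\<^sup>2 * C) * (ennreal (G s / sqrt (t - s)) * indicator {..<t} s)" for s
  proof (cases "0 < s \<and> s < t")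
    case True
    have "(\<integral>\<^sup>+ y. \<integral>\<^sup>+ \<omega>. ennreal ((if s < t then p (t - s) x y * \<sigma> (u s y \<omega>) else 0)\<^sup>2) * indicator ({0<..} \<times> {0<..<L}) (s, y) \<partial>M \<partial>lborel)
       \<le> (\<integral>\<^sup>+ y. ennreal (K\<^sup>2 * G s) * (ennreal ((p (t - s) x y)\<^sup>2) * indicator {0..L} y) \<partial>lborel)"
    proof (rule nn_integral_mono)
      fix y
      show "(\<integral>\<^sup>+ \<omega>. ennreal ((if s < t then p (t - s) x y * \<sigma> (u s y \<omega>) else 0)\<^sup>2) * indicator ({0<..} \<times> {0<..<L}) (s, y) \<partial>M)
          \<le> ennreal (K\<^sup>2 * G s) * (ennreal ((p (t - s) x y)\<^sup>2) * indicator {0..L} y)"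
      proof (cases "y \<in> {0<..<L}")
        case y: True
        have "(\<integral>\<^sup>+ \<omega>. ennreal ((p (t - s) x y * \<sigma> (u s y \<omega>))\<^sup>2) \<partial>M) \<le> ennreal (K\<^sup>2 * (p (t - s) x y)\<^sup>2) * F s y"
          using True y by (intro sigma_moment_le) auto
        also have "\<dots> \<le> ennreal (K\<^sup>2 * (p (t - s) x y)\<^sup>2) * ennreal (G s)"
          using True y by (intro mult_left_mono G) auto
        finally show ?thesis using True y G0[of s] by (simp add: ennreal_mult mult_ac)
      qed simp
    qed
    also have "\<dots> = ennreal (K\<^sup>2 * G s) * (\<integral>\<^sup>+ y. ennreal ((p (t - s) x y)\<^sup>2) * indicator {0..L} y \<partial>lborel)"
      using kernel_section_measurable(1)[of "t - s" x] True x by (intro nn_integral_cmult) auto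
    also have "\<dots> \<le> ennreal (K\<^sup>2 * G s) * ennreal (C / sqrt (t - s))"
      using True x by (intro mult_left_mono order_trans[OF nn_integral_kernel_square_le] ennreal_leI ker) auto
    also have "\<dots> = ennreal (K\<^sup>2 * C) * (ennreal (G s / sqrt (t - s)) * indicator {..<t} s)"
      using True C G0[of s] by (simp add: mult_ac flip: ennreal_mult)
    finally show ?thesis .
  qed (auto simp: indicator_def)
  have "F t x \<le> ennreal ((J t x)\<^sup>2) + ennreal (lam\<^sup>2) *
      (\<integral>\<^sup>+ s. ennreal (K\<^sup>2 * C) * (ennreal (G s / sqrt (t - s)) * indicator {..<t} s) \<partial>lborel)"
    unfolding second_moment_eq[OF t x] by (intro add_left_mono mult_left_mono nn_integral_mono inner) auto
  also have "(\<integral>\<^sup>+ s. ennreal (K\<^sup>2 * C) * (ennreal (G s / sqrt (t - s)) * indicator {..<t} s) \<partial>lborel) =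
      ennreal (K\<^sup>2 * C) * (\<integral>\<^sup>+ s. ennreal (G s / sqrt (t - s)) * indicator {..<t} s \<partial>lborel)"
    by (intro nn_integral_cmult) simp
  finally show ?thesis using C by (simp add: ennreal_mult mult.assoc)
qed

text \<open>Only the last time window of length \<open>\<delta>\<close> is kept. There the squared
  kernel has integral at least \<open>c / sqrt \<delta>\<close>, and multiplication by the length of
  the window leaves \<open>c * sqrt \<delta>\<close>.\<close>

lemma F_ge:
  assumes t: "0 < t" and x: "x \<in> {0..L}" and \<delta>: "0 < \<delta>" "\<delta> < t" "sqrt \<delta> \<le> L / 2" and m: "0 \<le> m"
    and ge: "\<And>s y. t - \<delta> < s \<Longrightarrow> s < t \<Longrightarrow> y \<in> {0..L} \<Longrightarrow> ennreal m \<le> F s y"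
  shows "ennreal (lam\<^sup>2 * l\<^sup>2 * (exp (- 1) / (2 * pi)) * sqrt \<delta> * m) \<le> F t x"
proof -
  define c where "c = exp (- 1) / (2 * pi)"
  have c: "0 < c" by (simp add: c_def)
  have inner: "ennreal (l\<^sup>2 * c * m / sqrt \<delta>) * indicator {t - \<delta><..<t} s \<le>
      (\<integral>\<^sup>+ y. \<integral>\<^sup>+ \<omega>. ennreal ((if s < t then p (t - s) x y * \<sigma> (u s y \<omega>) else 0)\<^sup>2) * indicator ({0<..} \<times> {0<..<L}) (s, y) \<partial>M \<partial>lborel)" for s
  proof (cases "s \<in> {t - \<delta><..<t}")
    case True
    then have s: "0 < t - s" "t - s \<le> \<delta>" "0 < s" "s < t" using \<delta> by auto
    have sq: "sqrt (t - s) \<le> sqrt \<delta>" using s by simp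
    have "ennreal (l\<^sup>2 * c * m / sqrt \<delta>) = ennreal (l\<^sup>2 * m) * ennreal (c / sqrt \<delta>)"
      using m c \<delta> by (simp add: mult_ac flip: ennreal_mult)
    also have "\<dots> \<le> ennreal (l\<^sup>2 * m) * ennreal (c / sqrt (t - s))"
      using sq s c by (intro mult_left_mono ennreal_leI divide_left_mono) auto
    also have "\<dots> \<le> ennreal (l\<^sup>2 * m) * (\<integral>\<^sup>+ y. ennreal ((p (t - s) x y)\<^sup>2) * indicator {0<..<L} y \<partial>lborel)"
      using nn_integral_kernel_square_ge[OF s(1) _ x] sq \<delta>(3) unfolding c_def by (intro mult_left_mono) auto
    also have "\<dots> = (\<integral>\<^sup>+ y. ennreal (l\<^sup>2 * m) * (ennreal ((p (t - s) x y)\<^sup>2) * indicator {0<..<L} y) \<partial>lborel)"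
      using kernel_section_measurable(2)[of "t - s" x] s x by (intro nn_integral_cmult[symmetric]) auto
    also have "\<dots> \<le> (\<integral>\<^sup>+ y. \<integral>\<^sup>+ \<omega>. ennreal ((if s < t then p (t - s) x y * \<sigma> (u s y \<omega>) else 0)\<^sup>2) * indicator ({0<..} \<times> {0<..<L}) (s, y) \<partial>M \<partial>lborel)"
    proof (rule nn_integral_mono)
      fix y
      show "ennreal (l\<^sup>2 * m) * (ennreal ((p (t - s) x y)\<^sup>2) * indicator {0<..<L} y) \<le>
        (\<integral>\<^sup>+ \<omega>. ennreal ((if s < t then p (t - s) x y * \<sigma> (u s y \<omega>) else 0)\<^sup>2) * indicator ({0<..} \<times> {0<..<L}) (s, y) \<partial>M)"
      proof (cases "y \<in> {0<..<L}")
        case y: True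
        have "ennreal (l\<^sup>2 * m) * ennreal ((p (t - s) x y)\<^sup>2) = ennreal (l\<^sup>2 * (p (t - s) x y)\<^sup>2) * ennreal m"
          using m by (simp add: mult_ac flip: ennreal_mult)
        also have "\<dots> \<le> ennreal (l\<^sup>2 * (p (t - s) x y)\<^sup>2) * F s y"
          using True y by (intro mult_left_mono ge) auto
        also have "\<dots> \<le> (\<integral>\<^sup>+ \<omega>. ennreal ((p (t - s) x y * \<sigma> (u s y \<omega>))\<^sup>2) \<partial>M)"
          using s y by (intro sigma_moment_ge) auto
        finally show ?thesis using s y by simp
      qed simp
    qed
    finally show ?thesis using True by simp
  qed simp
  have "ennreal (lam\<^sup>2 * l\<^sup>2 * c * sqrt \<delta> * m) = ennreal (lam\<^sup>2) * (ennreal (l\<^sup>2 * c * m / sqrt \<delta>) * emeasure lborel {t - \<delta><..<t})"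
  proof -
    have "emeasure lborel {t - \<delta><..<t} = ennreal \<delta>" using \<delta> by simp
    moreover have "lam\<^sup>2 * (l\<^sup>2 * c * m / sqrt \<delta> * \<delta>) = lam\<^sup>2 * l\<^sup>2 * c * sqrt \<delta> * m"
      using real_div_sqrt[of \<delta>] \<delta> by (simp add: field_simps)
    ultimately show ?thesis using m c \<delta> by (simp add: ennreal_mult[symmetric])
  qed
  also have "\<dots> = ennreal (lam\<^sup>2) * (\<integral>\<^sup>+ s. ennreal (l\<^sup>2 * c * m / sqrt \<delta>) * indicator {t - \<delta><..<t} s \<partial>lborel)"
    by (simp add: nn_integral_cmult)
  also have "\<dots> \<le> ennreal ((J t x)\<^sup>2) + ennreal (lam\<^sup>2) * (\<integral>\<^sup>+ s. \<integral>\<^sup>+ y. \<integral>\<^sup>+ \<omega>. ennreal ((if s < t then p (t - s) x y * \<sigma> (u s y \<omega>) else 0)\<^sup>2) * indicator ({0<..} \<times> {0<..<L}) (s, y) \<partial>M \<partial>lborel \<partial>lborel)"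
    by (intro add_increasing mult_left_mono nn_integral_mono inner) auto
  finally show ?thesis unfolding second_moment_eq[OF t x] c_def .
qed


text \<open>The value of \<open>\<beta>\<close> is the one for which
  \<open>lam\<^sup>2 * K\<^sup>2 * C * Gamma (1/2) / sqrt \<beta>\<close> equals 1/2, so that one
  application of the renewal inequality costs half of the weighted supremum.\<close>

lemma F_exponential_upper_bound:
  assumes T: "0 < T" and U: "\<And>t x. 0 < t \<Longrightarrow> x \<in> {0..L} \<Longrightarrow> \<bar>J t x\<bar> \<le> U"
    and C: "0 < C" and ker: "\<And>r. 0 < r \<Longrightarrow> r < T \<Longrightarrow> 3 / sqrt r + 8 / L ^ 3 * (L\<^sup>2 + r) \<le> C / sqrt r"
    and \<beta>: "\<beta> = (2 * (lam\<^sup>2 * K\<^sup>2 * C * Gamma (1/2)))\<^sup>2"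
    and x: "x \<in> {0..L}"
  shows "F T x \<le> ennreal (2 * U\<^sup>2 * exp (\<beta> * T))"
proof -
  have g: "0 < lam\<^sup>2 * K\<^sup>2 * C * Gamma (1/2)" using lam lK C by (simp add: Gamma_one_half_real)
  have \<beta>0: "0 < \<beta>" unfolding \<beta> using g by (intro zero_less_power) simp
  have sqrt_\<beta>: "sqrt \<beta> = 2 * (lam\<^sup>2 * K\<^sup>2 * C * Gamma (1/2))" unfolding \<beta> real_sqrt_abs using g by simp
  obtain B where B: "0 \<le> B" "\<And>t x. 0 \<le> t \<Longrightarrow> t \<le> T \<Longrightarrow> x \<in> {0..L} \<Longrightarrow> F t x \<le> ennreal B"
    using F_bounded[OF T] by blast
  define f where "f t x = enn2real (F t x)" for t x
  have F_f: "F t x = ennreal (f t x)" if "0 < t" "x \<in> {0..L}" for t x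
    using F_finite[OF that] by (simp add: f_def)
  have f0: "0 \<le> f t x" for t x by (simp add: f_def)
  have fB: "f t x \<le> B" if "0 < t" "t \<le> T" "x \<in> {0..L}" for t x
    using B(2)[of t x] F_f[of t x] that B(1) by simp
  define X where "X = {0<..T} \<times> {0..L}"
  define h where "h z = exp (- \<beta> * fst z) * f (fst z) (snd z)" for z
  have X: "X \<noteq> {}" using T x by (auto simp: X_def)
  \<comment> \<open>The a priori moment bound enters here: without a finite supremum, half of it
    could not be subtracted below.\<close>
  have bdd: "bdd_above (h ` X)"
  proof (intro bdd_aboveI2[where M = B])
    fix z assume z: "z \<in> X"
    have "h z \<le> 1 * B" unfolding h_def using z \<beta>0 f0 fB
      by (intro mult_mono) (auto simp: X_def)
    then show "h z \<le> B" by simp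
  qed
  define S where "S = (SUP z\<in>X. h z)"
  have hS: "h z \<le> S" if "z \<in> X" for z unfolding S_def using that bdd by (intro cSUP_upper)
  have S0: "0 \<le> S"
  proof -
    have "0 \<le> h (T, x)" by (simp add: h_def f0)
    also have "\<dots> \<le> S" using T x by (intro hS) (simp add: X_def)
    finally show ?thesis .
  qed
  have fS: "f t y \<le> S * exp (\<beta> * t)" if "0 < t" "t \<le> T" "y \<in> {0..L}" for t y
    using hS[of "(t, y)"] that by (simp add: h_def X_def exp_minus field_simps)
  have "S \<le> U\<^sup>2 + S / 2"
    unfolding S_def
  proof (rule cSUP_least[OF X])
    fix z assume "z \<in> X"
    then obtain t y where z: "z = (t, y)" and t: "0 < t" "t \<le> T" and y: "y \<in> {0..L}" by (auto simp: X_def)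
    have "F t y \<le> ennreal ((J t y)\<^sup>2) + ennreal (lam\<^sup>2 * K\<^sup>2 * C) *
        (\<integral>\<^sup>+ s. ennreal ((S * exp (\<beta> * s)) / sqrt (t - s)) * indicator {..<t} s \<partial>lborel)"
    proof (rule F_le[OF t(1) y])
      show "F s y \<le> ennreal (S * exp (\<beta> * s))" if "0 < s" "s < t" "y \<in> {0..L}" for s y
        using that t by (simp add: F_f fS ennreal_leI)
      show "3 / sqrt r + 8 / L ^ 3 * (L\<^sup>2 + r) \<le> C / sqrt r" if "0 < r" "r < t" for r
        using that t by (intro ker) auto
    qed (use S0 C in auto)
    also have "(\<integral>\<^sup>+ s. ennreal ((S * exp (\<beta> * s)) / sqrt (t - s)) * indicator {..<t} s \<partial>lborel) =
        (\<integral>\<^sup>+ s. ennreal S * (ennreal (exp (\<beta> * s) / sqrt (t - s)) * indicator {..<t} s) \<partial>lborel)"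
      using S0 by (intro nn_integral_cong) (auto simp: indicator_def simp flip: ennreal_mult)
    also have "\<dots> = ennreal S * ennreal (exp (\<beta> * t) * (Gamma (1/2) / sqrt \<beta>))"
      by (simp add: nn_integral_cmult Gamma_weight_nn_integral[OF \<beta>0])
    finally have "ennreal (f t y) \<le> ennreal ((J t y)\<^sup>2 + lam\<^sup>2 * K\<^sup>2 * C * (S * (exp (\<beta> * t) * (Gamma (1/2) / sqrt \<beta>))))"
      using S0 C \<beta>0 F_f[OF t(1) y] by (simp add: Gamma_one_half_real flip: ennreal_mult ennreal_plus)
    then have "f t y \<le> (J t y)\<^sup>2 + lam\<^sup>2 * K\<^sup>2 * C * (S * (exp (\<beta> * t) * (Gamma (1/2) / sqrt \<beta>)))"
      using S0 C \<beta>0 by (subst (asm) ennreal_le_iff) (auto simp: Gamma_one_half_real)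
    also have "lam\<^sup>2 * K\<^sup>2 * C * (S * (exp (\<beta> * t) * (Gamma (1/2) / sqrt \<beta>))) = S / 2 * exp (\<beta> * t)"
      unfolding sqrt_\<beta> using lam lK C by (simp add: field_simps Gamma_one_half_real)
    also have "(J t y)\<^sup>2 \<le> U\<^sup>2" using U[OF t(1) y] by (simp add: abs_le_square_iff[symmetric])
    also have "U\<^sup>2 \<le> U\<^sup>2 * exp (\<beta> * t)" using \<beta>0 t by (simp add: mult_le_cancel_left1)
    finally have "f t y \<le> (U\<^sup>2 + S / 2) * exp (\<beta> * t)" by (simp add: distrib_right)
    then have "h z \<le> U\<^sup>2 + S / 2" by (simp add: h_def z exp_minus field_simps)
    then show "h z \<le> U\<^sup>2 + (SUP z\<in>X. h z) / 2" by (simp add: S_def)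
  qed
  then have "S \<le> 2 * U\<^sup>2" by simp
  then have "f T x \<le> 2 * U\<^sup>2 * exp (\<beta> * T)"
    using fS[of T x] T x by (meson exp_ge_zero mult_right_mono order_refl order_trans)
  then show ?thesis using F_f[OF T x] by (simp add: ennreal_leI)
qed

text \<open>The third condition on \<open>\<delta>\<close> says that the gain factor of
  \<open>F_ge\<close> is at least 2. A window of length \<open>\<delta>\<close> that ends after
  \<open>T/2 + real (Suc n) * \<delta>\<close> lies in the range of the previous step, so each
  further step in time yields one doubling.\<close>

lemma F_geometric_lower_bound:
  assumes T: "0 < T" and j: "0 < j" "\<And>t x. T/2 \<le> t \<Longrightarrow> t \<le> T \<Longrightarrow> x \<in> {0..L} \<Longrightarrow> j \<le> J t x"
    and \<delta>: "0 < \<delta>" "sqrt \<delta> \<le> L / 2" "2 \<le> lam\<^sup>2 * l\<^sup>2 * (exp (- 1) / (2 * pi)) * sqrt \<delta>"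
    and s: "T/2 + real n * \<delta> \<le> s" "s \<le> T" and x: "x \<in> {0..L}"
  shows "ennreal (j\<^sup>2 * 2 ^ n) \<le> F s x"
  using s x
proof (induction n arbitrary: s x)
  case 0
  then have "j\<^sup>2 \<le> (J s x)\<^sup>2" using j(1) j(2)[of s x] by (intro power_mono) auto
  then show ?case using F_ge_initial[of s x] 0 T by (simp add: order_trans[OF ennreal_leI])
next
  case (Suc n)
  have "0 \<le> real n * \<delta>" using \<delta> by simp
  then have s: "0 < s" "\<delta> < s" "T/2 + real n * \<delta> \<le> s - \<delta>" 
  proof -
    have "T/2 + real n * \<delta> + \<delta> \<le> s" using Suc.prems by (simp add: algebra_simps)
    then show "0 < s" "\<delta> < s" "T/2 + real n * \<delta> \<le> s - \<delta>" using \<open>0 \<le> real n * \<delta>\<close> T \<delta>(1) by linarith+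
  qed
  have "j\<^sup>2 * 2 ^ Suc n \<le> lam\<^sup>2 * l\<^sup>2 * (exp (- 1) / (2 * pi)) * sqrt \<delta> * (j\<^sup>2 * 2 ^ n)"
    using mult_right_mono[OF \<delta>(3), of "j\<^sup>2 * 2 ^ n"] by (simp add: mult_ac)
  then have "ennreal (j\<^sup>2 * 2 ^ Suc n) \<le> ennreal (lam\<^sup>2 * l\<^sup>2 * (exp (- 1) / (2 * pi)) * sqrt \<delta> * (j\<^sup>2 * 2 ^ n))"
    by (rule ennreal_leI)
  also have "\<dots> \<le> F s x"
    using s Suc.prems \<delta> by (intro F_ge Suc.IH) auto
  finally show ?case .
qed

lemma second_moment_integral:
  assumes "0 < t" "x \<in> {0..L}"
  shows "F t x = ennreal (\<integral>\<omega>. \<bar>u t x \<omega>\<bar>\<^sup>2 \<partial>M)"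
proof -
  note [measurable] = u_measurable[OF assms]
  have "integrable M (\<lambda>\<omega>. (u t x \<omega>)\<^sup>2)"
    using F_finite[OF assms] unfolding F_def by (intro integrableI_bounded) auto
  then show ?thesis unfolding F_def by (simp add: nn_integral_eq_integral)
qed

lemma inf_second_moment_ge:
  assumes "0 < t" "0 \<le> B" "\<And>x. x \<in> {0..L} \<Longrightarrow> ennreal B \<le> F t x"
  shows "B \<le> inf_second_moment M L u t"
  unfolding inf_second_moment_def using assms L
  by (intro cINF_greatest) (auto simp: second_moment_integral)

lemma sup_second_moment_le:
  assumes "0 < t" "0 \<le> B" "\<And>x. x \<in> {0..L} \<Longrightarrow> F t x \<le> ennreal B"
  shows "sup_second_moment M L u t \<le> B"
  unfolding sup_second_moment_def using assms L
  by (intro cSUP_least) (auto simp: second_moment_integral)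

text \<open>A supremum or infimum of reals is meaningful only for a bounded family; the upper bound
  comes from the moment condition, the lower bound is 0.\<close>

lemma inf_le_sup_second_moment:
  assumes "0 < t"
  shows "inf_second_moment M L u t \<le> sup_second_moment M L u t"
proof -
  obtain B where B: "0 \<le> B" "\<And>s x. 0 \<le> s \<Longrightarrow> s \<le> t \<Longrightarrow> x \<in> {0..L} \<Longrightarrow> F s x \<le> ennreal B"
    using F_bounded[OF assms] by blast
  have "(\<integral>\<omega>. \<bar>u t x \<omega>\<bar>\<^sup>2 \<partial>M) \<le> B" if "x \<in> {0..L}" for x
    using B(2)[of t x] B(1) that assms by (simp add: second_moment_integral)
  then have bdd: "bdd_above ((\<lambda>x. \<integral>\<omega>. \<bar>u t x \<omega>\<bar>\<^sup>2 \<partial>M) ` {0..L})" by (intro bdd_aboveI2)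
  have "inf_second_moment M L u t \<le> (\<integral>\<omega>. \<bar>u t 0 \<omega>\<bar>\<^sup>2 \<partial>M)"
    unfolding inf_second_moment_def using L by (intro cINF_lower bdd_belowI2[where m = 0]) auto
  also have "\<dots> \<le> sup_second_moment M L u t"
    unfolding sup_second_moment_def using L by (intro cSUP_upper bdd) auto
  finally show ?thesis .
qed

end

section \<open>Double logarithms and the conclusion\<close>

lemma loglog_mono: "r \<le> s \<Longrightarrow> loglog r \<le> loglog s"
  by (auto simp: loglog_def)

text \<open>A model function \<open>b * exp (c * x ^ 4)\<close> has limit 4 whatever the positive
  \<open>b\<close> and \<open>c\<close> are. A lower bound on \<open>f\<close> and an upper bound on
  \<open>g\<close> then suffice for both limits, by the chain
  \<open>4 \<le> Liminf f \<le> Limsup f \<le> Limsup g \<le> 4\<close> for the quotients.\<close>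

lemma Liminf_Limsup_loglog_eq_4:
  fixes f g :: "real \<Rightarrow> real"
  assumes le: "\<And>x. 0 < x \<Longrightarrow> f x \<le> g x"
    and a: "0 < a" "0 < d" and lower: "\<forall>\<^sub>F x in at_top. a * exp (d * x ^ 4) \<le> f x"
    and A: "0 < A" "0 < D" and upper: "\<forall>\<^sub>F x in at_top. g x \<le> A * exp (D * x ^ 4)"
  shows "Liminf at_top (\<lambda>x. loglog (f x) / ereal (ln x)) = 4 \<and> Limsup at_top (\<lambda>x. loglog (g x) / ereal (ln x)) = 4"
proof -
  have main: "((\<lambda>x. loglog (b * exp (c * x ^ 4)) / ereal (ln x)) \<longlongrightarrow> 4) at_top" if b: "0 < b" and c: "0 < c" for b c :: real
  proof -
    have "((\<lambda>x. ln (ln b + c * x ^ 4) / ln x) \<longlongrightarrow> 4) at_top"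
      using c by real_asymp
    then have lim: "((\<lambda>x. ereal (ln (ln b + c * x ^ 4) / ln x)) \<longlongrightarrow> 4) at_top"
      by (simp add: lim_ereal[symmetric] del: lim_ereal)
    \<comment> \<open>Eventually the argument exceeds 1, so the branch of \<open>loglog\<close> with
      value \<open>-\<infinity>\<close> is left.\<close>
    have "\<forall>\<^sub>F x in at_top. 1 < b * exp (c * x ^ 4)" using b c by real_asymp
    then have "\<forall>\<^sub>F x in at_top. ereal (ln (ln b + c * x ^ 4) / ln x) = loglog (b * exp (c * x ^ 4)) / ereal (ln x)"
      using eventually_gt_at_top[of 1]
    proof eventually_elim
      case (elim x)
      have "ln (b * exp (c * x ^ 4)) = ln b + c * x ^ 4" using b by (simp add: ln_mult)
      then show ?case using elim by (simp add: loglog_def)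
    qed
    then show ?thesis using lim by (rule Lim_transform_eventually[rotated])
  qed
  have mono: "\<forall>\<^sub>F x in at_top. loglog (h x) / ereal (ln x) \<le> loglog (k x) / ereal (ln x)"
    if "\<forall>\<^sub>F x in at_top. h x \<le> k x" for h k :: "real \<Rightarrow> real"
    using that eventually_gt_at_top[of 1]
    by eventually_elim (intro ereal_divide_right_mono loglog_mono, auto)
  have fg: "\<forall>\<^sub>F x in at_top. f x \<le> g x" using eventually_gt_at_top[of 0] by eventually_elim (rule le)
  let ?f = "\<lambda>x. loglog (f x) / ereal (ln x)" and ?g = "\<lambda>x. loglog (g x) / ereal (ln x)"
  have "4 \<le> Liminf at_top ?f"
    using Liminf_mono[OF mono[OF lower]] lim_imp_Liminf[OF _ main[OF a]] by simp
  moreover have "Liminf at_top ?f \<le> Limsup at_top ?f" by (rule Liminf_le_Limsup) simp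
  moreover have "Limsup at_top ?f \<le> Limsup at_top ?g" by (rule Limsup_mono[OF mono[OF fg]])
  moreover have "Limsup at_top ?g \<le> 4"
    using Limsup_mono[OF mono[OF upper]] lim_imp_Limsup[OF _ main[OF A]] by simp
  ultimately show ?thesis by (meson order.trans order.antisym)
qed

theorem theorem1p4:
  fixes M :: "'a measure"
    and W :: "(real \<times> real) set \<Rightarrow> 'a \<Rightarrow> real"
    and p :: "real \<Rightarrow> real \<Rightarrow> real \<Rightarrow> real"
    and \<sigma> u0 :: "real \<Rightarrow> real"
    and u :: "real \<Rightarrow> real \<Rightarrow> real \<Rightarrow> 'a \<Rightarrow> real"
    and L t :: real
  assumes "0 < L"
    and "prob_space M"
    and "white_noise M L W"
    and "neumann_heat_kernel L p"
    and "admissible_sigma \<sigma>"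
    and "admissible_initial L u0"
    and "\<And>lam. 0 < lam \<Longrightarrow> mild_solution M L W p \<sigma> u0 lam (u lam)"
    and "0 < t"
  shows "Liminf at_top
           (\<lambda>lam::real. loglog (inf_second_moment M L (u lam) t) / ereal (ln lam)) = 4 \<and>
         Limsup at_top
           (\<lambda>lam::real. loglog (sup_second_moment M L (u lam) t) / ereal (ln lam)) = 4"
proof -
  interpret neumann_kernel L p using assms(1,4) by unfold_locales
  obtain l K where lK: "0 < l" "0 < K" "\<And>x. l * \<bar>x\<bar> \<le> \<bar>\<sigma> x\<bar>" "\<And>x. \<bar>\<sigma> x\<bar> \<le> K * \<bar>x\<bar>" "\<sigma> \<in> borel_measurable borel"
    using admissible_sigma_bounds[OF assms(5)] by blast
  obtain U j where U: "0 \<le> U" and j: "0 < j"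
    and U_le: "\<forall>t>0. \<forall>x\<in>{0..L}. \<bar>LBINT y:{0..L}. u0 y * p t x y\<bar> \<le> U"
    and j_le: "\<forall>s\<in>{t/2..t}. \<forall>x\<in>{0..L}. j \<le> (LBINT y:{0..L}. u0 y * p s x y)"
    by (rule initial_flow_bounds[OF assms(6,8)])
  have field: "mild_field M L W p \<sigma> u0 lam (u lam) l K" if "0 < lam" for lam
    using assms that lK
    by (auto simp: mild_field_def mild_field_axioms_def noise_def noise_axioms_def neumann_kernel_def)
  \<comment> \<open>The kernel bound multiplied by \<open>sqrt r\<close>, with \<open>r\<close>
    replaced by its upper limit \<open>t\<close>.\<close>
  define C where "C = 3 + 8 / L ^ 3 * (L\<^sup>2 + t) * sqrt t"
  have C: "0 < C" using assms(1,8) by (auto simp: C_def intro!: add_pos_nonneg)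
  have ker: "3 / sqrt r + 8 / L ^ 3 * (L\<^sup>2 + r) \<le> C / sqrt r" if r: "0 < r" "r < t" for r
  proof -
    have "8 / L ^ 3 * (L\<^sup>2 + r) * sqrt r \<le> 8 / L ^ 3 * (L\<^sup>2 + t) * sqrt t"
      using r assms(1) by (intro mult_mono) auto
    then have "(3 + 8 / L ^ 3 * (L\<^sup>2 + r) * sqrt r) / sqrt r \<le> C / sqrt r"
      unfolding C_def using r by (intro divide_right_mono) auto
    then show ?thesis using r by (simp add: add_divide_distrib)
  qed
  define c where "c = exp (- 1) / (2 * pi)"
  have c: "0 < c" by (simp add: c_def)
  \<comment> \<open>With time steps satisfying \<open>sqrt \<delta> = q / lam\<^sup>2\<close>, the
    gain factor \<open>lam\<^sup>2 * l\<^sup>2 * c * sqrt \<delta>\<close> is exactly 2.\<close>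
  define q where "q = 2 / (l\<^sup>2 * c)"
  have q: "0 < q" using lK c by (simp add: q_def)
  show ?thesis
  proof (rule Liminf_Limsup_loglog_eq_4)
    show "inf_second_moment M L (u lam) t \<le> sup_second_moment M L (u lam) t" if "0 < lam" for lam
      by (rule mild_field.inf_le_sup_second_moment[OF field[OF that] assms(8)])
    show "0 < j\<^sup>2 / 2" "0 < ln 2 * t / (2 * q\<^sup>2)" using j q assms(8) by auto
    \<comment> \<open>\<open>U\<close> is only known to be nonnegative; \<open>U + 1\<close> keeps
      the prefactor positive, as its logarithm is taken.\<close>
    show "0 < 2 * (U + 1)\<^sup>2" "0 < (2 * (K\<^sup>2 * C * Gamma (1/2)))\<^sup>2 * t"
      using U lK C assms(8) by (auto simp: Gamma_one_half_real)
    show "\<forall>\<^sub>F lam in at_top. sup_second_moment M L (u lam) t \<le> 2 * (U + 1)\<^sup>2 * exp ((2 * (K\<^sup>2 * C * Gamma (1/2)))\<^sup>2 * t * lam ^ 4)"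
      using eventually_gt_at_top[of 0]
    proof eventually_elim
      case (elim lam)
      interpret mild_field M L W p \<sigma> u0 lam "u lam" l K by (rule field[OF elim])
      show ?case
      proof (rule sup_second_moment_le[OF assms(8)])
        fix x assume x: "x \<in> {0..L}"
        have "F t x \<le> ennreal (2 * (U + 1)\<^sup>2 * exp ((2 * (lam\<^sup>2 * K\<^sup>2 * C * Gamma (1/2)))\<^sup>2 * t))"
        proof (rule F_exponential_upper_bound[OF assms(8) _ C ker refl x])
          fix s x :: real assume "0 < s" "x \<in> {0..L}"
          then have "\<bar>J s x\<bar> \<le> U" using U_le by (simp add: J_def)
          then show "\<bar>J s x\<bar> \<le> U + 1" by simp
        qed
        also have "(2 * (lam\<^sup>2 * K\<^sup>2 * C * Gamma (1/2)))\<^sup>2 * t = (2 * (K\<^sup>2 * C * Gamma (1/2)))\<^sup>2 * t * lam ^ 4"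
          by (simp add: power_mult_distrib mult_ac flip: power_mult)
        finally show "F t x \<le> ennreal (2 * (U + 1)\<^sup>2 * exp ((2 * (K\<^sup>2 * C * Gamma (1/2)))\<^sup>2 * t * lam ^ 4))" .
      qed simp
    qed
    \<comment> \<open>For large \<open>lam\<close> the time step is short enough for the lower
      kernel bound, which requires \<open>sqrt \<delta> \<le> L / 2\<close>.\<close>
    have "\<forall>\<^sub>F lam in at_top. q / lam\<^sup>2 < L / 2" using q assms(1) by real_asymp
    then show "\<forall>\<^sub>F lam in at_top. j\<^sup>2 / 2 * exp (ln 2 * t / (2 * q\<^sup>2) * lam ^ 4) \<le> inf_second_moment M L (u lam) t"
      using eventually_gt_at_top[of 0]
    proof eventually_elim
      case (elim lam)
      interpret mild_field M L W p \<sigma> u0 lam "u lam" l K by (rule field[OF elim(2)])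
      define \<delta> where "\<delta> = (q / lam\<^sup>2)\<^sup>2"
      have \<delta>: "0 < \<delta>" "sqrt \<delta> = q / lam\<^sup>2" using q elim by (auto simp: \<delta>_def)
      \<comment> \<open>The number of whole time steps that fit between \<open>t/2\<close> and
        \<open>t\<close>. Rounding down loses less than one doubling, which accounts for the factor
        1/2 in \<open>j\<^sup>2 / 2\<close>.\<close>
      define m where "m = nat \<lfloor>t / (2 * \<delta>)\<rfloor>"
      have m0: "0 \<le> t / (2 * \<delta>)" using \<delta> assms(8) by simp
      then have m: "real m \<le> t / (2 * \<delta>)" "t / (2 * \<delta>) - 1 \<le> real m" unfolding m_def by linarith+
      have le: "t/2 + real m * \<delta> \<le> t" using m(1) \<delta>(1) by (simp add: field_simps)
      have two: "2 \<le> lam\<^sup>2 * l\<^sup>2 * (exp (- 1) / (2 * pi)) * sqrt \<delta>"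
        unfolding \<delta>(2) c_def[symmetric] using elim lK c by (simp add: q_def)
      have "j\<^sup>2 / 2 * exp (ln 2 * t / (2 * q\<^sup>2) * lam ^ 4) = j\<^sup>2 * (exp (ln 2 * (t / (2 * \<delta>))) / 2)"
        using q elim by (simp add: \<delta>_def field_simps flip: power_mult)
      also have "exp (ln 2 * (t / (2 * \<delta>))) / 2 = 2 powr (t / (2 * \<delta>) - 1)"
        by (simp add: powr_diff) (simp add: powr_def mult.commute)
      also have "\<dots> \<le> 2 powr (real m)" using m by (intro powr_mono) auto
      also have "\<dots> = 2 ^ m" by (simp add: powr_realpow)
      finally have le1: "j\<^sup>2 / 2 * exp (ln 2 * t / (2 * q\<^sup>2) * lam ^ 4) \<le> j\<^sup>2 * 2 ^ m"
        by (simp add: mult_left_mono)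
      have "j\<^sup>2 * 2 ^ m \<le> inf_second_moment M L (u lam) t"
      proof (rule inf_second_moment_ge[OF assms(8)])
        fix x assume x: "x \<in> {0..L}"
        show "ennreal (j\<^sup>2 * 2 ^ m) \<le> F t x"
        proof (rule F_geometric_lower_bound[OF assms(8) j _ \<delta>(1) _ two le order_refl x])
          show "j \<le> J s x" if "t/2 \<le> s" "s \<le> t" "x \<in> {0..L}" for s x
            using j_le that by (simp add: J_def)
          show "sqrt \<delta> \<le> L / 2" using elim(1) \<delta>(2) by simp
        qed
      qed simp
      then show ?case using le1 by simp
    qed
  qed
qed

end
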